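(* Let $m$ be a positive integer, $p\in(1,\infty)$, and let $E$ be a closed subset of $\mathbb{R}$ containing at least $m+1$ points. A function $f:E\to\mathbb{R}$ can be extended to a function $F\in W^m_p(\mathbb{R})$ if and only if the quantity $$\mathcal{W}_{m,p}(f:E)=\sup_{\{x_0,\dots,x_n\}\subset E}\left(\sum_{k=0}^{m}\sum_{i=0}^{n-k}\min\{1,x_{i+m}-x_i\}\,\bigl|\Delta^kf[x_i,\dots,x_{i+k}]\bigr|^p\right)^{1/p}$$ is finite. Here the supremum is taken over all finite strictly increasing sequences $\{x_0,\dots,x_n\}\subset E$ with $n\ge m$, and $x_j=+\infty$ whenever $j>n$. Furthermore, $$\|f\|_{W^m_p(\mathbb{R})|_E}\sim \mathcal{W}_{m,p}(f:E),$$ i.e. there is a constant $C\ge 1$ depending only on $m$ such that $C^{-1}\mathcal{W}_{m,p}(f:E)\le\|f\|_{W^m_p(\mathbb{R})|_E}\le C\,\mathcal{W}_{m,p}(f:E)$.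
   Context: $L^m_p(\mathbb{R})$ is the space of functions $F:\mathbb{R}\to\mathbb{R}$ such that $F^{(m-1)}$ exists and is (locally) absolutely continuous and $F^{(m)}\in L_p(\mathbb{R})$. $W^m_p(\mathbb{R})$ is the space of all $F\in L^m_p(\mathbb{R})$ whose derivatives of all orders $0,\dots,m$ belong to $L_p(\mathbb{R})$, normed by $\|F\|_{W^m_p(\mathbb{R})}=\sum_{k=0}^m\|F^{(k)}\|_{L_p(\mathbb{R})}$ (functions are identified with their continuous representatives). The trace norm is $\|f\|_{W^m_p(\mathbb{R})|_E}=\inf\{\|F\|_{W^m_p(\mathbb{R})}:F\in W^m_p(\mathbb{R}),\,F|_E=f\}$ (equal to $+\infty$ if there is no such $F$). For a $(k+1)$-point set $S=\{x_0,\dots,x_k\}\subset\mathbb{R}$, the $k$-th order divided difference $\Delta^kf[S]=\Delta^kf[x_0,\dots,x_k]$ is the coefficient of $x^k$ in the Lagrange polynomial of degree at most $k$ which agrees with $f$ on $S$ (so $\Delta^0f[x_0]=f(x_0)$). *)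

theory Defs
  imports "HOL-Analysis.Analysis" "HOL-Computational_Algebra.Polynomial"
begin

section \<open>Sobolev spaces on the real line\<close>

text \<open>
  A family \<open>d\<close> with \<open>d division_of (\<Union>d)\<close> is a finite family of non-overlapping compact
  intervals \<open>K = {Inf K..Sup K}\<close>.
\<close>

definition abs_continuous_on :: "real set \<Rightarrow> (real \<Rightarrow> real) \<Rightarrow> bool" where
  "abs_continuous_on S f \<longleftrightarrow>
     (\<forall>\<epsilon>>0. \<exists>\<delta>>0. \<forall>d. d division_of (\<Union>d) \<and> \<Union>d \<subseteq> S \<and> (\<Sum>K\<in>d. Sup K - Inf K) < \<delta>
        \<longrightarrow> (\<Sum>K\<in>d. \<bar>f (Sup K) - f (Inf K)\<bar>) < \<epsilon>)"

definition locally_abs_continuous :: "(real \<Rightarrow> real) \<Rightarrow> bool" where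
  "locally_abs_continuous f \<longleftrightarrow> (\<forall>a b. abs_continuous_on {a..b} f)"

definition Lp_space :: "real \<Rightarrow> (real \<Rightarrow> real) set" where
  "Lp_space p = {g \<in> borel_measurable lebesgue. integrable lebesgue (\<lambda>x. \<bar>g x\<bar> powr p)}"

definition Lp_norm :: "real \<Rightarrow> (real \<Rightarrow> real) \<Rightarrow> real" where
  "Lp_norm p g = (LINT x|lebesgue. \<bar>g x\<bar> powr p) powr (1 / p)"

text \<open>
  The \<open>m\<close>-th derivative of a member of \<open>hom_sobolev m p\<close> exists only almost everywhere; the
  unspecified value of \<^const>\<open>deriv\<close> at the exceptional null set does not affect
  \<^term>\<open>Lp_space p\<close> and \<^term>\<open>Lp_norm p\<close>, which refer to the complete measure
  \<^term>\<open>lebesgue\<close>.  The definitions are meant for \<open>m \<ge> 1\<close>.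
\<close>

definition hom_sobolev :: "nat \<Rightarrow> real \<Rightarrow> (real \<Rightarrow> real) set" where
  "hom_sobolev m p = {F.
     (\<forall>k<m - 1. \<forall>x. (deriv ^^ k) F differentiable at x) \<and>
     locally_abs_continuous ((deriv ^^ (m - 1)) F) \<and>
     (deriv ^^ m) F \<in> Lp_space p}"

definition sobolev :: "nat \<Rightarrow> real \<Rightarrow> (real \<Rightarrow> real) set" where
  "sobolev m p = {F \<in> hom_sobolev m p. \<forall>k\<le>m. (deriv ^^ k) F \<in> Lp_space p}"

definition sobolev_norm :: "nat \<Rightarrow> real \<Rightarrow> (real \<Rightarrow> real) \<Rightarrow> real" where
  "sobolev_norm m p F = (\<Sum>k\<le>m. Lp_norm p ((deriv ^^ k) F))"

text \<open>
  A function on \<open>E\<close> is represented by a total function of which only the values on \<open>E\<close> matter.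
  The infimum over the empty set is \<open>\<infinity>\<close> in \<^typ>\<open>ereal\<close>.
\<close>

definition sobolev_trace_norm ::
    "nat \<Rightarrow> real \<Rightarrow> real set \<Rightarrow> (real \<Rightarrow> real) \<Rightarrow> ereal" where
  "sobolev_trace_norm m p E f =
     (INF F \<in> {F \<in> sobolev m p. \<forall>x\<in>E. F x = f x}. ereal (sobolev_norm m p F))"

section \<open>Divided differences\<close>

definition lagrange_poly :: "(real \<Rightarrow> real) \<Rightarrow> real set \<Rightarrow> real poly" where
  "lagrange_poly f S = (THE P. degree P \<le> card S - 1 \<and> (\<forall>x\<in>S. poly P x = f x))"

definition divided_difference :: "(real \<Rightarrow> real) \<Rightarrow> real set \<Rightarrow> real" where
  "divided_difference f S = coeff (lagrange_poly f S) (card S - 1)"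

lemma lagrange_poly_unique_existence:
  fixes f :: "real \<Rightarrow> real"
  assumes "finite S" "S \<noteq> {}"
  shows "\<exists>!P. degree P \<le> card S - 1 \<and> (\<forall>x\<in>S. poly P x = f x)"
proof (rule ex_ex1I)
  define b where "b = (\<lambda>s. \<Prod>t\<in>S - {s}. [:- t, 1:] :: real poly)"
  define P where "P = (\<Sum>s\<in>S. smult (f s / poly (b s) s) (b s))"
  have nz: "poly (b s) s \<noteq> 0" for s
    using assms by (auto simp: b_def poly_prod)
  have z: "poly (b s) x = 0" if "x \<in> S" "x \<noteq> s" for s x
    using assms that by (auto simp: b_def poly_prod)
  have "degree (b s) \<le> card S - 1" if "s \<in> S" for s
  proof -
    have "degree (b s) \<le> (\<Sum>t\<in>S - {s}. degree [:- t, 1:])"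
      unfolding b_def using assms degree_prod_sum_le[of "S - {s}" "\<lambda>t. [:- t, 1:]"]
      by (simp add: o_def)
    then show ?thesis using assms that by simp
  qed
  then have "degree P \<le> card S - 1"
    unfolding P_def using assms
    by (intro degree_sum_le order.trans[OF degree_smult_le]) auto
  moreover have "poly P x = f x" if "x \<in> S" for x
  proof -
    have "poly P x = (\<Sum>s\<in>S. f s / poly (b s) s * poly (b s) x)"
      by (simp add: P_def poly_sum)
    also have "\<dots> = (\<Sum>s\<in>S. if s = x then f x else 0)"
      using nz z that by (intro sum.cong) auto
    finally show ?thesis using assms that by simp
  qed
  ultimately show "\<exists>P. degree P \<le> card S - 1 \<and> (\<forall>x\<in>S. poly P x = f x)" by blast
next
  fix P Q :: "real poly"
  assume P: "degree P \<le> card S - 1 \<and> (\<forall>x\<in>S. poly P x = f x)"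
    and Q: "degree Q \<le> card S - 1 \<and> (\<forall>x\<in>S. poly Q x = f x)"
  have "card S > 0" using assms by (simp add: card_gt_0_iff)
  then show "P = Q"
    using P Q by (intro poly_eqI_degree[of S]) auto
qed

section \<open>The functional\<close>

text \<open>
  A strictly increasing sequence \<open>x\<^sub>0 < \<dots> < x\<^sub>n\<close> is given by \<open>n\<close> and the values of \<open>x\<close> on
  \<open>{..n}\<close>.  The conditional encodes the convention \<open>x\<^sub>j = +\<infinity>\<close> for \<open>j > n\<close>, for which
  \<open>min {1, x\<^sub>j - x\<^sub>i} = 1\<close>.
\<close>

definition W_weight :: "nat \<Rightarrow> nat \<Rightarrow> (nat \<Rightarrow> real) \<Rightarrow> nat \<Rightarrow> real" where
  "W_weight m n x i = (if i + m \<le> n then min 1 (x (i + m) - x i) else 1)"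

definition W_functional ::
    "nat \<Rightarrow> real \<Rightarrow> real set \<Rightarrow> (real \<Rightarrow> real) \<Rightarrow> ereal" where
  "W_functional m p E f =
     (SUP (n, x) \<in> {(n, x). m \<le> n \<and> strict_mono_on {..n} x \<and> x ` {..n} \<subseteq> E}.
        ereal ((\<Sum>k\<le>m. \<Sum>i\<le>n - k.
          W_weight m n x i * \<bar>divided_difference f (x ` {i..i + k})\<bar> powr p) powr (1 / p)))"

end

(*
  Necessity: a divided difference of order k < m is a value of F^(k)/k!, which on an interval of
  length L <= 1 is controlled by the L_p-averages of F^(k) and F^(k+1); a window longer than 1 is
  first reduced to shorter ones by the recursion for divided differences. For k = m one uses
  |F^(m-1)(b) - F^(m-1)(a)| <= int_a^b |F^(m)|, which needs that absolutely continuous functions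
  are differentiable almost everywhere. The windows [x_i, x_{i+m}] have overlap at most m + 1.

  Sufficiency for finitely many points of an interval of length 2: if P_i interpolates f at
  x_i, ..., x_{i+m-1}, then F = P_0 + sum_i theta_i (P_{i+1} - P_i) interpolates f, where theta_i
  passes from 0 to 1 on the largest of the gaps between x_i and x_{i+m}. Since
  P_{i+1} - P_i = (x_{i+m} - x_i) Delta^m f[x_i, ..., x_{i+m}] prod_{0<j<m} (x - x_{i+j}),
  and that gap has length at least (x_{i+m} - x_i)/m, |F^(m)| is at most a constant times
  |Delta^m f[x_i, ..., x_{i+m}]| there. Such local extensions over [z - 1, z + 1], z an integer,
  are glued by a partition of unity. No maximal function is involved, so that the constants do not
  depend on p.

  For general E the extensions from an increasing sequence of finite subsets with dense union are
  uniformly Hoelder continuous together with their derivatives up to order m - 1, so a subsequence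
  converges; the limit lies in W^m_p by Fatou's lemma for difference quotients.
*)
theory Submission
  imports Defs "HOL-Complex_Analysis.Great_Picard"
begin

section \<open>Divided differences\<close>

text \<open>The weight min {1, x_{i+m} - x_i} also multiplies the differences of order below m, so
  on tightly clustered points the sum for the given sequence hardly controls them. Two things remove
  this obstacle. The construction needs low orders only at the leftmost point of a cluster: in
  Newton's form P_0 involves no other differences of order below m, and every later correction is
  paid for by a difference of order m with its natural weight. And the supremum may be tested on
  thinned sequences in which the window starting at that point has weight 1; to have room between
  the clusters, the integers z are split into residue classes mod 3. The constants are free of p
  because the estimates are kept in the form X^p <= c^p Y with c >= 1 depending on m only: a
  numerical factor c is enlarged to c^p, boundedly many terms are added by the power mean
  inequality, and the root is taken at the end.\<close>

lemma lagrange_poly_props: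
  assumes "finite S" "S \<noteq> {}"
  shows "degree (lagrange_poly f S) \<le> card S - 1" and "x \<in> S \<Longrightarrow> poly (lagrange_poly f S) x = f x"
  using theI'[OF lagrange_poly_unique_existence[OF assms, of f]]
  unfolding lagrange_poly_def by auto

lemma lagrange_poly_eqI:
  assumes "finite S" "S \<noteq> {}" "degree P \<le> card S - 1" "\<And>x. x \<in> S \<Longrightarrow> poly P x = f x"
  shows "lagrange_poly f S = P"
  using lagrange_poly_unique_existence[OF assms(1,2), of f] lagrange_poly_props[OF assms(1,2), where f = f] assms(3,4)
  by blast

lemma degree_nodal_poly: "degree (\<Prod>s\<in>S. [:- s, 1::real:]) \<le> card S"
proof (cases "finite S")
  case True
  then show ?thesis
    using degree_prod_sum_le[of S "\<lambda>s. [:- s, 1::real:]"] by (simp add: o_def)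
qed simp

lemma coeff_nodal_poly: 
  assumes "finite S" shows "coeff (\<Prod>s\<in>S. [:- s, 1::real:]) (card S) = 1"
  using assms
proof (induction S)
  case (insert a S)
  have "coeff (\<Prod>s\<in>S. [:- s, 1::real:]) (Suc (card S)) = 0"
    using degree_nodal_poly[of S] by (intro coeff_eq_0) auto
  then show ?case using insert by simp
qed simp

text \<open>Newton's formula. The multiple of the nodal polynomial that corrects the value at
  \<open>a\<close> yields the interpolant by uniqueness; the nodal polynomial being monic of degree
  \<open>card S\<close>, the multiplier is the leading coefficient.\<close>

lemma lagrange_poly_insert:
  assumes "finite S" "S \<noteq> {}" "a \<notin> S"
  shows "lagrange_poly f (insert a S) =
    lagrange_poly f S + smult (divided_difference f (insert a S)) (\<Prod>s\<in>S. [:- s, 1:])"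
proof -
  let ?L = "lagrange_poly f S" and ?N = "\<Prod>s\<in>S. [:- s, 1::real:]"
  define c where "c = (f a - poly ?L a) / poly ?N a"
  have nz: "poly ?N a \<noteq> 0" using assms by (auto simp: poly_prod)
  have cS: "card S > 0" using assms by (simp add: card_gt_0_iff)
  have dL: "degree ?L < card S" using lagrange_poly_props(1)[OF assms(1,2), where f = f] cS by linarith
  have eq: "lagrange_poly f (insert a S) = ?L + smult c ?N"
  proof (rule lagrange_poly_eqI)
    show "degree (?L + smult c ?N) \<le> card (insert a S) - 1"
      using assms dL degree_nodal_poly[of S]
      by (auto intro!: degree_add_le order.trans[OF degree_smult_le])
    show "poly (?L + smult c ?N) x = f x" if "x \<in> insert a S" for x
    proof (cases "x = a")
      case True
      then show ?thesis using nz by (simp add: c_def)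
    next
      case False
      then have "x \<in> S" using that by auto
      then have "poly ?N x = 0" using assms by (auto simp: poly_prod)
      then show ?thesis using lagrange_poly_props(2)[OF assms(1,2) \<open>x \<in> S\<close>, where f = f] by simp
    qed
  qed (use assms in auto)
  have "divided_difference f (insert a S) = c"
    using assms dL by (simp add: divided_difference_def eq coeff_nodal_poly coeff_eq_0)
  with eq show ?thesis by simp
qed

lemma divided_difference_singleton [simp]: "divided_difference f {a} = f a"
proof -
  have "lagrange_poly f {a} = [:f a:]" by (rule lagrange_poly_eqI) auto
  then show ?thesis by (simp add: divided_difference_def)
qed

text \<open>Adding the two nodes in either order gives two Newton forms of one polynomial. They are
  compared at a point off \<open>S\<close>, where the common nodal factor can be cancelled. The case
  of empty \<open>S\<close> is separate because Newton's formula starts from a nonempty set.\<close>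

lemma divided_difference_recursion:
  assumes "finite S" "a \<notin> S" "b \<notin> S" "a \<noteq> b"
  shows "(b - a) * divided_difference f (insert a (insert b S)) =
    divided_difference f (insert b S) - divided_difference f (insert a S)"
proof (cases "S = {}")
  case True
  have "lagrange_poly f {a} = [:f a:]" by (rule lagrange_poly_eqI) auto
  then have "lagrange_poly f {a, b} = [:f a:] + smult (divided_difference f {a, b}) [:- a, 1:]"
    using lagrange_poly_insert[of "{a}" b f] assms by (simp add: insert_commute)
  moreover have "poly (lagrange_poly f {a, b}) b = f b" by (rule lagrange_poly_props(2)) auto
  ultimately show ?thesis using True by (simp add: algebra_simps)
next
  case False
  let ?L = "lagrange_poly f S" and ?N = "\<Prod>s\<in>S. [:- s, 1::real:]"
  let ?A = "divided_difference f (insert a S)" and ?B = "divided_difference f (insert b S)"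
    and ?D = "divided_difference f (insert a (insert b S))"
  obtain t where t: "t \<notin> S" using assms(1) ex_new_if_finite[OF infinite_UNIV_char_0] by blast
  then have nz: "poly ?N t \<noteq> 0" using assms by (auto simp: poly_prod)
  have e1: "lagrange_poly f (insert a (insert b S)) = ?L + smult ?B ?N + smult ?D ([:- b, 1:] * ?N)"
    using lagrange_poly_insert[of "insert b S" a f] lagrange_poly_insert[of S b f] False assms by simp
  have e2: "lagrange_poly f (insert a (insert b S)) = ?L + smult ?A ?N + smult ?D ([:- a, 1:] * ?N)"
    using lagrange_poly_insert[of "insert a S" b f] lagrange_poly_insert[of S a f] False assms
    by (simp add: insert_commute)
  have "poly (?L + smult ?B ?N + smult ?D ([:- b, 1:] * ?N)) t =
      poly (?L + smult ?A ?N + smult ?D ([:- a, 1:] * ?N)) t"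
    by (simp only: e1[symmetric] e2[symmetric])
  then have "(?B + ?D * (t - b)) * poly ?N t = (?A + ?D * (t - a)) * poly ?N t"
    by (simp add: algebra_simps)
  with nz have "?B + ?D * (t - b) = ?A + ?D * (t - a)" by (simp only: mult_cancel_right) simp
  then show ?thesis by (simp add: algebra_simps)
qed

lemma divided_difference_step:
  fixes x :: "nat \<Rightarrow> real"
  assumes "inj_on x {i..i + Suc k}"
  shows "(x (i + Suc k) - x i) * divided_difference f (x ` {i..i + Suc k}) =
    divided_difference f (x ` {Suc i..Suc i + k}) - divided_difference f (x ` {i..i + k})"
proof -
  let ?S = "x ` {Suc i..i + k}"
  have 1: "{i..i + Suc k} = insert i (insert (i + Suc k) {Suc i..i + k})"
    and 2: "{Suc i..Suc i + k} = insert (i + Suc k) {Suc i..i + k}"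
    and 3: "{i..i + k} = insert i {Suc i..i + k}" by auto
  have "x i \<notin> ?S" "x (i + Suc k) \<notin> ?S" "x i \<noteq> x (i + Suc k)"
    using inj_on_eq_iff[OF assms] by fastforce+
  then show ?thesis
    using divided_difference_recursion[of ?S "x i" "x (i + Suc k)" f] unfolding 1 2 3 by simp
qed

section \<open>Functions given together with their derivatives\<close>

text \<open>The derivatives are carried along explicitly instead of being iterates of
  \<open>deriv\<close>: sums, affine substitutions, gluings and Leibniz products are then formed
  term by term. \<open>D m\<close> need not be continuous; in a chain of length \<open>Suc m\<close>
  it is, which is why the extensions below are built with one order more.\<close>

definition deriv_chain :: "nat \<Rightarrow> (nat \<Rightarrow> real \<Rightarrow> real) \<Rightarrow> bool" where
  "deriv_chain m D \<longleftrightarrow> (\<forall>k<m. \<forall>t. (D k has_real_derivative D (Suc k) t) (at t))"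

lemma deriv_chainD: "deriv_chain m D \<Longrightarrow> k < m \<Longrightarrow> (D k has_real_derivative D (Suc k) t) (at t)"
  by (simp add: deriv_chain_def)

lemma deriv_chain_mono: "deriv_chain m D \<Longrightarrow> k \<le> m \<Longrightarrow> deriv_chain k D"
  by (simp add: deriv_chain_def)

lemma deriv_chain_continuous: "deriv_chain m D \<Longrightarrow> k < m \<Longrightarrow> continuous_on S (D k)"
  by (meson DERIV_isCont continuous_at_imp_continuous_on deriv_chainD)

lemma deriv_chain_add:
  "deriv_chain m A \<Longrightarrow> deriv_chain m B \<Longrightarrow> deriv_chain m (\<lambda>k t. A k t + B k t)"
  by (auto simp: deriv_chain_def intro!: derivative_intros)

lemma deriv_chain_diff:
  "deriv_chain m A \<Longrightarrow> deriv_chain m B \<Longrightarrow> deriv_chain m (\<lambda>k t. A k t - B k t)"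
  by (auto simp: deriv_chain_def intro!: derivative_intros)

lemma deriv_chain_cmult: "deriv_chain m A \<Longrightarrow> deriv_chain m (\<lambda>k t. c * A k t)"
  by (auto simp: deriv_chain_def intro!: derivative_eq_intros)

lemma deriv_chain_sum:
  "(\<And>i. i \<in> I \<Longrightarrow> deriv_chain m (A i)) \<Longrightarrow> deriv_chain m (\<lambda>k t. \<Sum>i\<in>I. A i k t)"
  by (auto simp: deriv_chain_def intro!: derivative_intros)

lemma deriv_chain_affine:
  assumes "deriv_chain m A" shows "deriv_chain m (\<lambda>k t. c ^ k * A k (c * t + d))"
proof -
  have "((\<lambda>t. c ^ k * A k (c * t + d)) has_real_derivative c ^ Suc k * A (Suc k) (c * t + d)) (at t)" 
    if "k < m" for k t
  proof -
    have "((\<lambda>t. c * t + d) has_real_derivative c) (at t)" by (auto intro!: derivative_eq_intros)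
    then have "((\<lambda>t. A k (c * t + d)) has_real_derivative A (Suc k) (c * t + d) * c) (at t)"
      using DERIV_chain2[where f = "A k" and g = "\<lambda>t. c * t + d"] deriv_chainD[OF assms that] by blast
    from DERIV_cmult[OF this, of "c ^ k"] show ?thesis by (simp add: algebra_simps)
  qed
  then show ?thesis by (simp add: deriv_chain_def)
qed

lemma deriv_chain_poly: "deriv_chain m (\<lambda>k. poly ((pderiv ^^ k) P))"
  by (auto simp: deriv_chain_def intro!: poly_DERIV)

lemma poly_higher_pderiv_top:
  fixes P :: "real poly"
  assumes "degree P \<le> k" shows "poly ((pderiv ^^ k) P) t = fact k * coeff P k"
proof -
  have "degree ((pderiv ^^ k) P) = 0" using assms by (simp add: degree_higher_pderiv)
  then obtain c where c: "(pderiv ^^ k) P = [:c:]" by (rule degree_eq_zeroE)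
  then have "c = coeff ((pderiv ^^ k) P) 0" by simp
  also have "\<dots> = fact k * coeff P k" by (simp add: coeff_higher_pderiv pochhammer_fact)
  finally show ?thesis using c by simp
qed

text \<open>Rolle's theorem between neighbouring zeros leaves one zero fewer for the next
  derivative; after \<open>k\<close> rounds one zero is left.\<close>

lemma generalized_rolle:
  assumes "deriv_chain k D" "strict_mono_on {..k} x" "\<And>i. i \<le> k \<Longrightarrow> D 0 (x i) = 0"
  shows "\<exists>\<xi>\<in>{x 0..x k}. D k \<xi> = 0"
  using assms
proof (induction k arbitrary: D x)
  case 0
  then show ?case by auto
next
  case (Suc k)
  have "\<exists>z. x i < z \<and> z < x (Suc i) \<and> D 1 z = 0" if "i \<le> k" for i
  proof -
    have lt: "x i < x (Suc i)" using Suc.prems(2) that by (auto simp: strict_mono_on_def)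
    have der: "(D 0 has_real_derivative D 1 t) (at t)" for t
      using deriv_chainD[OF Suc.prems(1), of 0 t] by simp
    have "\<exists>z. x i < z \<and> z < x (Suc i) \<and> (\<lambda>h. D 1 z * h) = (\<lambda>v. 0)"
    proof (rule Rolle_deriv[OF lt])
      show "D 0 (x i) = D 0 (x (Suc i))" using Suc.prems(3) that by auto
      show "continuous_on {x i..x (Suc i)} (D 0)"
        by (rule deriv_chain_continuous[OF Suc.prems(1)]) simp
      show "(D 0 has_derivative (\<lambda>h. D 1 t * h)) (at t)" for t
        using der[of t] by (simp add: has_field_derivative_def)
    qed
    then show ?thesis by (metis mult.right_neutral)
  qed
  then obtain y where y: "\<And>i. i \<le> k \<Longrightarrow> x i < y i \<and> y i < x (Suc i) \<and> D 1 (y i) = 0" by metis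
  have xm: "x i \<le> x j" if "i \<le> j" "j \<le> Suc k" for i j
    using Suc.prems(2) that unfolding strict_mono_on_def
    by (metis atMost_iff le_trans less_eq_real_def order.order_iff_strict)
  have "y i < y j" if "i < j" "j \<le> k" for i j
    using y[of i] y[of j] xm[of "Suc i" j] that by fastforce
  then have "strict_mono_on {..k} y" by (auto simp: strict_mono_on_def)
  moreover have "deriv_chain k (\<lambda>i. D (Suc i))" using Suc.prems(1) by (auto simp: deriv_chain_def)
  ultimately have "\<exists>\<xi>\<in>{y 0..y k}. D (Suc k) \<xi> = 0"
    using Suc.IH[of "\<lambda>i. D (Suc i)" y] y by simp
  moreover have "{y 0..y k} \<subseteq> {x 0..x (Suc k)}" using y[of 0] y[of k] by auto
  ultimately show ?case by blast
qed

text \<open>\<open>D 0\<close> minus its interpolant vanishes at all k + 1 points, and the k-th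
  derivative of the interpolant is the constant k! times its leading coefficient, the divided
  difference.\<close>

lemma divided_difference_mean_value:
  assumes D: "deriv_chain k D" and x: "strict_mono_on {i..i + k} x"
  shows "\<exists>\<xi>\<in>{x i..x (i + k)}. divided_difference (D 0) (x ` {i..i + k}) = D k \<xi> / fact k"
proof -
  let ?S = "x ` {i..i + k}"
  define P where "P = lagrange_poly (D 0) ?S"
  have inj: "inj_on x {i..i + k}" using x by (rule strict_mono_on_imp_inj_on)
  have card: "card ?S = Suc k" using card_image[OF inj] by simp
  have deg: "degree P \<le> k" using lagrange_poly_props(1)[of ?S "D 0"] card by (simp add: P_def)
  have eq: "poly P (x j) = D 0 (x j)" if "j \<in> {i..i + k}" for j
    unfolding P_def using that by (intro lagrange_poly_props(2)) auto
  define H where "H = (\<lambda>j t. D j t - poly ((pderiv ^^ j) P) t)"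
  have "deriv_chain k H" unfolding H_def by (intro deriv_chain_diff D deriv_chain_poly)
  moreover have "strict_mono_on {..k} (\<lambda>j. x (i + j))" using x by (auto simp: strict_mono_on_def)
  moreover have "H 0 (x (i + j)) = 0" if "j \<le> k" for j using eq[of "i + j"] that by (simp add: H_def)
  ultimately obtain \<xi> where \<xi>: "\<xi> \<in> {x i..x (i + k)}" "H k \<xi> = 0"
    using generalized_rolle[of k H "\<lambda>j. x (i + j)"] by auto
  have "D k \<xi> = fact k * coeff P k" using \<xi>(2) poly_higher_pderiv_top[OF deg] by (simp add: H_def)
  then have "divided_difference (D 0) ?S = D k \<xi> / fact k"
    by (simp add: divided_difference_def card P_def)
  then show ?thesis using \<xi> by blast
qed

section \<open>Absolutely continuous functions\<close>

text \<open>The covering theorem yields a countable disjoint family that covers \<open>E\<close> up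
  to a null set, and finitely many of its members exhaust its measure up to \<open>e\<close>;
  \<open>T\<close> absorbs both losses. Since \<open>E\<close> need not be measurable, the result is
  phrased as an inclusion. The point x may be an end point of its intervals.\<close>

lemma vitali_finite:
  fixes E :: "real set"
  assumes U: "open U" "U \<in> lmeasurable" "E \<subseteq> U" and e: "e > 0"
    and P: "\<And>x d. x \<in> E \<Longrightarrow> d > 0 \<Longrightarrow> \<exists>y z. y < z \<and> y \<le> x \<and> x \<le> z \<and> z - y < d \<and> P y z"
  obtains D T where "D division_of \<Union>D" "\<Union>D \<subseteq> U"
    "\<And>K. K \<in> D \<Longrightarrow> \<exists>y z. y < z \<and> K = {y..z} \<and> P y z"
    "E \<subseteq> \<Union>D \<union> T" "T \<in> lmeasurable" "measure lebesgue T < e"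
proof -
  define I where "I = {(y, z). y < z \<and> P y z \<and> {y..z} \<subseteq> U}"
  \<comment> \<open>Intervals are coded by their end points; \<open>c\<close> and \<open>r\<close>
    present them as closed balls, the form in which the covering theorem speaks of them.\<close>
  define c where "c = (\<lambda>(y, z). (y + z) / 2 :: real)"
  define r where "r = (\<lambda>(y, z). (z - y) / 2 :: real)"
  have ball: "cball (c i) (r i) = {fst i..snd i}" for i
    by (auto simp: c_def r_def cball_eq_atLeastAtMost field_simps split: prod.splits)
  obtain C where C: "countable C" "C \<subseteq> I"
     "pairwise (\<lambda>i j. disjnt (cball (c i) (r i)) (cball (c j) (r j))) C"
     "negligible (E - (\<Union>i\<in>C. cball (c i) (r i)))"
  proof (rule Vitali_covering_theorem_cballs[of I r E c])
    show "0 < r i" if "i \<in> I" for i using that by (auto simp: I_def r_def)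
    show "\<exists>i. i \<in> I \<and> x \<in> cball (c i) (r i) \<and> r i < d" if x: "x \<in> E" and d: "0 < d" for x d
    proof -
      obtain \<eta> where \<eta>: "\<eta> > 0" "ball x \<eta> \<subseteq> U" using U x open_contains_ball by blast
      obtain y z where yz: "y < z" "y \<le> x" "x \<le> z" "z - y < min d \<eta>" "P y z"
        using P[OF x, of "min d \<eta>"] d \<eta> by auto
      have "{y..z} \<subseteq> ball x \<eta>" using yz by (auto simp: dist_real_def)
      then have "(y, z) \<in> I" using yz \<eta> by (auto simp: I_def)
      moreover have "r (y, z) < d" using yz by (auto simp: r_def)
      ultimately show ?thesis using yz ball by fastforce
    qed
  qed
  define \<D> where "\<D> = (\<lambda>i. cball (c i) (r i)) ` C"
  have cl: "K \<in> sets lebesgue" if "K \<in> \<D>" for K using that by (auto simp: \<D>_def)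
  have sub: "\<Union>\<D> \<subseteq> U"
  proof -
    have "cball (c i) (r i) \<subseteq> U" if "i \<in> C" for i
      using that C(2) unfolding ball by (auto simp: I_def subset_eq)
    then show ?thesis by (auto simp: \<D>_def)
  qed
  have cD: "countable \<D>" using C by (auto simp: \<D>_def)
  have meas: "\<Union>\<D> \<in> lmeasurable"
    by (rule fmeasurableI2[OF U(2) sub]) (intro sets.countable_Union cD subsetI cl)
  obtain D where D: "D \<subseteq> \<D>" "finite D" "measure lebesgue (\<Union>\<D>) - e < measure lebesgue (\<Union>D)"
  proof (rule measure_countable_Union_approachable[OF cD e])
    show "d \<in> lmeasurable" if "d \<in> \<D>" for d using that by (auto simp: \<D>_def)
    show "measure lebesgue (\<Union>D') \<le> measure lebesgue (\<Union>\<D>)" if "D' \<subseteq> \<D>" "finite D'" for D'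
      using that cl by (intro measure_mono_fmeasurable meas Union_mono) auto
  qed
  define T where "T = (E - \<Union>\<D>) \<union> (\<Union>\<D> - \<Union>D)"
  have neg: "negligible (E - \<Union>\<D>)" using C(4) by (simp add: \<D>_def)
  have mD: "\<Union>D \<in> lmeasurable"
    using D cl by (intro fmeasurableI2[OF meas] Union_mono) auto
  have dm: "\<Union>\<D> - \<Union>D \<in> lmeasurable" using meas fmeasurableD[OF mD] by (rule fmeasurable_Diff)
  show ?thesis
  proof
    have int: "\<exists>y z. y < z \<and> K = {y..z} \<and> P y z" if KD: "K \<in> \<D>" for K
    proof -
      from KD obtain i where i: "K = cball (c i) (r i)" "i \<in> C" unfolding \<D>_def by (rule imageE)
      then have "i \<in> I" using C by auto
      then have "fst i < snd i \<and> P (fst i) (snd i)" by (auto simp: I_def)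
      moreover have "K = {fst i..snd i}" using i(1) unfolding ball .
      ultimately show ?thesis by blast
    qed
    show "\<exists>y z. y < z \<and> K = {y..z} \<and> P y z" if "K \<in> D" for K
      using int[OF subsetD[OF D(1) that]] .
    have disj: "K1 \<inter> K2 = {}" if K: "K1 \<in> D" "K2 \<in> D" "K1 \<noteq> K2" for K1 K2
    proof -
      obtain i where i: "K1 = cball (c i) (r i)" "i \<in> C"
        using subsetD[OF D(1) K(1)] unfolding \<D>_def by (rule imageE)
      obtain j where j: "K2 = cball (c j) (r j)" "j \<in> C"
        using subsetD[OF D(1) K(2)] unfolding \<D>_def by (rule imageE)
      have "i \<noteq> j" using i j K(3) by blast
      from pairwiseD[OF C(3) i(2) j(2) this] show ?thesis by (simp add: disjnt_def i(1) j(1))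
    qed
    show "D division_of \<Union>D"
    proof (rule division_ofI)
      show "finite D" by fact
      show "K \<subseteq> \<Union>D" if "K \<in> D" for K using that by blast
      fix K assume K: "K \<in> D"
      obtain y z where yz: "y < z" "K = {y..z}" using int[OF subsetD[OF D(1) K]] by blast
      show "K \<noteq> {}" using yz by simp
      show "\<exists>a b. K = cbox a b" using yz cbox_interval by blast
      show "interior K \<inter> interior K2 = {}" if "K2 \<in> D" "K \<noteq> K2" for K2
        using disj[OF K that] interior_subset[of K] interior_subset[of K2] by blast
    qed simp
    show "\<Union>D \<subseteq> U" using sub D(1) by blast
    show "E \<subseteq> \<Union>D \<union> T" by (auto simp: T_def)
    show "T \<in> lmeasurable" unfolding T_def by (intro fmeasurable.Un dm negligible_imp_measurable[OF neg])
    have "measure lebesgue T \<le> measure lebesgue (E - \<Union>\<D>) + measure lebesgue (\<Union>\<D> - \<Union>D)"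
      unfolding T_def
      by (intro measure_Un_le fmeasurableD[OF dm] fmeasurableD[OF negligible_imp_measurable[OF neg]])
    also have "\<dots> = measure lebesgue (\<Union>\<D>) - measure lebesgue (\<Union>D)"
      using neg D by (simp add: negligible_imp_measure0 measurable_measure_Diff[OF meas] mD fmeasurableD Union_mono)
    finally show "measure lebesgue T < e" using D by simp
  qed
qed

lemma division_of_real_interval:
  fixes K :: "real set"
  assumes "q division_of S" "K \<in> q"
  shows "\<exists>y z. y \<le> z \<and> K = {y..z}"
proof -
  obtain y z where K: "K = cbox y z" using division_ofD(4)[OF assms] by blast
  moreover have "K \<noteq> {}" using division_ofD(3)[OF assms] .
  ultimately have "y \<le> z \<and> K = {y..z}" by auto
  then show ?thesis by blast
qed

text \<open>Any tags will do; the left end points reduce the claim to the telescoping sum for tagged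
  divisions.\<close>

lemma additive_division_real:
  fixes h :: "real \<Rightarrow> real"
  assumes "a \<le> b" "q division_of {a..b}"
  shows "(\<Sum>K\<in>q. h (Sup K) - h (Inf K)) = h b - h a"
proof -
  have K: "\<exists>y z. y \<le> z \<and> K = {y..z}" if "K \<in> q" for K
    using division_of_real_interval[OF assms(2) that] .
  let ?p = "(\<lambda>K. (Inf K, K)) ` q"
  have "?p tagged_division_of {a..b}"
  proof (rule tagged_division_ofI)
    show "finite ?p" using assms by auto
    show "x \<in> K" if "(x, K) \<in> ?p" for x K using that K[of K] by auto
    show "K \<subseteq> {a..b}" if "(x, K) \<in> ?p" for x K using that division_ofD(2)[OF assms(2), of K] by auto
    show "\<exists>a b. K = cbox a b" if "(x, K) \<in> ?p" for x K using that K[of K] by (auto simp: cbox_interval)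
    show "interior K1 \<inter> interior K2 = {}" if "(x1, K1) \<in> ?p" "(x2, K2) \<in> ?p" "(x1, K1) \<noteq> (x2, K2)" for x1 x2 K1 K2
      using that division_ofD(5)[OF assms(2), of K1 K2] by auto
    have "{K. \<exists>x. (x, K) \<in> ?p} = q" by auto
    then show "\<Union>{K. \<exists>x. (x, K) \<in> ?p} = {a..b}" using division_ofD(6)[OF assms(2)] by simp
  qed
  from additive_tagged_division_1[OF assms(1) this, of h]
  show ?thesis by (simp add: sum.reindex inj_on_def)
qed

lemma measure_division_real:
  assumes "D division_of S"
  shows "measure lebesgue S = (\<Sum>K\<in>D. Sup K - Inf K)"
proof -
  have "measure lebesgue K = Sup K - Inf K" if "K \<in> D" for K
    using division_of_real_interval[OF assms that] by auto
  then show ?thesis using content_division[OF assms] by simp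
qed

text \<open>Every interval of \<open>D\<close> is subdivided so that the members of
  \<open>D'\<close> inside it are among the pieces; \<open>R\<close> collects the other pieces. The
  identity for all \<open>h\<close> serves twice, with the identity function for the total length
  and with \<open>g\<close> for its increments. Nondegeneracy ensures that a member of
  \<open>D'\<close> lies in only one interval of \<open>D\<close>.\<close>

lemma division_remainder:
  fixes D D' :: "real set set"
  assumes D: "D division_of \<Union>D" and D': "D' division_of \<Union>D'"
    and sub: "\<And>K'. K' \<in> D' \<Longrightarrow> \<exists>K\<in>D. K' \<subseteq> K"
    and nd: "\<And>K'. K' \<in> D' \<Longrightarrow> interior K' \<noteq> {}"
  obtains R where "R division_of \<Union>R" "\<Union>R \<subseteq> \<Union>D"
    "\<And>h :: real \<Rightarrow> real. (\<Sum>K\<in>R. h (Sup K) - h (Inf K)) =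
       (\<Sum>K\<in>D. h (Sup K) - h (Inf K)) - (\<Sum>K\<in>D'. h (Sup K) - h (Inf K))"
proof -
  have finD: "finite D" and finD': "finite D'" using D D' by auto
  define S where "S K = {K'\<in>D'. K' \<subseteq> K}" for K
  have "\<exists>q. S K \<subseteq> q \<and> q division_of K" if KD: "K \<in> D" for K
  proof -
    obtain a b where K: "K = cbox a b" using division_ofD(4)[OF D KD] by blast
    have "S K division_of \<Union>(S K)" using division_of_subset[OF D'] by (auto simp: S_def)
    moreover have "\<Union>(S K) \<subseteq> cbox a b" using K by (auto simp: S_def)
    ultimately obtain p where "S K \<subseteq> p" "p division_of cbox a b"
      by (rule partial_division_extend_interval)
    then show ?thesis using K by blast
  qed
  then obtain q where q: "\<And>K. K \<in> D \<Longrightarrow> S K \<subseteq> q K \<and> q K division_of K" by metis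
  \<comment> \<open>Degenerate pieces are dropped: one point can be shared by two intervals of
    \<open>D\<close>, and increments over it vanish.\<close>
  define R where "R K = {J\<in>q K - S K. interior J \<noteq> {}}" for K
  have Rsub: "J \<subseteq> K" if "J \<in> R K" "K \<in> D" for J K
    using that division_ofD(2)[OF conjunct2[OF q[OF that(2)]], of J] by (simp add: R_def)
  have dJ: "K1 = K2" if "J \<subseteq> K1" "J \<subseteq> K2" "interior J \<noteq> {}" "K1 \<in> D" "K2 \<in> D" for J K1 K2
    using division_ofD(5)[OF D that(4,5)] interior_mono[OF that(1)] interior_mono[OF that(2)] that(3) by blast
  have finR: "finite (R K)" if "K \<in> D" for K
    using division_ofD(1)[OF conjunct2[OF q[OF that]]] by (simp add: R_def)
  have Sdisj: "S K1 \<inter> S K2 = {}" if "K1 \<in> D" "K2 \<in> D" "K1 \<noteq> K2" for K1 K2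
      proof (rule ccontr)
    assume "S K1 \<inter> S K2 \<noteq> {}"
    then obtain J where "J \<in> D'" "J \<subseteq> K1" "J \<subseteq> K2" by (auto simp: S_def)
    then show False using dJ[of J K1 K2] nd[of J] that by simp
  qed
  have Rdisj: "R K1 \<inter> R K2 = {}" if "K1 \<in> D" "K2 \<in> D" "K1 \<noteq> K2" for K1 K2
      proof (rule ccontr)
    assume "R K1 \<inter> R K2 \<noteq> {}"
    then obtain J where J: "J \<in> R K1" "J \<in> R K2" by auto
    then have "interior J \<noteq> {}" by (simp add: R_def)
    then show False using dJ[of J K1 K2] Rsub[OF J(1)] Rsub[OF J(2)] that by simp
  qed
  have D'eq: "D' = (\<Union>K\<in>D. S K)" using sub unfolding S_def by blast
  show ?thesis
  proof
    let ?R = "\<Union>K\<in>D. R K"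
    show "?R division_of \<Union>?R"
    proof (rule division_ofI)
      show "finite ?R" using finD finR by auto
      fix J assume J: "J \<in> ?R"
      then obtain K where K: "K \<in> D" "J \<in> R K" by auto
      then have JqK: "J \<in> q K" by (auto simp: R_def)
      show "J \<subseteq> \<Union>?R" using J by blast
      show "J \<noteq> {}" "\<exists>a b. J = cbox a b"
        using division_ofD(3,4)[OF conjunct2[OF q[OF K(1)]] JqK] by blast+
      fix J' assume J': "J' \<in> ?R" "J \<noteq> J'"
      then obtain K' where K': "K' \<in> D" "J' \<in> R K'" by auto
      show "interior J \<inter> interior J' = {}"
      proof (cases "K = K'")
        case True
        then have "J' \<in> q K" using K' by (auto simp: R_def)
        then show ?thesis using division_ofD(5)[of "q K" K J J'] q[OF K(1)] JqK J' by auto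
      next
        case False
        then show ?thesis
          using division_ofD(5)[OF D K(1) K'(1) False] interior_mono[OF Rsub[OF K(2,1)]]
            interior_mono[OF Rsub[OF K'(2,1)]] by blast
      qed
    qed simp
    show "\<Union>?R \<subseteq> \<Union>D"
    proof
      fix t assume "t \<in> \<Union>?R"
      then obtain K J where "K \<in> D" "J \<in> R K" "t \<in> J" by auto
      then show "t \<in> \<Union>D" using Rsub[of J K] by blast
    qed
    fix h :: "real \<Rightarrow> real"
    let ?i = "\<lambda>K. h (Sup K) - h (Inf K)"
    have "sum ?i ?R = (\<Sum>K\<in>D. sum ?i (R K))" using finD finR Rdisj by (intro sum.UNION_disjoint) simp_all
    moreover have "sum ?i D' = (\<Sum>K\<in>D. sum ?i (S K))"
      unfolding D'eq
    proof (rule sum.UNION_disjoint)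
      show "\<forall>K\<in>D. finite (S K)" using finD' by (simp add: S_def)
    qed (use finD Sdisj in auto)
    moreover have "?i K = sum ?i (S K) + sum ?i (R K)" if K: "K \<in> D" for K
    proof -
      obtain a b where ab: "K = {a..b}" "a \<le> b"
        using division_of_real_interval[OF D K] by blast
      have fq: "finite (q K)" using division_ofD(1)[OF conjunct2[OF q[OF K]]] .
      have "?i K = sum ?i (q K)"
        using additive_division_real[OF ab(2), of "q K" h] q[OF K] ab by simp
      also have "\<dots> = sum ?i (q K - S K) + sum ?i (S K)"
        using q[OF K] fq by (intro sum.subset_diff) auto
      also have "sum ?i (q K - S K) = sum ?i (R K)"
      proof (rule sum.mono_neutral_right)
        show "\<forall>J\<in>q K - S K - R K. ?i J = 0"
        proof
          fix J assume J: "J \<in> q K - S K - R K"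
          then have "interior J = {}" by (auto simp: R_def)
          moreover obtain y z where "J = {y..z}" "y \<le> z"
            using J division_of_real_interval[OF conjunct2[OF q[OF K]], of J] by blast
          ultimately show "?i J = 0" by auto
        qed
      qed (use fq in \<open>auto simp: R_def\<close>)
      finally show ?thesis by simp
    qed
    ultimately show "sum ?i ?R = sum ?i D - sum ?i D'" by (simp add: sum.distrib)
  qed
qed


lemma abs_continuous_onD:
  assumes "abs_continuous_on S g" "e > 0"
  obtains \<delta> where "\<delta> > 0" "\<And>D. D division_of \<Union>D \<Longrightarrow> \<Union>D \<subseteq> S \<Longrightarrow> (\<Sum>K\<in>D. Sup K - Inf K) < \<delta> \<Longrightarrow>
    (\<Sum>K\<in>D. \<bar>g (Sup K) - g (Inf K)\<bar>) < e"
proof -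
  obtain \<delta> where "\<delta> > 0" "\<forall>d. d division_of (\<Union>d) \<and> \<Union>d \<subseteq> S \<and> (\<Sum>K\<in>d. Sup K - Inf K) < \<delta>
        \<longrightarrow> (\<Sum>K\<in>d. \<bar>g (Sup K) - g (Inf K)\<bar>) < e"
    using assms(1)[unfolded abs_continuous_on_def, rule_format, OF assms(2)] by blast
  then show ?thesis by (intro that[of \<delta>]) simp_all
qed

text \<open>Serves to shift a pair of slopes u < v to a symmetric pair - c, c.\<close>

lemma abs_continuous_on_add_linear:
  assumes "abs_continuous_on S g"
  shows "abs_continuous_on S (\<lambda>t. g t + c * t)"
  unfolding abs_continuous_on_def
proof (intro allI impI)
  fix e :: real assume e: "e > 0"
  then have "e / 2 > 0" by simp
  then obtain \<delta> where \<delta>: "\<delta> > 0" "\<And>D. D division_of \<Union>D \<Longrightarrow> \<Union>D \<subseteq> S \<Longrightarrow> (\<Sum>K\<in>D. Sup K - Inf K) < \<delta> \<Longrightarrow>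
    (\<Sum>K\<in>D. \<bar>g (Sup K) - g (Inf K)\<bar>) < e / 2"
    by (rule abs_continuous_onD[OF assms]) (rule that)
  show "\<exists>\<delta>>0. \<forall>d. d division_of (\<Union>d) \<and> \<Union>d \<subseteq> S \<and> (\<Sum>K\<in>d. Sup K - Inf K) < \<delta>
        \<longrightarrow> (\<Sum>K\<in>d. \<bar>(g (Sup K) + c * Sup K) - (g (Inf K) + c * Inf K)\<bar>) < e"
  proof (intro exI[of _ "min \<delta> (e / (2 * (\<bar>c\<bar> + 1)))"] conjI allI impI)
    show "0 < min \<delta> (e / (2 * (\<bar>c\<bar> + 1)))" using \<delta> e by (simp add: add_nonneg_pos)
    fix D :: "real set set"
    assume D: "D division_of \<Union>D \<and> \<Union>D \<subseteq> S \<and> (\<Sum>K\<in>D. Sup K - Inf K) < min \<delta> (e / (2 * (\<bar>c\<bar> + 1)))"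
    let ?L = "\<Sum>K\<in>D. Sup K - Inf K"
    have "(\<Sum>K\<in>D. \<bar>(g (Sup K) + c * Sup K) - (g (Inf K) + c * Inf K)\<bar>) \<le>
        (\<Sum>K\<in>D. \<bar>g (Sup K) - g (Inf K)\<bar> + \<bar>c\<bar> * (Sup K - Inf K))"
    proof (rule sum_mono)
      fix K assume "K \<in> D"
      then have "Inf K \<le> Sup K" using division_of_real_interval[of D "\<Union>D" K] D by auto
      then have "\<bar>c * Sup K - c * Inf K\<bar> = \<bar>c\<bar> * (Sup K - Inf K)"
        by (metis abs_mult abs_of_nonneg diff_ge_0_iff_ge right_diff_distrib)
      then show "\<bar>(g (Sup K) + c * Sup K) - (g (Inf K) + c * Inf K)\<bar>
          \<le> \<bar>g (Sup K) - g (Inf K)\<bar> + \<bar>c\<bar> * (Sup K - Inf K)" by linarith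
    qed
    also have "\<dots> = (\<Sum>K\<in>D. \<bar>g (Sup K) - g (Inf K)\<bar>) + \<bar>c\<bar> * ?L"
      by (simp add: sum.distrib sum_distrib_left)
    also have "\<dots> < e / 2 + e / 2"
    proof (rule add_less_le_mono)
      show "(\<Sum>K\<in>D. \<bar>g (Sup K) - g (Inf K)\<bar>) < e / 2" using \<delta> D by auto
      have "\<bar>c\<bar> * ?L \<le> \<bar>c\<bar> * (e / (2 * (\<bar>c\<bar> + 1)))" using D by (intro mult_left_mono) auto
      also have "\<dots> \<le> e / 2" using e by (simp add: field_simps)
      finally show "\<bar>c\<bar> * ?L \<le> e / 2" .
    qed
    finally show "(\<Sum>K\<in>D. \<bar>(g (Sup K) + c * Sup K) - (g (Inf K) + c * Inf K)\<bar>) < e" by simp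
  qed
qed

text \<open>\<open>s\<close> is the outer Lebesgue measure of \<open>E\<close>. The exceptional sets
  below are not shown to be measurable beforehand, so they are measured from outside, by open sets
  within the given interval.\<close>

lemma non_negligible_outer:
  fixes E :: "real set"
  assumes "\<not> negligible E" "E \<subseteq> {a<..<b}"
  obtains s where "s > 0" "\<And>T. T \<in> lmeasurable \<Longrightarrow> E \<subseteq> T \<Longrightarrow> s \<le> measure lebesgue T"
    "\<And>e. e > 0 \<Longrightarrow> \<exists>U. open U \<and> U \<in> lmeasurable \<and> E \<subseteq> U \<and> U \<subseteq> {a<..<b} \<and> measure lebesgue U < s + e"
proof -
  let ?A = "{measure lebesgue T |T. T \<in> lmeasurable \<and> E \<subseteq> T}"
  define s where "s = Inf ?A"
  have bdd: "bdd_below ?A" by (rule bdd_belowI[of _ 0]) auto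
  have ne: "?A \<noteq> {}" using assms(2) lmeasurable_interval(2)[of a b] by (auto simp: box_real)
  show ?thesis
  proof
    obtain e where e: "e > 0" "\<And>T. E \<subseteq> T \<Longrightarrow> T \<in> lmeasurable \<Longrightarrow> e < measure lebesgue T"
      using assms(1) unfolding negligible_outer_le by (meson not_le)
    have "e \<le> s" unfolding s_def using e by (intro cInf_greatest[OF ne]) (auto intro: less_imp_le)
    with e show "s > 0" by simp
    show "s \<le> measure lebesgue T" if "T \<in> lmeasurable" "E \<subseteq> T" for T
      unfolding s_def using that by (intro cInf_lower[OF _ bdd]) auto
    show "\<exists>U. open U \<and> U \<in> lmeasurable \<and> E \<subseteq> U \<and> U \<subseteq> {a<..<b} \<and> measure lebesgue U < s + e" if e: "e > 0" for e
    proof -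
      obtain T where T: "T \<in> lmeasurable" "E \<subseteq> T" "measure lebesgue T < s + e / 2"
        using cInf_lessD[OF ne, of "s + e / 2"] e unfolding s_def by auto
      have "0 < e / 2" using e by simp
      then obtain V where V': "open V" "T \<subseteq> V" "V - T \<in> lmeasurable" "emeasure lebesgue (V - T) < ennreal (e / 2)"
        by (rule sets_lebesgue_outer_open[OF fmeasurableD[OF T(1)]]) (rule that)
      have Veq: "V = T \<union> (V - T)" using V'(2) by blast
      have "measure lebesgue (V - T) < e / 2"
        using V'(3,4) e by (simp add: emeasure_eq_measure2 ennreal_less_iff)
      moreover have Vm: "V \<in> lmeasurable" using fmeasurable.Un[OF T(1) V'(3)] by (subst Veq)
      moreover have "measure lebesgue V \<le> measure lebesgue T + measure lebesgue (V - T)"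
        using measure_Un_le[OF fmeasurableD[OF T(1)] fmeasurableD[OF V'(3)]] by (subst Veq)
      ultimately have V: "open V" "T \<subseteq> V" "V \<in> lmeasurable" "measure lebesgue V < measure lebesgue T + e / 2"
        using V'(1,2) Vm by simp_all
      have VI: "V \<inter> {a<..<b} \<in> lmeasurable" using V(3) by (intro fmeasurable_Int_fmeasurable) auto
      have "measure lebesgue (V \<inter> {a<..<b}) \<le> measure lebesgue V"
        using VI V by (intro measure_mono_fmeasurable) auto
      then show ?thesis using V T VI assms(2) by (intro exI[of _ "V \<inter> {a<..<b}"]) auto
    qed
  qed
qed

text \<open>
  Cover the set by intervals on which the slope of \<open>g\<close> is below \<open>- c\<close> and, inside them, by intervals
  on which it is above \<open>c\<close>, both of total length almost the outer measure \<open>s\<close>. What remains of the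
  first cover is short, but the increment of \<open>g\<close> over it is about \<open>- 2 * c * s\<close>. So the classical
  argument applies to \<open>g\<close> itself and no reduction to monotone functions is needed.
\<close>

lemma ac_crossing_negligible:
  assumes ac: "abs_continuous_on {a..b} g" and c: "c > 0"
  shows "negligible {x \<in> {a<..<b}.
     (\<forall>d>0. \<exists>y z. y < z \<and> y \<le> x \<and> x \<le> z \<and> z - y < d \<and> g z - g y < - c * (z - y)) \<and>
     (\<forall>d>0. \<exists>y z. y < z \<and> y \<le> x \<and> x \<le> z \<and> z - y < d \<and> g z - g y > c * (z - y))}" (is "negligible ?E")
proof (rule ccontr)
  assume "\<not> negligible ?E"
  then obtain s where s: "s > 0" "\<And>T. T \<in> lmeasurable \<Longrightarrow> ?E \<subseteq> T \<Longrightarrow> s \<le> measure lebesgue T"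
    "\<And>e. e > 0 \<Longrightarrow> \<exists>U. open U \<and> U \<in> lmeasurable \<and> ?E \<subseteq> U \<and> U \<subseteq> {a<..<b} \<and> measure lebesgue U < s + e"
  proof (rule non_negligible_outer[where a = a and b = b])
    show "?E \<subseteq> {a<..<b}" by blast
  qed (rule that)
  have "c * s / 2 > 0" using c s by simp
  then obtain \<delta> where \<delta>: "\<delta> > 0" "\<And>D. D division_of \<Union>D \<Longrightarrow> \<Union>D \<subseteq> {a..b} \<Longrightarrow> (\<Sum>K\<in>D. Sup K - Inf K) < \<delta> \<Longrightarrow>
    (\<Sum>K\<in>D. \<bar>g (Sup K) - g (Inf K)\<bar>) < c * s / 2"
    by (rule abs_continuous_onD[OF ac]) (rule that)
  \<comment> \<open>The numbers 6 and 8 give L1 - L2 <= 3 e < \<delta> and L1 + L2 >= 2 s - 3 e > s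
    / 2.\<close>
  define e where "e = min (\<delta> / 6) (s / 8)"
  have e: "e > 0" "e \<le> \<delta> / 6" "e \<le> s / 8" using \<delta> s by (auto simp: e_def)
  obtain U where U: "open U" "U \<in> lmeasurable" "?E \<subseteq> U" "U \<subseteq> {a<..<b}" "measure lebesgue U < s + e"
    using s(3)[OF e(1)] by blast
  obtain D1 T1 where D1: "D1 division_of \<Union>D1" "\<Union>D1 \<subseteq> U"
    "\<And>K. K \<in> D1 \<Longrightarrow> \<exists>y z. y < z \<and> K = {y..z} \<and> g z - g y < - c * (z - y)"
    "?E \<subseteq> \<Union>D1 \<union> T1" "T1 \<in> lmeasurable" "measure lebesgue T1 < e"
  proof (rule vitali_finite[OF U(1-3) e(1), of "\<lambda>y z. g z - g y < - c * (z - y)"])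
    fix x d :: real assume "x \<in> ?E" "d > 0"
    then show "\<exists>y z. y < z \<and> y \<le> x \<and> x \<le> z \<and> z - y < d \<and> g z - g y < - c * (z - y)" by blast
  qed (rule that)
  \<comment> \<open>Only interiors are kept, so that every interval of the second cover fits into a
    single member of \<open>D1\<close>; the finitely many end points lost reappear below as the null
    set \<open>F\<close>.\<close>
  define V where "V = (\<Union>K\<in>D1. interior K)"
  have VU: "V \<subseteq> \<Union>D1" using interior_subset by (auto simp: V_def)
  have V: "open V" "V \<in> lmeasurable"
  proof -
    show o: "open V" by (auto simp: V_def)
    show "V \<in> lmeasurable"
      using subset_trans[OF VU D1(2)] o by (intro fmeasurableI2[OF U(2)]) auto
  qed
  obtain D2 T2 where D2: "D2 division_of \<Union>D2" "\<Union>D2 \<subseteq> V"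
    "\<And>K. K \<in> D2 \<Longrightarrow> \<exists>y z. y < z \<and> K = {y..z} \<and> g z - g y > c * (z - y) \<and> (\<exists>L\<in>D1. {y..z} \<subseteq> L)"
    "?E \<inter> V \<subseteq> \<Union>D2 \<union> T2" "T2 \<in> lmeasurable" "measure lebesgue T2 < e"
  proof (rule vitali_finite[OF V _ e(1), of "?E \<inter> V" "\<lambda>y z. g z - g y > c * (z - y) \<and> (\<exists>L\<in>D1. {y..z} \<subseteq> L)"])
    fix x d :: real assume x: "x \<in> ?E \<inter> V" and d: "d > 0"
    then obtain L where L: "L \<in> D1" "x \<in> interior L" by (auto simp: V_def)
    then obtain \<eta> where \<eta>: "\<eta> > 0" "ball x \<eta> \<subseteq> L" by (auto simp: mem_interior)
    have "0 < min d \<eta>" using d \<eta> by simp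
    then have "\<exists>y z. y < z \<and> y \<le> x \<and> x \<le> z \<and> z - y < min d \<eta> \<and> g z - g y > c * (z - y)"
      using x by blast
    then obtain y z where yz: "y < z" "y \<le> x" "x \<le> z" "z - y < min d \<eta>" "g z - g y > c * (z - y)"
      by blast
    have "{y..z} \<subseteq> ball x \<eta>" using yz by (auto simp: dist_real_def)
    then have "{y..z} \<subseteq> L" using \<eta>(2) by (rule subset_trans)
    moreover have "z - y < d" using yz(4) by simp
    ultimately show "\<exists>y z. y < z \<and> y \<le> x \<and> x \<le> z \<and> z - y < d \<and> g z - g y > c * (z - y) \<and> (\<exists>L\<in>D1. {y..z} \<subseteq> L)"
      using yz L(1) by blast
  next
    show "?E \<inter> V \<subseteq> V" by blast
  qed (rule that)
  obtain R where R: "R division_of \<Union>R" "\<Union>R \<subseteq> \<Union>D1"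
    "\<And>h :: real \<Rightarrow> real. (\<Sum>K\<in>R. h (Sup K) - h (Inf K)) =
       (\<Sum>K\<in>D1. h (Sup K) - h (Inf K)) - (\<Sum>K\<in>D2. h (Sup K) - h (Inf K))"
  proof (rule division_remainder[OF D1(1) D2(1)])
    fix K' assume "K' \<in> D2"
    then obtain y z L where "y < z" "K' = {y..z}" "L \<in> D1" "{y..z} \<subseteq> L" using D2(3) by blast
    then show "\<exists>K\<in>D1. K' \<subseteq> K" "interior K' \<noteq> {}" by auto
  qed (rule that)
  define L1 where "L1 = (\<Sum>K\<in>D1. Sup K - Inf K)"
  define L2 where "L2 = (\<Sum>K\<in>D2. Sup K - Inf K)"
  have L1: "L1 = measure lebesgue (\<Union>D1)" and L2: "L2 = measure lebesgue (\<Union>D2)"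
    unfolding L1_def L2_def
    by (rule measure_division_real[OF D1(1), symmetric], rule measure_division_real[OF D2(1), symmetric])
  have m1: "\<Union>D1 \<in> lmeasurable" and m2: "\<Union>D2 \<in> lmeasurable"
    using lmeasurable_division D1(1) D2(1) by auto
  have L1le: "L1 \<le> s + e"
    using measure_mono_fmeasurable[OF D1(2) fmeasurableD[OF m1] U(2)] U(5) L1 by simp
  have L1ge: "s \<le> L1 + e"
  proof -
    have "s \<le> measure lebesgue (\<Union>D1 \<union> T1)" by (intro s(2) fmeasurable.Un m1 D1(4,5))
    also have "\<dots> \<le> measure lebesgue (\<Union>D1) + measure lebesgue T1"
      by (intro measure_Un_le fmeasurableD m1 D1(5))
    finally show ?thesis using D1 L1 by simp
  qed
  have L2ge: "s \<le> L2 + 2 * e"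
  proof -
    define F where "F = Inf ` D1 \<union> Sup ` D1"
    have "finite F" using D1 by (auto simp: F_def)
    then have "negligible F" by (rule negligible_finite)
    then have F: "F \<in> lmeasurable" "measure lebesgue F = 0"
      by (simp_all add: negligible_imp_measurable negligible_imp_measure0)
    have sub: "?E \<subseteq> \<Union>D2 \<union> T1 \<union> T2 \<union> F"
    proof
      fix x assume x: "x \<in> ?E"
      show "x \<in> \<Union>D2 \<union> T1 \<union> T2 \<union> F"
      proof (cases "x \<in> V \<or> x \<in> T1")
        case True then show ?thesis using x D2(4) by blast
      next
        case False
        then obtain K where K: "K \<in> D1" "x \<in> K" "x \<notin> interior K" using x D1(4) unfolding V_def by blast
        obtain y z where yz: "y < z" "K = {y..z}" using D1(3)[OF K(1)] by blast
        then have "x = Inf K \<or> x = Sup K" using K by (auto simp: less_le)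
        then show ?thesis using K(1) by (auto simp: F_def)
      qed
    qed
    have "s \<le> measure lebesgue (\<Union>D2 \<union> T1 \<union> T2 \<union> F)"
      by (intro s(2) sub fmeasurable.Un m2 D1(5) D2(5) F(1))
    also have "\<dots> \<le> measure lebesgue (\<Union>D2 \<union> T1 \<union> T2) + measure lebesgue F"
      by (intro measure_Un_le fmeasurableD fmeasurable.Un m2 D1(5) D2(5) F(1))
    also have "measure lebesgue (\<Union>D2 \<union> T1 \<union> T2) \<le> measure lebesgue (\<Union>D2 \<union> T1) + measure lebesgue T2"
      by (intro measure_Un_le fmeasurableD fmeasurable.Un m2 D1(5) D2(5) F(1))
    also have "measure lebesgue (\<Union>D2 \<union> T1) \<le> measure lebesgue (\<Union>D2) + measure lebesgue T1"
      by (intro measure_Un_le fmeasurableD fmeasurable.Un m2 D1(5) D2(5) F(1))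
    finally show ?thesis using D1(6) D2(6) F L2 by simp
  qed
  have inc1: "(\<Sum>K\<in>D1. g (Sup K) - g (Inf K)) \<le> - c * L1"
    unfolding L1_def sum_distrib_left
  proof (rule sum_mono)
    fix K assume "K \<in> D1"
    from D1(3)[OF this] show "g (Sup K) - g (Inf K) \<le> - c * (Sup K - Inf K)" by auto
  qed
  have inc2: "c * L2 \<le> (\<Sum>K\<in>D2. g (Sup K) - g (Inf K))"
    unfolding L2_def sum_distrib_left
  proof (rule sum_mono)
    fix K assume "K \<in> D2"
    from D2(3)[OF this] show "c * (Sup K - Inf K) \<le> g (Sup K) - g (Inf K)" by auto
  qed
  have "(\<Sum>K\<in>R. Sup K - Inf K) = L1 - L2" using R(3)[of "\<lambda>t. t"] by (simp add: L1_def L2_def)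
  also have "\<dots> < \<delta>" using L1le L2ge e \<delta>(1) by linarith
  finally have "(\<Sum>K\<in>R. \<bar>g (Sup K) - g (Inf K)\<bar>) < c * s / 2"
  proof (intro \<delta>(2) R(1))
    have "{a<..<b} \<subseteq> {a..b}" by auto
    then show "\<Union>R \<subseteq> {a..b}" using R(2) D1(2) U(4) by blast
  qed
  moreover have "\<bar>\<Sum>K\<in>R. g (Sup K) - g (Inf K)\<bar> \<le> (\<Sum>K\<in>R. \<bar>g (Sup K) - g (Inf K)\<bar>)" by (rule sum_abs)
  moreover have "(\<Sum>K\<in>R. g (Sup K) - g (Inf K)) \<le> - c * (L1 + L2)"
    using R(3)[of g] inc1 inc2 by (simp add: algebra_simps)
  ultimately have "c * (L1 + L2) < c * s / 2" by linarith
  then have "c * (L1 + L2) < c * (s / 2)" by simp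
  then have "L1 + L2 < s / 2" using c by (simp only: mult_less_cancel_left_pos)
  then show False using L1ge L2ge e s(1) by linarith
qed

text \<open>Intervals of slope above 2 / s that cover at least half of the outer measure
  \<open>s\<close> would produce a variation of at least 1. This contradicts absolute continuity
  once the set sits in an interval of length \<delta> / 2, and negligibility is a local
  property.\<close>

lemma ac_steep_negligible:
  assumes ac: "abs_continuous_on {a..b} g"
  shows "negligible {x \<in> {a<..<b}.
     \<forall>M. \<forall>d>0. \<exists>y z. y < z \<and> y \<le> x \<and> x \<le> z \<and> z - y < d \<and> \<bar>g z - g y\<bar> > M * (z - y)}" (is "negligible ?E")
proof -
  obtain \<delta> where \<delta>: "\<delta> > 0" "\<And>D. D division_of \<Union>D \<Longrightarrow> \<Union>D \<subseteq> {a..b} \<Longrightarrow> (\<Sum>K\<in>D. Sup K - Inf K) < \<delta> \<Longrightarrow>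
    (\<Sum>K\<in>D. \<bar>g (Sup K) - g (Inf K)\<bar>) < 1"
    by (rule abs_continuous_onD[OF ac zero_less_one]) (rule that)
  have "negligible (?E \<inter> {w<..<w + \<delta> / 2})" for w
  proof (rule ccontr)
    let ?F = "?E \<inter> {w<..<w + \<delta> / 2}"
    assume "\<not> negligible ?F"
    then obtain s where s: "s > 0" "\<And>T. T \<in> lmeasurable \<Longrightarrow> ?F \<subseteq> T \<Longrightarrow> s \<le> measure lebesgue T"
      "\<And>e. e > 0 \<Longrightarrow> \<exists>U. open U \<and> U \<in> lmeasurable \<and> ?F \<subseteq> U \<and> U \<subseteq> {max a w<..<min b (w + \<delta> / 2)} \<and> measure lebesgue U < s + e"
    proof (rule non_negligible_outer[where a = "max a w" and b = "min b (w + \<delta> / 2)"])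
      show "?F \<subseteq> {max a w<..<min b (w + \<delta> / 2)}" by auto
    qed (rule that)
    obtain U where U: "open U" "U \<in> lmeasurable" "?F \<subseteq> U" "U \<subseteq> {max a w<..<min b (w + \<delta> / 2)}"
      using s(3)[of 1] by auto
    have s2: "s / 2 > 0" using s by simp
    obtain D T where D: "D division_of \<Union>D" "\<Union>D \<subseteq> U"
      "\<And>K. K \<in> D \<Longrightarrow> \<exists>y z. y < z \<and> K = {y..z} \<and> \<bar>g z - g y\<bar> > (2 / s) * (z - y)"
      "?F \<subseteq> \<Union>D \<union> T" "T \<in> lmeasurable" "measure lebesgue T < s / 2"
    proof (rule vitali_finite[OF U(1-3) s2, of "\<lambda>y z. \<bar>g z - g y\<bar> > (2 / s) * (z - y)"])
      fix x d :: real assume "x \<in> ?F" "d > 0"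
      then show "\<exists>y z. y < z \<and> y \<le> x \<and> x \<le> z \<and> z - y < d \<and> \<bar>g z - g y\<bar> > (2 / s) * (z - y)" by blast
    qed (rule that)
    have m: "\<Union>D \<in> lmeasurable" using lmeasurable_division[OF D(1)] .
    have L: "measure lebesgue (\<Union>D) = (\<Sum>K\<in>D. Sup K - Inf K)" by (rule measure_division_real[OF D(1)])
    have "s \<le> measure lebesgue (\<Union>D \<union> T)" by (intro s(2) fmeasurable.Un m D(4,5))
    also have "\<dots> \<le> measure lebesgue (\<Union>D) + measure lebesgue T"
      by (intro measure_Un_le fmeasurableD m D(5))
    finally have ge: "s / 2 \<le> (\<Sum>K\<in>D. Sup K - Inf K)" using D(6) L by simp
    have DU: "\<Union>D \<subseteq> {max a w<..<min b (w + \<delta> / 2)}" using D(2) U(4) by (rule subset_trans)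
    also have "\<dots> \<subseteq> {w..w + \<delta> / 2}" by auto
    finally have "measure lebesgue (\<Union>D) \<le> measure lebesgue {w..w + \<delta> / 2}"
      by (rule measure_mono_fmeasurable[OF _ fmeasurableD[OF m]]) simp
    then have "(\<Sum>K\<in>D. Sup K - Inf K) < \<delta>" using L \<delta>(1) by simp
    moreover have "{max a w<..<min b (w + \<delta> / 2)} \<subseteq> {a..b}" by auto
    then have "\<Union>D \<subseteq> {a..b}" using DU by (rule subset_trans[rotated])
    ultimately have lt: "(\<Sum>K\<in>D. \<bar>g (Sup K) - g (Inf K)\<bar>) < 1" using \<delta>(2)[OF D(1)] by blast
    have "(2 / s) * (\<Sum>K\<in>D. Sup K - Inf K) \<le> (\<Sum>K\<in>D. \<bar>g (Sup K) - g (Inf K)\<bar>)"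
      unfolding sum_distrib_left
    proof (rule sum_mono)
      fix K assume "K \<in> D"
      from D(3)[OF this] show "(2 / s) * (Sup K - Inf K) \<le> \<bar>g (Sup K) - g (Inf K)\<bar>" by auto
    qed
    moreover have "1 \<le> (2 / s) * (\<Sum>K\<in>D. Sup K - Inf K)"
      using ge s(1) by (simp add: pos_le_divide_eq)
    ultimately have "1 \<le> (\<Sum>K\<in>D. \<bar>g (Sup K) - g (Inf K)\<bar>)" by (rule order_trans[rotated])
    from leD[OF this] lt show False by (rule notE)
  qed
  note neg = this
  show ?thesis
  proof (subst locally_negligible_alt, rule ballI)
    fix x assume x: "x \<in> ?E"
    let ?U = "?E \<inter> {x - \<delta> / 4<..<x - \<delta> / 4 + \<delta> / 2}"
    have 1: "openin (top_of_set ?E) ?U" by (rule openin_open_Int[OF open_greaterThanLessThan])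
    have "x \<in> {x - \<delta> / 4<..<x - \<delta> / 4 + \<delta> / 2}" using \<delta>(1) by simp
    with x have 2: "x \<in> ?U" by (rule IntI)
    show "\<exists>U. openin (top_of_set ?E) U \<and> x \<in> U \<and> negligible U"
      by (rule exI[of _ ?U], rule conjI[OF 1 conjI[OF 2 neg]])
  qed
qed

text \<open>\<open>L\<close> is the upper derivative, the infimum of the eventual upper bounds for
  the slopes of intervals straddling x; \<open>M\<close> makes it finite. A value v < L is exceeded
  at all scales, so by the hypothesis on crossings slopes below u < v do not occur at small scales,
  and \<open>L\<close> is the lower derivative as well. Rational u and v suffice, so that countably
  many exceptional sets will do.\<close>

lemma differentiable_if_slopes_converge:
  fixes g :: "real \<Rightarrow> real"
  assumes d0: "d0 > 0" and M: "\<And>y z. y < z \<Longrightarrow> y \<le> x \<Longrightarrow> x \<le> z \<Longrightarrow> z - y < d0 \<Longrightarrow> \<bar>g z - g y\<bar> \<le> M * (z - y)"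
    and cross: "\<And>u v. u \<in> \<rat> \<Longrightarrow> v \<in> \<rat> \<Longrightarrow> u < v \<Longrightarrow>
      \<not> ((\<forall>d>0. \<exists>y z. y < z \<and> y \<le> x \<and> x \<le> z \<and> z - y < d \<and> g z - g y < u * (z - y)) \<and>
         (\<forall>d>0. \<exists>y z. y < z \<and> y \<le> x \<and> x \<le> z \<and> z - y < d \<and> g z - g y > v * (z - y)))"
  shows "g differentiable (at x)"
proof -
  define A where "A = {v. \<exists>d>0. \<forall>y z. y < z \<and> y \<le> x \<and> x \<le> z \<and> z - y < d \<longrightarrow> g z - g y \<le> v * (z - y)}"
  have "M \<in> A"
  proof -
    have "g z - g y \<le> M * (z - y)" if "y < z \<and> y \<le> x \<and> x \<le> z \<and> z - y < d0" for y z
      using M[of y z] that by linarith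
    then show ?thesis unfolding A_def using d0 by blast
  qed
  have lb: "- M \<le> v" if vA: "v \<in> A" for v
  proof -
    obtain d where d: "d > 0" "\<And>y z. y < z \<Longrightarrow> y \<le> x \<Longrightarrow> x \<le> z \<Longrightarrow> z - y < d \<Longrightarrow> g z - g y \<le> v * (z - y)"
      using vA unfolding A_def by blast
    define h where "h = min d d0 / 2"
    have h: "h > 0" "h < d" "h < d0" using d d0 by (auto simp: h_def)
    have "- M * h \<le> v * h" using d(2)[of x "x + h"] M[of x "x + h"] h by simp
    then show ?thesis using h(1) by (simp only: mult_le_cancel_right_pos)
  qed
  define L where "L = Inf A"
  have upper: "\<exists>d>0. \<forall>y z. y < z \<and> y \<le> x \<and> x \<le> z \<and> z - y < d \<longrightarrow> g z - g y \<le> (L + e) * (z - y)" if e: "e > 0" for e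
  proof -
    obtain v where v: "v \<in> A" "v < L + e"
      using cInf_lessD[of A "L + e"] \<open>M \<in> A\<close> e unfolding L_def by auto
    obtain d where d: "d > 0" "\<And>y z. y < z \<Longrightarrow> y \<le> x \<Longrightarrow> x \<le> z \<Longrightarrow> z - y < d \<Longrightarrow> g z - g y \<le> v * (z - y)"
      using v(1) unfolding A_def by blast
    have "g z - g y \<le> (L + e) * (z - y)" if A: "y < z \<and> y \<le> x \<and> x \<le> z \<and> z - y < d" for y z
    proof -
      have "v * (z - y) \<le> (L + e) * (z - y)" using v A by (intro mult_right_mono) simp_all
      then show ?thesis using d(2)[of y z] A by linarith
    qed
    then show ?thesis using d(1) by blast
  qed
  have lower: "\<exists>d>0. \<forall>y z. y < z \<and> y \<le> x \<and> x \<le> z \<and> z - y < d \<longrightarrow> (L - e) * (z - y) \<le> g z - g y" if e: "e > 0" for e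
  proof -
    obtain v where v: "v \<in> \<rat>" "L - e < v" "v < L" using Rats_dense_in_real[of "L - e" L] e by auto
    obtain u where u: "u \<in> \<rat>" "L - e < u" "u < v" using Rats_dense_in_real[of "L - e" v] v by auto
    have "v \<notin> A" using v(3) cInf_lower[of v A] bdd_belowI[of A, OF lb] unfolding L_def by fastforce
    then have "\<forall>d>0. \<exists>y z. y < z \<and> y \<le> x \<and> x \<le> z \<and> z - y < d \<and> g z - g y > v * (z - y)"
      unfolding A_def mem_Collect_eq not_ex not_all de_Morgan_conj not_imp not_le by blast
    then obtain d where d: "d > 0" "\<And>y z. y < z \<Longrightarrow> y \<le> x \<Longrightarrow> x \<le> z \<Longrightarrow> z - y < d \<Longrightarrow> \<not> g z - g y < u * (z - y)"
      using cross[OF u(1) v(1) u(3)] by blast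
    have "(L - e) * (z - y) \<le> g z - g y" if A: "y < z \<and> y \<le> x \<and> x \<le> z \<and> z - y < d" for y z
    proof -
      have "(L - e) * (z - y) \<le> u * (z - y)" using u A by (intro mult_right_mono) simp_all
      then show ?thesis using d(2)[of y z] A by linarith
    qed
    then show ?thesis using d(1) by blast
  qed
  have "((\<lambda>h. (g (x + h) - g x) / h) \<longlongrightarrow> L) (at 0)"
  proof (rule LIM_I)
    fix e :: real assume e: "e > 0"
    obtain d1 where d1: "d1 > 0" "\<And>y z. y < z \<Longrightarrow> y \<le> x \<Longrightarrow> x \<le> z \<Longrightarrow> z - y < d1 \<Longrightarrow> g z - g y \<le> (L + e / 2) * (z - y)"
      using upper[OF half_gt_zero[OF e]] by blast
    obtain d2 where d2: "d2 > 0" "\<And>y z. y < z \<Longrightarrow> y \<le> x \<Longrightarrow> x \<le> z \<Longrightarrow> z - y < d2 \<Longrightarrow> (L - e / 2) * (z - y) \<le> g z - g y"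
      using lower[OF half_gt_zero[OF e]] by blast
    show "\<exists>s>0. \<forall>h. h \<noteq> 0 \<and> norm (h - 0) < s \<longrightarrow> norm ((g (x + h) - g x) / h - L) < e"
    proof (intro exI[of _ "min d1 d2"] conjI allI impI)
      show "0 < min d1 d2" using d1 d2 by simp
      fix h :: real assume h: "h \<noteq> 0 \<and> norm (h - 0) < min d1 d2"
      have "(L - e / 2) \<le> (g (x + h) - g x) / h \<and> (g (x + h) - g x) / h \<le> L + e / 2"
      proof (cases "h > 0")
        case True
        then show ?thesis using d1(2)[of x "x + h"] d2(2)[of x "x + h"] h by (simp add: field_simps)
      next
        case False
        then have "h < 0" using h by simp
        then show ?thesis using d1(2)[of "x + h" x] d2(2)[of "x + h" x] h by (simp add: field_simps)
      qed
      then show "norm ((g (x + h) - g x) / h - L) < e" using e by (simp add: abs_less_iff)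
    qed
  qed
  then have "(g has_real_derivative L) (at x)" by (simp add: DERIV_def)
  then show ?thesis using real_differentiable_def by blast
qed

text \<open>At a point of nondifferentiability the slopes are unbounded or cross some pair of
  rationals u < v. The first set is negligible, and each of the countably many others becomes a set
  of \<open>ac_crossing_negligible\<close> after a linear function of slope (u + v) / 2 is
  subtracted.\<close>

lemma ac_differentiable_ae:
  assumes ac: "abs_continuous_on {a..b} g"
  shows "negligible {x \<in> {a<..<b}. \<not> g differentiable (at x)}"
proof -
  let ?S = "{x \<in> {a<..<b}. \<forall>M. \<forall>d>0. \<exists>y z. y < z \<and> y \<le> x \<and> x \<le> z \<and> z - y < d \<and> \<bar>g z - g y\<bar> > M * (z - y)}"
  define X where "X u v = {x \<in> {a<..<b}.
     (\<forall>d>0. \<exists>y z. y < z \<and> y \<le> x \<and> x \<le> z \<and> z - y < d \<and> g z - g y < u * (z - y)) \<and>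
     (\<forall>d>0. \<exists>y z. y < z \<and> y \<le> x \<and> x \<le> z \<and> z - y < d \<and> g z - g y > v * (z - y))}" for u v :: real
  define Q where "Q = {(u, v). u \<in> \<rat> \<and> v \<in> \<rat> \<and> u < (v::real)}"
  have "countable Q"
    by (rule countable_subset[of _ "\<rat> \<times> \<rat>"]) (auto simp: Q_def countable_rat)
  have "negligible (X u v)" if uv: "u < v" for u v
  proof -
    define w where "w = (u + v) / 2"
    define c where "c = (v - u) / 2"
    have 1: "(g z + (- w) * z) - (g y + (- w) * y) < - c * (z - y) \<longleftrightarrow> g z - g y < u * (z - y)"
      and 2: "(g z + (- w) * z) - (g y + (- w) * y) > c * (z - y) \<longleftrightarrow> g z - g y > v * (z - y)" for y z
    proof -
      have "u = w - c" "v = w + c" by (simp_all add: w_def c_def field_simps)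
      then show "(g z + (- w) * z) - (g y + (- w) * y) < - c * (z - y) \<longleftrightarrow> g z - g y < u * (z - y)"
        "(g z + (- w) * z) - (g y + (- w) * y) > c * (z - y) \<longleftrightarrow> g z - g y > v * (z - y)"
        by (auto simp: algebra_simps)
    qed
    have "c > 0" using uv by (simp add: c_def)
    from ac_crossing_negligible[OF abs_continuous_on_add_linear[OF ac, of "- w"] this]
    show ?thesis unfolding 1 2 X_def .
  qed
  then have "negligible (\<Union>(u, v)\<in>Q. X u v)"
    using \<open>countable Q\<close> by (intro negligible_countable_Union) (auto simp: Q_def)
  then have "negligible (?S \<union> (\<Union>(u, v)\<in>Q. X u v))"
    by (intro negligible_Un ac_steep_negligible ac)
  then show ?thesis
  proof (rule negligible_subset)
    show "{x \<in> {a<..<b}. \<not> g differentiable (at x)} \<subseteq> ?S \<union> (\<Union>(u, v)\<in>Q. X u v)"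
    proof
      fix x assume x: "x \<in> {x \<in> {a<..<b}. \<not> g differentiable (at x)}"
      show "x \<in> ?S \<union> (\<Union>(u, v)\<in>Q. X u v)"
      proof (rule ccontr)
        assume n: "x \<notin> ?S \<union> (\<Union>(u, v)\<in>Q. X u v)"
        then have "\<not> (\<forall>M. \<forall>d>0. \<exists>y z. y < z \<and> y \<le> x \<and> x \<le> z \<and> z - y < d \<and> \<bar>g z - g y\<bar> > M * (z - y))"
          using x by blast
        then obtain M d0 where d0: "d0 > 0" and M: "\<And>y z. y < z \<Longrightarrow> y \<le> x \<Longrightarrow> x \<le> z \<Longrightarrow> z - y < d0 \<Longrightarrow> \<not> \<bar>g z - g y\<bar> > M * (z - y)"
          by blast
        have "g differentiable (at x)"
        proof (rule differentiable_if_slopes_converge[OF d0, of x g M])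
          show "\<bar>g z - g y\<bar> \<le> M * (z - y)" if "y < z" "y \<le> x" "x \<le> z" "z - y < d0" for y z
            using M[OF that] by simp
          fix u v :: real assume uv: "u \<in> \<rat>" "v \<in> \<rat>" "u < v"
          then have "(u, v) \<in> Q" by (simp add: Q_def)
          then have "x \<notin> X u v" using n by blast
          then show "\<not> ((\<forall>d>0. \<exists>y z. y < z \<and> y \<le> x \<and> x \<le> z \<and> z - y < d \<and> g z - g y < u * (z - y)) \<and>
            (\<forall>d>0. \<exists>y z. y < z \<and> y \<le> x \<and> x \<le> z \<and> z - y < d \<and> g z - g y > v * (z - y)))"
            using x unfolding X_def by blast
        qed
        then show False using x by blast
      qed
    qed
  qed
qed


section \<open>Increments of absolutely continuous functions\<close>

text \<open>Both end points are free because a tagged interval has its tag anywhere inside.\<close>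

lemma derivative_straddle_bound:
  assumes "(g has_real_derivative v) (at x)" "e > 0"
  shows "\<exists>r>0. \<forall>y z. y \<le> x \<and> x \<le> z \<and> x - y < r \<and> z - x < r \<longrightarrow> \<bar>g z - g y\<bar> \<le> (\<bar>v\<bar> + e) * (z - y)"
proof -
  obtain r where r: "r > 0" "\<And>t. \<bar>t - x\<bar> < r \<Longrightarrow> \<bar>g t - g x - v * (t - x)\<bar> \<le> e * \<bar>t - x\<bar>"
    using assms unfolding has_field_derivative_def has_derivative_at_alt by force
  have "\<bar>g z - g y\<bar> \<le> (\<bar>v\<bar> + e) * (z - y)" if A: "y \<le> x \<and> x \<le> z \<and> x - y < r \<and> z - x < r" for y z
  proof -
    have *: "\<bar>g t - g x\<bar> \<le> (\<bar>v\<bar> + e) * \<bar>t - x\<bar>" if "\<bar>t - x\<bar> < r" for t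
    proof -
      have "\<bar>v * (t - x)\<bar> = \<bar>v\<bar> * \<bar>t - x\<bar>" by (rule abs_mult)
      then show ?thesis using r(2)[OF that] by (simp add: distrib_right)
    qed
    have "\<bar>g z - g x\<bar> \<le> (\<bar>v\<bar> + e) * (z - x)" "\<bar>g y - g x\<bar> \<le> (\<bar>v\<bar> + e) * (x - y)"
      using *[of z] *[of y] A by auto
    then have "\<bar>g z - g y\<bar> \<le> (\<bar>v\<bar> + e) * (z - x) + (\<bar>v\<bar> + e) * (x - y)" by linarith
    also have "\<dots> = (\<bar>v\<bar> + e) * (z - y)" by (simp add: algebra_simps)
    finally show ?thesis .
  qed
  then show ?thesis using r(1) by blast
qed

text \<open>Controls, in a Henstock sum, the increments over the intervals tagged in the null set
  \<open>N\<close>: \<open>W\<close> is an open superset of \<open>N\<close> of measure below the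
  \<delta> of absolute continuity. A degenerate interval may occur with several tags; such pairs are
  removed, at no cost, to obtain a division.\<close>

lemma ac_small_tagged_division:
  assumes ac: "abs_continuous_on {a..b} g" and N: "negligible N" and e: "e > 0"
  obtains W where "open W" "N \<subseteq> W"
    "\<And>p. p tagged_partial_division_of {a..b} \<Longrightarrow> \<forall>(x, K)\<in>p. K \<subseteq> W \<Longrightarrow>
       (\<Sum>(x, K)\<in>p. \<bar>g (Sup K) - g (Inf K)\<bar>) < e"
proof -
  obtain \<delta> where \<delta>: "\<delta> > 0" "\<And>D. D division_of \<Union>D \<Longrightarrow> \<Union>D \<subseteq> {a..b} \<Longrightarrow> (\<Sum>K\<in>D. Sup K - Inf K) < \<delta> \<Longrightarrow>
    (\<Sum>K\<in>D. \<bar>g (Sup K) - g (Inf K)\<bar>) < e"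
    by (rule abs_continuous_onD[OF ac e]) (rule that)
  obtain W where W: "open W" "N \<subseteq> W" "W - N \<in> lmeasurable" "emeasure lebesgue (W - N) < ennreal \<delta>"
    by (rule sets_lebesgue_outer_open[OF fmeasurableD[OF negligible_imp_measurable[OF N]] \<delta>(1)]) (rule that)
  have mN: "N \<in> lmeasurable" "measure lebesgue N = 0"
    using N by (simp_all add: negligible_imp_measurable negligible_imp_measure0)
  have "measure lebesgue (W - N) < \<delta>"
    using W(3,4) \<delta>(1) by (simp add: emeasure_eq_measure2 ennreal_less_iff)
  moreover have Weq: "W = N \<union> (W - N)" using W(2) by blast
  moreover have Wm: "W \<in> lmeasurable" using fmeasurable.Un[OF mN(1) W(3)] by (subst Weq)
  moreover have "measure lebesgue W \<le> measure lebesgue N + measure lebesgue (W - N)"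
    using measure_Un_le[OF fmeasurableD[OF mN(1)] fmeasurableD[OF W(3)]] by (subst Weq)
  ultimately have mW: "measure lebesgue W < \<delta>" using mN(2) by simp
  show ?thesis
  proof (rule that[OF W(1,2)])
    fix p assume p: "p tagged_partial_division_of {a..b}" and pW: "\<forall>(x, K)\<in>p. K \<subseteq> W"
    define q where "q = {(x, K) \<in> p. interior K \<noteq> {}}"
    have fin: "finite p" using p by (simp add: tagged_partial_division_of_def)
    have K: "\<exists>y z. y \<le> z \<and> K = {y..z}" if xK: "(x, K) \<in> p" for x K
    proof -
      obtain y z where yz: "K = cbox y z" "x \<in> K"
        using p xK unfolding tagged_partial_division_of_def by blast
      then have "y \<le> z \<and> K = {y..z}" by auto
      then show ?thesis by blast
    qed
    have inj: "inj_on snd q"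
    proof (rule inj_onI)
      fix s t assume st: "s \<in> q" "t \<in> q" "snd s = snd t"
      show "s = t"
      proof (rule ccontr)
        assume ne: "s \<noteq> t"
        obtain x K where s: "s = (x, K)" by fastforce
        obtain y L where t: "t = (y, L)" by fastforce
        have "interior K \<inter> interior L = {}" 
          using p st ne unfolding tagged_partial_division_of_def q_def s t by blast
        then show False using st unfolding q_def s t by simp
      qed
    qed
    define D where "D = snd ` q"
    have Dp: "\<exists>x. (x, K) \<in> p" if "K \<in> D" for K using that by (auto simp: D_def q_def)
    have D: "D division_of \<Union>D"
    proof (rule division_ofI)
      show "finite D" using finite_subset[OF _ fin, of q] by (auto simp: D_def q_def)
      fix K assume "K \<in> D"
      then obtain x where x: "(x, K) \<in> q" by (auto simp: D_def)
      then have xp: "(x, K) \<in> p" by (simp add: q_def)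
      show "K \<subseteq> \<Union>D" using \<open>K \<in> D\<close> by blast
      obtain y z where yz: "y \<le> z" "K = {y..z}" using K[OF xp] by blast
      show "K \<noteq> {}" using yz by simp
      have "K = cbox y z" using yz by simp
      then show "\<exists>a b. K = cbox a b" by blast
      fix L assume L: "L \<in> D" "K \<noteq> L"
      then obtain y where "(y, L) \<in> p" using Dp by blast
      then show "interior K \<inter> interior L = {}"
        using p xp L(2) unfolding tagged_partial_division_of_def by blast
    qed simp
    have DW: "\<Union>D \<subseteq> W" using pW Dp by blast
    have pab: "K \<subseteq> {a..b}" if "(x, K) \<in> p" for x K
      using p that unfolding tagged_partial_division_of_def by blast
    have Dab: "\<Union>D \<subseteq> {a..b}" using pab Dp by blast
    have "measure lebesgue (\<Union>D) \<le> measure lebesgue W"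
      by (rule measure_mono_fmeasurable[OF DW fmeasurableD[OF lmeasurable_division[OF D]] Wm])
    then have "(\<Sum>K\<in>D. Sup K - Inf K) < \<delta>" using mW measure_division_real[OF D] by simp
    then have f1: "(\<Sum>K\<in>D. \<bar>g (Sup K) - g (Inf K)\<bar>) < e" by (rule \<delta>(2)[OF D Dab])
    have f2: "(\<Sum>K\<in>D. \<bar>g (Sup K) - g (Inf K)\<bar>) = (\<Sum>(x, K)\<in>q. \<bar>g (Sup K) - g (Inf K)\<bar>)"
      unfolding D_def by (simp add: sum.reindex[OF inj] case_prod_beta)
    have f3: "(\<Sum>(x, K)\<in>q. \<bar>g (Sup K) - g (Inf K)\<bar>) = (\<Sum>(x, K)\<in>p. \<bar>g (Sup K) - g (Inf K)\<bar>)"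
    proof (rule sum.mono_neutral_left[OF fin])
      show "q \<subseteq> p" by (auto simp: q_def)
      show "\<forall>i\<in>p - q. (case i of (x, K) \<Rightarrow> \<bar>g (Sup K) - g (Inf K)\<bar>) = 0"
      proof
        fix i assume i: "i \<in> p - q"
        obtain x L where iL: "i = (x, L)" by (rule prod.exhaust)
        have xK: "(x, L) \<in> p" and L: "interior L = {}" using i by (simp_all add: iL q_def)
        obtain y z where yz: "y \<le> z" "L = {y..z}" using K[OF xK] by blast
        then have "y = z" using L by simp
        then show "(case i of (x, K) \<Rightarrow> \<bar>g (Sup K) - g (Inf K)\<bar>) = 0" using yz iL by simp
      qed
    qed
    show "(\<Sum>(x, K)\<in>p. \<bar>g (Sup K) - g (Inf K)\<bar>) < e" using f1 unfolding f2 f3 .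
  qed
qed

text \<open>Henstock's argument: the gauge enforces the derivative estimate at tags off
  \<open>N\<close> and inclusion in the small open set \<open>W\<close> at tags in \<open>N\<close>.
  The bound then comes from one fine tagged division, without a theory of indefinite Lebesgue
  integrals.\<close>

lemma ac_increment_bound:
  assumes ac: "abs_continuous_on {a..b} g" and ab: "a \<le> b" and N: "negligible N"
    and der: "\<And>x. x \<in> {a..b} - N \<Longrightarrow> (g has_real_derivative v x) (at x)"
    and int: "(\<lambda>x. \<bar>v x\<bar>) integrable_on {a..b}"
  shows "\<bar>g b - g a\<bar> \<le> integral {a..b} (\<lambda>x. \<bar>v x\<bar>)"
proof (rule field_le_epsilon)
  fix e0 :: real assume e0: "e0 > 0"
  \<comment> \<open>One \<open>e\<close> for the Riemann sum, one for the tags in \<open>N\<close>,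
    and \<open>e\<close> per unit length for the derivative estimate.\<close>
  define e where "e = e0 / (2 + (b - a))"
  have e: "e > 0" using e0 ab by (simp add: e_def)
  let ?I = "integral {a..b} (\<lambda>x. \<bar>v x\<bar>)"
  define w where "w x = (if x \<in> N then 0 else \<bar>v x\<bar>)" for x
  have "(w has_integral ?I) {a..b}"
    by (rule has_integral_spike[OF N _ integrable_integral[OF int]]) (simp add: w_def)
  from spec[OF this[unfolded has_integral_real], of e] e
  have "\<exists>\<gamma>. gauge \<gamma> \<and> (\<forall>p. p tagged_division_of {a..b} \<and> \<gamma> fine p \<longrightarrow>
      norm ((\<Sum>(x, K)\<in>p. measure lborel K *\<^sub>R w x) - ?I) < e)"
    by (rule mp)
  then obtain \<gamma> where \<gamma>: "gauge \<gamma>" "\<forall>p. p tagged_division_of {a..b} \<and> \<gamma> fine p \<longrightarrow>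
      norm ((\<Sum>(x, K)\<in>p. measure lborel K *\<^sub>R w x) - ?I) < e"
    by (elim exE conjE) (rule that)
  obtain W where W: "open W" "N \<subseteq> W"
    "\<And>p. p tagged_partial_division_of {a..b} \<Longrightarrow> \<forall>(x, K)\<in>p. K \<subseteq> W \<Longrightarrow>
       (\<Sum>(x, K)\<in>p. \<bar>g (Sup K) - g (Inf K)\<bar>) < e"
    by (rule ac_small_tagged_division[OF ac N e]) (rule that)
  have "\<exists>r>0. \<forall>y z. y \<le> x \<and> x \<le> z \<and> x - y < r \<and> z - x < r \<longrightarrow> \<bar>g z - g y\<bar> \<le> (\<bar>v x\<bar> + e) * (z - y)"
    if x: "x \<in> {a..b} - N" for x
    by (rule derivative_straddle_bound[OF der[OF x] e])
  then obtain r where r: "\<And>x. x \<in> {a..b} - N \<Longrightarrow> r x > 0 \<and> (\<forall>y z. y \<le> x \<and> x \<le> z \<and> x - y < r x \<and> z - x < r x \<longrightarrow> \<bar>g z - g y\<bar> \<le> (\<bar>v x\<bar> + e) * (z - y))"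
    by metis
  define \<rho> where "\<rho> x = \<gamma> x \<inter> (if x \<in> N then W else if x \<in> {a..b} then ball x (r x) else UNIV)" for x
  have "gauge \<rho>"
    using \<gamma>(1) W(1,2) r unfolding gauge_def \<rho>_def by auto
  then obtain p where p: "p tagged_division_of {a..b}" "\<rho> fine p"
    by (rule fine_division_exists_real)
  have "\<gamma> fine p" using p(2) unfolding fine_def \<rho>_def by blast
  then have near: "norm ((\<Sum>(x, K)\<in>p. measure lborel K *\<^sub>R w x) - ?I) < e" by (rule \<gamma>(2)[rule_format, OF conjI[OF p(1)]])
  let ?i = "\<lambda>(x::real, K). \<bar>g (Sup K) - g (Inf K)\<bar>"
  define p1 where "p1 = {(x, K) \<in> p. x \<in> N}"
  have p1p: "p1 \<subseteq> p" by (auto simp: p1_def)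
  have fin: "finite p" using p(1) by blast
  have part: "p1 tagged_partial_division_of {a..b}"
    using tagged_partial_division_subset[OF _ p1p] p(1) unfolding tagged_division_of_def by blast
  have s1: "sum ?i p1 < e"
  proof (rule W(3)[OF part])
    have "K \<subseteq> W" if "(x, K) \<in> p1" for x K
    proof -
      have "x \<in> N" "(x, K) \<in> p" using that by (auto simp: p1_def)
      then have "K \<subseteq> \<rho> x" using p(2) unfolding fine_def by blast
      then show ?thesis using \<open>x \<in> N\<close> by (simp add: \<rho>_def)
    qed
    then show "\<forall>(x, K)\<in>p1. K \<subseteq> W" by blast
  qed
  have K: "\<exists>y z. y \<le> x \<and> x \<le> z \<and> K = {y..z}" if xK: "(x, K) \<in> p" for x K
  proof -
    obtain y z where "K = cbox y z" using tagged_division_ofD(4)[OF p(1) xK] by blast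
    moreover have "x \<in> K" by (rule tagged_division_ofD(2)[OF p(1) xK])
    ultimately have "y \<le> x \<and> x \<le> z \<and> K = {y..z}" by auto
    then show ?thesis by blast
  qed
  have "sum ?i (p - p1) \<le> (\<Sum>(x, K)\<in>p - p1. measure lborel K *\<^sub>R w x + e * measure lborel K)"
  proof (rule sum_mono, clarify)
    fix x :: real and L assume xL: "(x, L) \<in> p" "(x, L) \<notin> p1"
    then have xN: "x \<notin> N" by (simp add: p1_def)
    have xab: "x \<in> {a..b}"
      using tagged_division_ofD(2)[OF p(1) xL(1)] tagged_division_ofD(3)[OF p(1) xL(1)] by blast
    obtain y z where yz: "y \<le> x" "x \<le> z" "L = {y..z}" using K[OF xL(1)] by blast
    have "L \<subseteq> \<rho> x" using p(2) xL(1) unfolding fine_def by blast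
    then have "L \<subseteq> ball x (r x)" using xN xab by (simp add: \<rho>_def)
    moreover have "y \<in> L" "z \<in> L" using yz by simp_all
    ultimately have "y \<in> ball x (r x)" "z \<in> ball x (r x)" by blast+
    then have "x - y < r x" "z - x < r x" using yz by (auto simp: dist_real_def)
    then have "\<bar>g z - g y\<bar> \<le> (\<bar>v x\<bar> + e) * (z - y)" using r[of x] xN xab yz by blast
    then show "\<bar>g (Sup L) - g (Inf L)\<bar> \<le> measure lborel L *\<^sub>R w x + e * measure lborel L"
      using yz xN by (simp add: w_def algebra_simps)
  qed
  also have "\<dots> \<le> (\<Sum>(x, K)\<in>p. measure lborel K *\<^sub>R w x + e * measure lborel K)"
  proof (rule sum_mono2[OF fin])
    show "0 \<le> (case i of (x, K) \<Rightarrow> measure lborel K *\<^sub>R w x + e * measure lborel K)" if "i \<in> p - (p - p1)" for i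
      using e by (auto simp: w_def split: prod.splits)
  qed auto
  also have "\<dots> = (\<Sum>(x, K)\<in>p. measure lborel K *\<^sub>R w x) + e * (\<Sum>(x, K)\<in>p. measure lborel K)"
    by (simp add: sum.distrib sum_distrib_left case_prod_beta)
  also have "(\<Sum>(x, K)\<in>p. measure lborel K) = (\<Sum>(x, K)\<in>p. Sup K - Inf K)"
  proof (rule sum.cong[OF refl])
    fix i assume i: "i \<in> p"
    obtain x L where iL: "i = (x, L)" by (rule prod.exhaust)
    then obtain y z where "y \<le> x" "x \<le> z" "L = {y..z}" using K i by blast
    then show "(case i of (x, K) \<Rightarrow> measure lborel K) = (case i of (x, K) \<Rightarrow> Sup K - Inf K)"
      using iL by simp
  qed
  also have "\<dots> = b - a" using additive_tagged_division_1[OF ab p(1), of "\<lambda>x. x"] by simp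
  finally have s3: "sum ?i (p - p1) \<le> ?I + e + e * (b - a)" using near by (simp add: abs_less_iff)
  have "g b - g a = (\<Sum>(x, K)\<in>p. g (Sup K) - g (Inf K))"
    using additive_tagged_division_1[OF ab p(1), of g] by simp
  also have "\<bar>\<dots>\<bar> \<le> sum ?i p" by (rule order_trans[OF sum_abs]) (auto intro!: sum_mono split: prod.splits)
  also have "sum ?i p = sum ?i (p - p1) + sum ?i p1" by (rule sum.subset_diff[OF p1p fin])
  also have "\<dots> \<le> ?I + e * (2 + (b - a))" using s1 s3 by (simp add: algebra_simps)
  also have "e * (2 + (b - a)) = e0" using ab by (simp add: e_def)
  finally show "\<bar>g b - g a\<bar> \<le> ?I + e0" .
qed

section \<open>Smooth transition functions and Leibniz products\<close>

text \<open>At \<open>a\<close> the one-sided derivatives of order k are \<open>A (Suc k) a\<close>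
  and \<open>B (Suc k) a\<close>; hence agreement is required up to order m inclusive.\<close>

lemma deriv_chain_glue:
  assumes A: "deriv_chain m A" and B: "deriv_chain m B" and eq: "\<And>k. k \<le> m \<Longrightarrow> A k a = B k a"
  shows "deriv_chain m (\<lambda>k t. if t \<le> a then A k t else B k t)"
  unfolding deriv_chain_def
proof (intro allI impI)
  fix k t assume k: "k < m"
  let ?f = "\<lambda>s. if s \<le> a then A k s else B k s"
  have dA: "(A k has_real_derivative A (Suc k) s) (at s)" and dB: "(B k has_real_derivative B (Suc k) s) (at s)" for s
    using deriv_chainD[OF A k] deriv_chainD[OF B k] by auto
  consider "t < a" | "t > a" | "t = a" by linarith
  then show "(?f has_real_derivative (if t \<le> a then A (Suc k) t else B (Suc k) t)) (at t)"
  proof cases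
    case 1
    have "(?f has_real_derivative A (Suc k) t) (at t)"
      by (rule has_field_derivative_transform_within_open[OF dA, of "{..<a}"]) (use 1 in auto)
    then show ?thesis using 1 by simp
  next
    case 2
    have "(?f has_real_derivative B (Suc k) t) (at t)"
      by (rule has_field_derivative_transform_within_open[OF dB, of "{a<..}"]) (use 2 in auto)
    then show ?thesis using 2 by simp
  next
    case 3
    have e0: "A k a = B k a" and e1: "A (Suc k) a = B (Suc k) a" using eq k by auto
    have L: "(?f has_real_derivative A (Suc k) a) (at a within {..a})"
      by (rule has_field_derivative_transform_within[OF DERIV_subset[OF dA[of a] subset_UNIV] zero_less_one]) auto
    have "(?f has_real_derivative B (Suc k) a) (at a within {a..})"
    proof (rule has_field_derivative_transform_within[OF DERIV_subset[OF dB[of a] subset_UNIV] zero_less_one])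
      show "B k s = ?f s" if "s \<in> {a..}" "dist s a < 1" for s using that e0 by (cases "s = a") auto
    qed simp
    then have R: "(?f has_real_derivative A (Suc k) a) (at a within {a..})" using e1 by simp
    have "((\<lambda>y. (?f y - ?f a) / (y - a)) \<longlongrightarrow> A (Suc k) a) (at a within {..a} \<union> {a..})"
      unfolding at_within_union
      by (rule filterlim_sup[OF L[unfolded has_field_derivative_iff] R[unfolded has_field_derivative_iff]])
    then have "(?f has_real_derivative A (Suc k) a) (at a within {..a} \<union> {a..})"
      unfolding has_field_derivative_iff .
    moreover have "{..a} \<union> {a..} = (UNIV :: real set)" by auto
    ultimately show ?thesis using 3 by simp
  qed
qed

lemma dvd_pderiv_of_power_dvd:
  fixes P :: "real poly"
  assumes "[:- a, 1:] ^ Suc n dvd P" shows "[:- a, 1:] ^ n dvd pderiv P"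
proof -
  obtain U where U: "P = [:- a, 1:] ^ Suc n * U" using assms by (auto elim: dvdE)
  have "pderiv P = [:- a, 1:] ^ n * ([:- a, 1:] * pderiv U + smult (of_nat (Suc n)) U)"
    unfolding U pderiv_mult pderiv_power_Suc by (simp add: pderiv_pCons algebra_simps del: power_Suc) (simp add: algebra_simps)
  then show ?thesis by simp
qed

lemma poly_higher_pderiv_eq_0:
  fixes P :: "real poly"
  assumes "[:- a, 1:] ^ Suc n dvd P" "k \<le> n" shows "poly ((pderiv ^^ k) P) a = 0"
  using assms
proof (induction k arbitrary: n P)
  case 0
  then have "[:- a, 1:] dvd P" by (metis dvd_mult_left power_Suc)
  then show ?case by (simp add: poly_eq_0_iff_dvd)
next
  case (Suc k)
  then obtain n' where n': "n = Suc n'" by (cases n) auto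
  then show ?case using Suc.IH[of n' "pderiv P"] dvd_pderiv_of_power_dvd[of a n P] Suc.prems
    by (simp add: funpow_swap1)
qed

lemma higher_pderiv_diff: "(pderiv ^^ k) (P - Q) = (pderiv ^^ k) P - (pderiv ^^ k) (Q :: real poly)"
  by (induction k) (simp_all add: pderiv_diff)

text \<open>Split the binomial expansion of \<open>1 = (X + (1 - X)) ^ (2 * n + 1)\<close> in the middle.\<close>

lemma smoothstep_poly:
  obtains R :: "real poly" where "[:0, 1:] ^ Suc n dvd R" "[:- 1, 1:] ^ Suc n dvd (1 - R)"
proof -
  let ?X = "[:0, 1:] :: real poly" and ?Y = "[:1, - 1:] :: real poly"
  let ?N = "Suc (2 * n)"
  let ?c = "\<lambda>k. of_nat (?N choose k) * ?X ^ k * ?Y ^ (?N - k)"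
  define R where "R = (\<Sum>k\<in>{Suc n..?N}. ?c k)"
  have "?X + ?Y = 1" by (simp add: one_pCons)
  then have "(1 :: real poly) = (?X + ?Y) ^ ?N" by (simp only: power_one)
  also have "\<dots> = (\<Sum>k\<le>?N. ?c k)" by (rule binomial_ring)
  also have "{..?N} = {..n} \<union> {Suc n..?N}" by auto
  also have "sum ?c \<dots> = sum ?c {..n} + R" unfolding R_def by (rule sum.union_disjoint) auto
  finally have eq: "1 - R = sum ?c {..n}" by (simp add: algebra_simps)
  show ?thesis
  proof
    show "[:0, 1:] ^ Suc n dvd R" unfolding R_def
    proof (rule dvd_sum)
      fix k assume "k \<in> {Suc n..?N}"
      then have "?X ^ Suc n dvd ?X ^ k" by (intro le_imp_power_dvd) auto
      then show "?X ^ Suc n dvd ?c k" by (intro dvd_mult2 dvd_mult)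
    qed
    have Y: "?Y = - [:- 1, 1:]" by simp
    show "[:- 1, 1:] ^ Suc n dvd (1 - R)" unfolding eq
    proof (rule dvd_sum)
      fix k assume "k \<in> {..n}"
      then have "[:- 1, 1:] ^ Suc n dvd ?Y ^ (?N - k)"
        unfolding Y power_minus[of "[:- 1, 1 :: real:]"] by (intro dvd_mult le_imp_power_dvd) auto
      then show "[:- 1, 1:] ^ Suc n dvd ?c k" by (rule dvd_mult)
    qed
  qed
qed

text \<open>\<open>H\<close> is the polynomial of \<open>smoothstep_poly\<close> on [0, 1],
  continued by the constants 0 and 1. Contact of order m + 1 at both ends gives a chain of length
  \<open>Suc m\<close>. Each \<open>H k\<close> with k <= m is bounded, being continuous on the
  compact [0, 1] and constant on either side of it.\<close>

lemma smoothstep_exists: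
  obtains H B where "deriv_chain (Suc m) H" "B \<ge> (1::real)"
    "\<And>k t. k \<le> Suc m \<Longrightarrow> t \<le> 0 \<Longrightarrow> H k t = 0" "\<And>t. t \<ge> 1 \<Longrightarrow> H 0 t = 1"
    "\<And>k t. 0 < k \<Longrightarrow> k \<le> Suc m \<Longrightarrow> t \<ge> 1 \<Longrightarrow> H k t = 0"
    "\<And>k t. k \<le> m \<Longrightarrow> \<bar>H k t\<bar> \<le> B"
proof -
  obtain R :: "real poly" where R: "[:0, 1:] ^ Suc (Suc m) dvd R" "[:- 1, 1:] ^ Suc (Suc m) dvd (1 - R)"
    by (rule smoothstep_poly)
  let ?P = "\<lambda>(p::real poly) k. poly ((pderiv ^^ k) p)"
  have R0: "?P R k 0 = 0" if "k \<le> Suc m" for k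
    using poly_higher_pderiv_eq_0[of 0 "Suc m" R k] R(1) that by simp
  have R1: "?P R k 1 = ?P 1 k 1" if "k \<le> Suc m" for k
    using poly_higher_pderiv_eq_0[OF R(2) that] by (simp add: higher_pderiv_diff)
  have one0: "?P 1 0 t = 1" for t by simp
  have one: "?P 1 k t = 0" if k0: "k > 0" for k t
  proof -
    obtain j where "k = Suc j" using k0 gr0_conv_Suc by blast
    then show ?thesis by (simp add: funpow_swap1 pderiv_1)
  qed
  define G where "G k t = (if t \<le> 0 then ?P 0 k t else ?P R k t)" for k t
  define H where "H k t = (if t \<le> 1 then G k t else ?P 1 k t)" for k t
  have G: "deriv_chain (Suc m) G" unfolding G_def
    by (rule deriv_chain_glue[OF deriv_chain_poly deriv_chain_poly]) (simp add: R0)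
  have H: "deriv_chain (Suc m) H" unfolding H_def
    by (rule deriv_chain_glue[OF G deriv_chain_poly]) (simp add: G_def R1)
  have H0: "H k t = 0" if "k \<le> Suc m" "t \<le> 0" for k t using that by (simp add: H_def G_def)
  have H1: "H k t = ?P 1 k t" if "k \<le> Suc m" "t \<ge> 1" for k t
  proof (cases "t = 1")
    case True
    then show ?thesis using R1[OF that(1)] one[of k] one0 by (cases "k = 0") (simp_all add: H_def G_def)
  next
    case False
    then show ?thesis using that by (simp add: H_def)
  qed
  have "\<exists>B. \<forall>t. \<bar>H k t\<bar> \<le> B" if k: "k \<le> m" for k
  proof -
    have "continuous_on {0..1} (H k)" by (rule deriv_chain_continuous[OF H]) (use k in simp)
    then have "compact (H k ` {0..1})" by (rule compact_continuous_image) simp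
    then obtain b where b: "\<forall>y\<in>H k ` {0..1}. norm y \<le> b" using compact_imp_bounded bounded_iff by blast
    have "\<bar>H k t\<bar> \<le> max b 1" for t
    proof -
      consider "t \<le> 0" | "t \<ge> 1" | "t \<in> {0..1}" by fastforce
      then show ?thesis
      proof cases
        case 1 then show ?thesis using H0[of k t] k by simp
      next
        case 2 then show ?thesis using H1[of k t] k one[of k t] one0[of t] by (cases "k = 0") simp_all
      next
        case 3 then show ?thesis using b by (simp add: le_max_iff_disj)
      qed
    qed
    then show ?thesis by blast
  qed
  then obtain b where b: "\<And>k t. k \<le> m \<Longrightarrow> \<bar>H k t\<bar> \<le> b k" by metis
  define B where "B = 1 + (\<Sum>k\<le>m. \<bar>b k\<bar>)"
  have bB: "b k \<le> B" if "k \<le> m" for k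
  proof -
    have "\<bar>b k\<bar> \<le> (\<Sum>k\<le>m. \<bar>b k\<bar>)" using that by (intro member_le_sum) auto
    then show ?thesis by (simp add: B_def)
  qed
  show ?thesis
  proof (rule that[of H B])
    show "1 \<le> B" by (simp add: B_def sum_nonneg)
    show "H 0 t = 1" if "t \<ge> 1" for t using H1[of 0 t] that by simp
    show "H k t = 0" if "0 < k" "k \<le> Suc m" "t \<ge> 1" for k t using H1[of k t] one[of k t] that by simp
    show "\<bar>H k t\<bar> \<le> B" if "k \<le> m" for k t using b[OF that, of t] bB[OF that] by linarith
  qed (fact H, rule H0)
qed

section \<open>Leibniz products and derivatives of nodal polynomials\<close>

definition leibniz :: "(nat \<Rightarrow> real \<Rightarrow> real) \<Rightarrow> (nat \<Rightarrow> real \<Rightarrow> real) \<Rightarrow> nat \<Rightarrow> real \<Rightarrow> real" where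
  "leibniz A B k t = (\<Sum>r\<le>k. of_nat (k choose r) * A r t * B (k - r) t)"

lemma leibniz_0 [simp]: "leibniz A B 0 t = A 0 t * B 0 t"
  by (simp add: leibniz_def)

lemma deriv_chain_leibniz:
  assumes A: "deriv_chain m A" and B: "deriv_chain m B"
  shows "deriv_chain m (leibniz A B)"
  unfolding deriv_chain_def
proof (intro allI impI)
  fix k t assume k: "k < m"
  have "(leibniz A B k has_real_derivative
      (\<Sum>r\<le>k. of_nat (k choose r) * (A (Suc r) t * B (k - r) t + A r t * B (Suc (k - r)) t))) (at t)"
    unfolding leibniz_def[abs_def]
  proof (rule DERIV_sum)
    fix r assume r: "r \<in> {..k}"
    have a: "(A r has_real_derivative A (Suc r) t) (at t)" using deriv_chainD[OF A, of r t] r k by simp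
    have b: "(B (k - r) has_real_derivative B (Suc (k - r)) t) (at t)" using deriv_chainD[OF B, of "k - r" t] r k by simp
    show "((\<lambda>t. of_nat (k choose r) * A r t * B (k - r) t) has_real_derivative
        of_nat (k choose r) * (A (Suc r) t * B (k - r) t + A r t * B (Suc (k - r)) t)) (at t)"
      using DERIV_cmult[OF DERIV_mult'[OF a b], of "of_nat (k choose r)"] by (simp add: algebra_simps)
  qed
  moreover have "(\<Sum>r\<le>k. of_nat (k choose r) * (A (Suc r) t * B (k - r) t + A r t * B (Suc (k - r)) t)) =
      leibniz A B (Suc k) t"
  proof -
    have 1: "(\<Sum>r\<le>k. of_nat (k choose r) * A r t * B (Suc (k - r)) t) =
        (\<Sum>r\<le>Suc k. of_nat (k choose r) * A r t * B (Suc k - r) t)"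
      by (simp add: Suc_diff_le)
    have 2: "(\<Sum>r\<le>Suc k. of_nat (k choose r) * A r t * B (Suc k - r) t) =
        A 0 t * B (Suc k) t + (\<Sum>r\<le>k. of_nat (k choose Suc r) * A (Suc r) t * B (k - r) t)"
      by (subst sum.atMost_Suc_shift) simp
    have 3: "leibniz A B (Suc k) t =
        A 0 t * B (Suc k) t + (\<Sum>r\<le>k. of_nat (Suc k choose Suc r) * A (Suc r) t * B (k - r) t)"
      unfolding leibniz_def by (subst sum.atMost_Suc_shift) simp
    have "(\<Sum>r\<le>k. of_nat (k choose r) * (A (Suc r) t * B (k - r) t + A r t * B (Suc (k - r)) t)) =
      (\<Sum>r\<le>k. of_nat (k choose r) * A (Suc r) t * B (k - r) t) +
      (\<Sum>r\<le>k. of_nat (k choose r) * A r t * B (Suc (k - r)) t)"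
      by (simp add: algebra_simps sum.distrib)
    then show ?thesis unfolding 1 2 3 by (simp add: algebra_simps sum.distrib)
  qed
  ultimately show "(leibniz A B k has_real_derivative leibniz A B (Suc k) t) (at t)" by simp
qed

lemma leibniz_bound:
  assumes "\<And>r. r \<le> k \<Longrightarrow> \<bar>A r t * B (k - r) t\<bar> \<le> M"
  shows "\<bar>leibniz A B k t\<bar> \<le> 2 ^ k * M"
proof -
  have "\<bar>leibniz A B k t\<bar> \<le> (\<Sum>r\<le>k. \<bar>of_nat (k choose r) * A r t * B (k - r) t\<bar>)"
    unfolding leibniz_def by (rule sum_abs)
  also have "\<dots> \<le> (\<Sum>r\<le>k. of_nat (k choose r) * M)"
    using assms by (intro sum_mono) (auto simp: abs_mult mult.assoc intro!: mult_left_mono)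
  also have "\<dots> = of_nat (\<Sum>r\<le>k. k choose r) * M" by (simp add: sum_distrib_right)
  also have "\<dots> = 2 ^ k * M" by (simp add: choose_row_sum)
  finally show ?thesis .
qed

lemma pderiv_linear_mult: "pderiv ([:- a, 1:] * P) = [:- a, 1:] * pderiv P + (P :: real poly)"
  unfolding pderiv_mult by (simp add: pderiv_pCons)

lemma higher_pderiv_linear_mult:
  "(pderiv ^^ Suc k) ([:- a, 1:] * P) = [:- a, 1:] * (pderiv ^^ Suc k) P + smult (of_nat (Suc k)) ((pderiv ^^ k) (P::real poly))"
proof (induction k)
  case 0
  show ?case using pderiv_linear_mult[of a P] by simp
next
  case (Suc k)
  have "(pderiv ^^ Suc (Suc k)) ([:- a, 1:] * P) = pderiv ((pderiv ^^ Suc k) ([:- a, 1:] * P))" by simp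
  also have "\<dots> = pderiv ([:- a, 1:] * (pderiv ^^ Suc k) P + smult (of_nat (Suc k)) ((pderiv ^^ k) P))"
    by (simp only: Suc.IH)
  also have "\<dots> = [:- a, 1:] * (pderiv ^^ Suc (Suc k)) P + (pderiv ^^ Suc k) P + smult (of_nat (Suc k)) ((pderiv ^^ Suc k) P)"
    unfolding pderiv_add pderiv_smult pderiv_linear_mult by simp
  also have "\<dots> = [:- a, 1:] * (pderiv ^^ Suc (Suc k)) P + smult (of_nat (Suc (Suc k))) ((pderiv ^^ Suc k) P)"
    unfolding of_nat_Suc[of "Suc k"] smult_add_left smult_1_left by (simp only: add.assoc)
  finally show ?case .
qed

lemma higher_pderiv_degree_less:
  fixes P :: "real poly"
  assumes "degree P < k" shows "(pderiv ^^ k) P = 0"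
proof -
  have "coeff ((pderiv ^^ k) P) n = 0" for n
    using assms by (simp add: coeff_higher_pderiv coeff_eq_0)
  then show ?thesis by (simp add: poly_eq_iff)
qed

text \<open>Induction on the nodes: the k-th derivative of (X - a) N is (X - a) times that of N plus
  k times the derivative of order k - 1. The factorial comes from (n + 1)! + (n + 1) (n + 1)! = (n +
  2)!.\<close>

lemma nodal_higher_pderiv_bound:
  fixes S :: "real set"
  assumes "finite S" "\<And>s. s \<in> S \<Longrightarrow> \<bar>t - s\<bar> \<le> L" "k \<le> card S"
  shows "\<bar>poly ((pderiv ^^ k) (\<Prod>s\<in>S. [:- s, 1:])) t\<bar> \<le> fact (Suc (card S)) * L ^ (card S - k)"
  using assms
proof (induction S arbitrary: k)
  case empty then show ?case by simp
next
  case (insert a S)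
  let ?N = "\<Prod>s\<in>S. [:- s, 1::real:]" and ?n = "card S"
  have L: "0 \<le> L" using insert.prems(1)[of a, OF insertI1] abs_ge_zero[of "t - a"] by linarith
  have ta: "\<bar>t - a\<bar> \<le> L" using insert.prems(1) by simp
  have IH: "\<bar>poly ((pderiv ^^ k) ?N) t\<bar> \<le> fact (Suc ?n) * L ^ (?n - k)" if "k \<le> ?n" for k
    using insert.IH[of k] insert.prems(1) that by simp
  have z: "(pderiv ^^ k) ?N = 0" if "k > ?n" for k
    by (rule higher_pderiv_degree_less) (use degree_nodal_poly[of S] that in simp)
  have pr: "(\<Prod>s\<in>insert a S. [:- s, 1::real:]) = [:- a, 1:] * ?N" using insert.hyps by simp
  have cs: "card (insert a S) = Suc ?n" using insert.hyps by simp
  have F1: "fact (Suc ?n) \<le> (fact (Suc (Suc ?n)) :: real)" by (rule fact_mono) simp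
  show ?case
  proof (cases k)
    case 0
    have "\<bar>(t - a) * poly ?N t\<bar> \<le> L * (fact (Suc ?n) * L ^ ?n)"
      unfolding abs_mult using ta IH[of 0] L by (intro mult_mono) auto
    also have "\<dots> = fact (Suc ?n) * L ^ Suc ?n" by simp
    also have "\<dots> \<le> fact (Suc (Suc ?n)) * L ^ Suc ?n" using F1 L by (intro mult_right_mono) auto
    finally show ?thesis unfolding pr cs 0 by (simp add: algebra_simps)
  next
    case (Suc j)
    then have j: "j \<le> ?n" using insert.prems(2) cs by simp
    have 1: "\<bar>(t - a) * poly ((pderiv ^^ Suc j) ?N) t\<bar> \<le> fact (Suc ?n) * L ^ (?n - j)"
    proof (cases "Suc j \<le> ?n")
      case True
      have "\<bar>(t - a) * poly ((pderiv ^^ Suc j) ?N) t\<bar> \<le> L * (fact (Suc ?n) * L ^ (?n - Suc j))"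
        unfolding abs_mult using ta IH[OF True] L by (intro mult_mono) auto
      also have "\<dots> = fact (Suc ?n) * L ^ Suc (?n - Suc j)" by simp
      also have "Suc (?n - Suc j) = ?n - j" using True by simp
      finally show ?thesis .
    next
      case False
      then have "(pderiv ^^ Suc j) ?N = 0" by (intro z) simp
      then show ?thesis using L by (simp del: funpow.simps)
    qed
    have 2: "\<bar>of_nat (Suc j) * poly ((pderiv ^^ j) ?N) t\<bar> \<le> of_nat (Suc ?n) * (fact (Suc ?n) * L ^ (?n - j))"
      unfolding abs_mult using IH[OF j] j L by (intro mult_mono) auto
    have "poly ((pderiv ^^ k) (\<Prod>s\<in>insert a S. [:- s, 1:])) t =
        (t - a) * poly ((pderiv ^^ Suc j) ?N) t + of_nat (Suc j) * poly ((pderiv ^^ j) ?N) t"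
      unfolding pr Suc higher_pderiv_linear_mult by (simp add: algebra_simps del: funpow.simps)
    then have "\<bar>poly ((pderiv ^^ k) (\<Prod>s\<in>insert a S. [:- s, 1:])) t\<bar> \<le>
        fact (Suc ?n) * L ^ (?n - j) + of_nat (Suc ?n) * (fact (Suc ?n) * L ^ (?n - j))"
      using 1 2 by linarith
    also have "\<dots> = fact (Suc (Suc ?n)) * L ^ (?n - j)" by (simp add: algebra_simps)
    finally show ?thesis unfolding cs Suc by simp
  qed
qed

section \<open>Extension from points in an interval of length 2\<close>

text \<open>Induction along Newton's form. Only windows that begin at \<open>a\<close> occur, which
  confines the low-order cost of a cluster to its first point. Nodes and \<open>t\<close> lie in an
  interval of length 2, whence the power of 2.\<close>

lemma lagrange_poly_higher_pderiv_bound: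
  fixes x :: "nat \<Rightarrow> real"
  assumes x: "strict_mono_on {a..b} x" and xu: "x ` {a..b} \<subseteq> {u - 1..u + 1}" and t: "t \<in> {u - 1..u + 1}"
    and n: "a + n \<le> b" "n < m"
  shows "\<bar>poly ((pderiv ^^ k) (lagrange_poly f (x ` {a..a + n}))) t\<bar> \<le>
    fact (Suc m) * 2 ^ m * (\<Sum>j\<le>n. \<bar>divided_difference f (x ` {a..a + j})\<bar>)"
  using n
proof (induction n)
  case 0
  have "lagrange_poly f {x a} = [:f (x a):]" by (rule lagrange_poly_eqI) auto
  moreover have "\<bar>poly ((pderiv ^^ k) [:f (x a):]) t\<bar> \<le> \<bar>f (x a)\<bar>"
    by (cases k) (simp_all add: funpow_swap1 pderiv_pCons)
  moreover have "(1::real) \<le> fact (Suc m) * 2 ^ m"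
    using mult_mono[of "1::real" "fact (Suc m)" 1 "2 ^ m"] fact_ge_1[of "Suc m", where 'a = real] by simp
  then have "1 * \<bar>f (x a)\<bar> \<le> fact (Suc m) * 2 ^ m * \<bar>f (x a)\<bar>" by (rule mult_right_mono) simp
  ultimately show ?case by simp
next
  case (Suc n)
  let ?S = "x ` {a..a + n}" and ?y = "x (a + Suc n)"
  let ?N = "\<Prod>s\<in>?S. [:- s, 1::real:]" and ?d = "divided_difference f (x ` {a..a + Suc n})"
  have inj: "inj_on x {a..b}" using x by (rule strict_mono_on_imp_inj_on)
  have inj': "inj_on x {a..a + n}" using inj Suc.prems(1) by (auto intro: inj_on_subset)
  have card: "card ?S = Suc n" using card_image[OF inj'] by simp
  have ins: "x ` {a..a + Suc n} = insert ?y ?S"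
  proof -
    have "{a..a + Suc n} = insert (a + Suc n) {a..a + n}" by auto
    then show ?thesis by simp
  qed
  have nin: "?y \<notin> ?S" using inj_on_eq_iff[OF inj, of "a + Suc n"] Suc.prems(1) by force
  have L: "lagrange_poly f (x ` {a..a + Suc n}) = lagrange_poly f ?S + smult ?d ?N"
    unfolding ins by (rule lagrange_poly_insert[OF _ _ nin]) auto
  have N: "\<bar>poly ((pderiv ^^ k) ?N) t\<bar> \<le> fact (Suc m) * 2 ^ m"
  proof (cases "k \<le> Suc n")
    case True
    have "\<bar>poly ((pderiv ^^ k) ?N) t\<bar> \<le> fact (Suc (card ?S)) * 2 ^ (card ?S - k)"
    proof (rule nodal_higher_pderiv_bound)
      show "\<bar>t - s\<bar> \<le> 2" if "s \<in> ?S" for s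
      proof -
        have "s \<in> {u - 1..u + 1}" using that xu Suc.prems(1) by fastforce
        then show ?thesis using t by (auto simp: abs_le_iff)
      qed
    qed (use True card in simp_all)
    also have "\<dots> \<le> fact (Suc m) * 2 ^ m"
      using Suc.prems(2) unfolding card by (intro mult_mono fact_mono power_increasing) simp_all
    finally show ?thesis .
  next
    case False
    then have "(pderiv ^^ k) ?N = 0"
      by (intro higher_pderiv_degree_less order.strict_trans1[OF degree_nodal_poly]) (simp add: card)
    then show ?thesis by simp
  qed
  have IH: "\<bar>poly ((pderiv ^^ k) (lagrange_poly f ?S)) t\<bar> \<le>
    fact (Suc m) * 2 ^ m * (\<Sum>j\<le>n. \<bar>divided_difference f (x ` {a..a + j})\<bar>)"
    using Suc.IH Suc.prems by simp
  have "poly ((pderiv ^^ k) (lagrange_poly f (x ` {a..a + Suc n}))) t =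
      poly ((pderiv ^^ k) (lagrange_poly f ?S)) t + ?d * poly ((pderiv ^^ k) ?N) t"
    unfolding L by (simp add: higher_pderiv_add higher_pderiv_smult)
  also have "\<bar>\<dots>\<bar> \<le> fact (Suc m) * 2 ^ m * (\<Sum>j\<le>n. \<bar>divided_difference f (x ` {a..a + j})\<bar>) +
      \<bar>?d\<bar> * (fact (Suc m) * 2 ^ m)"
    using IH mult_left_mono[OF N abs_ge_zero[of ?d]] abs_mult[of ?d] by (intro order_trans[OF abs_triangle_ineq] add_mono) simp_all
  also have "\<dots> = fact (Suc m) * 2 ^ m * (\<Sum>j\<le>Suc n. \<bar>divided_difference f (x ` {a..a + j})\<bar>)"
    by (simp add: algebra_simps)
  finally show ?case .
qed

text \<open>\<open>E\<close> is the product of the step function, rescaled to the gap of length h,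
  and the nodal polynomial of the m - 1 inner points. Let D be the window length. On the gap the
  r-th derivative of the first factor is at most B (m / D)^r, as D <= m h, and the k-th derivative
  of the second at most m! D^(m - 1 - k). So order m costs 1 / D, which the factor x (i + m) - x i
  cancels. Right of the gap \<open>E\<close> is a polynomial of degree below m; hence order m lives
  on the gap only. The additional power of 2 for the lower orders comes from D <= 2.\<close>

lemma transition_term:
  fixes x :: "nat \<Rightarrow> real"
  assumes m: "m \<ge> 1" and H: "deriv_chain (Suc m) H" and B: "B \<ge> (1::real)"
    and H0: "\<And>k t. k \<le> Suc m \<Longrightarrow> t \<le> 0 \<Longrightarrow> H k t = 0" and H1: "\<And>t. t \<ge> 1 \<Longrightarrow> H 0 t = 1"
    and Hk: "\<And>k t. 0 < k \<Longrightarrow> k \<le> Suc m \<Longrightarrow> t \<ge> 1 \<Longrightarrow> H k t = 0"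
    and HB: "\<And>k t. k \<le> m \<Longrightarrow> \<bar>H k t\<bar> \<le> B"
    and x: "strict_mono_on {i..i + m} x" and xu: "x ` {i..i + m} \<subseteq> {u - 1..u + 1}"
    and g: "i \<le> g" "g < i + m" "x (i + m) - x i \<le> m * (x (Suc g) - x g)"
  shows "\<exists>E. deriv_chain (Suc m) E \<and> (\<forall>t\<le>x g. E 0 t = 0) \<and>
    (\<forall>t\<ge>x (Suc g). E 0 t = poly (\<Prod>s\<in>x ` {Suc i..<i + m}. [:- s, 1:]) t) \<and>
    (\<forall>t. t \<notin> {x g<..<x (Suc g)} \<longrightarrow> E m t = 0) \<and>
    (\<forall>t. (x (i + m) - x i) * \<bar>E m t\<bar> \<le> 2 ^ m * (B * real m ^ m * fact m)) \<and>
    (\<forall>t\<in>{u - 1..u + 1}. \<forall>k<m. \<bar>E k t\<bar> \<le> 2 ^ m * (B * real m ^ m * fact m) * 2 ^ m)"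
proof -
  define h where "h = x (Suc g) - x g"
  define D where "D = x (i + m) - x i"
  define S where "S = x ` {Suc i..<i + m}"
  define Q where "Q = (\<Prod>s\<in>S. [:- s, 1::real:])"
  define T where "T k t = (1 / h) ^ k * H k ((1 / h) * t + (- x g / h))" for k t
  define P where "P k = poly ((pderiv ^^ k) Q)" for k
  define E where "E = leibniz T P"
  define M where "M = B * real m ^ m * fact m"
  have xmono: "x p < x q" if "i \<le> p" "p < q" "q \<le> i + m" for p q
    using strict_mono_onD[OF x, of p q] that by simp
  have xle: "x p \<le> x q" if "i \<le> p" "p \<le> q" "q \<le> i + m" for p q
    using xmono[of p q] that by (cases "p = q") auto
  have h: "h > 0" unfolding h_def using xmono[of g "Suc g"] g by simp
  have D: "D > 0" unfolding D_def using xmono[of i "i + m"] m by simp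
  have Dh: "D \<le> m * h" using g(3) by (simp add: D_def h_def)
  have xin: "x p \<in> {u - 1..u + 1}" if "i \<le> p" "p \<le> i + m" for p
    by (rule subsetD[OF xu imageI]) (use that in simp)
  have D2: "D \<le> 2" using xin[of i] xin[of "i + m"] by (simp add: D_def)
  have inj: "inj_on x {Suc i..<i + m}"
    by (rule inj_on_subset[OF strict_mono_on_imp_inj_on[OF x]]) auto
  have finS: "finite S" by (simp add: S_def)
  have cS: "card S = m - 1" unfolding S_def using card_image[OF inj] by simp
  have arg: "(1 / h) * t + (- x g / h) = (t - x g) / h" for t by (simp add: diff_divide_distrib)
  have T: "T k t = (1 / h) ^ k * H k ((t - x g) / h)" for k t unfolding T_def arg ..
  have chT: "deriv_chain (Suc m) T" unfolding T_def by (rule deriv_chain_affine[OF H])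
  have chE: "deriv_chain (Suc m) E" unfolding E_def
    by (rule deriv_chain_leibniz[OF chT]) (use deriv_chain_poly[of "Suc m" Q] in \<open>simp add: P_def[abs_def]\<close>)
  have T0: "T k t = 0" if "k \<le> m" "t \<le> x g" for k t
    using that h H0[of k "(t - x g) / h"] by (simp add: T divide_nonpos_pos)
  have tge: "(t - x g) / h \<ge> 1" if "t \<ge> x (Suc g)" for t using that h by (simp add: h_def pos_le_divide_eq)
  have T1: "T 0 t = 1" if "t \<ge> x (Suc g)" for t using H1[OF tge[OF that]] by (simp add: T)
  have Tk: "T k t = 0" if "0 < k" "k \<le> m" "t \<ge> x (Suc g)" for k t
    using Hk[OF that(1) _ tge[OF that(3)]] that by (simp add: T)
  have E0: "E k t = 0" if "k \<le> m" "t \<le> x g" for k t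
    unfolding E_def leibniz_def using T0 that by (intro sum.neutral) auto
  have E1: "E k t = P k t" if "k \<le> m" "t \<ge> x (Suc g)" for k t
  proof -
    have "E k t = (\<Sum>r\<le>k. if r = 0 then P k t else 0)"
      unfolding E_def leibniz_def using Tk[OF _ _ that(2)] T1[OF that(2)] that(1) by (intro sum.cong) auto
    then show ?thesis by simp
  qed
  have P0: "P k t = 0" if "k \<ge> m" for k t
  proof -
    have "degree Q < k" using degree_nodal_poly[of S] cS that m by (simp add: Q_def)
    from higher_pderiv_degree_less[OF this] show ?thesis by (simp add: P_def)
  qed
  have PL: "\<bar>P k t\<bar> \<le> fact m * L ^ (m - 1 - k)" if "\<And>s. s \<in> S \<Longrightarrow> \<bar>t - s\<bar> \<le> L" "k < m" for k t L
    using nodal_higher_pderiv_bound[OF finS that(1), of k] that(2) cS m by (simp add: P_def Q_def)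
  have M1: "1 \<le> real m ^ m" using m by (simp add: one_le_power)
  have Mf: "fact m \<le> M"
  proof -
    have "1 * 1 \<le> B * real m ^ m" using B M1 by (intro mult_mono) auto
    then have "1 * fact m \<le> B * real m ^ m * fact m" by (intro mult_right_mono) auto
    then show ?thesis by (simp add: M_def)
  qed
  have Mpos: "M \<ge> 0" using Mf fact_ge_zero[of m, where 'a = real] by linarith
  have gap: "\<bar>E k t\<bar> \<le> 2 ^ k * (M * D ^ (m - 1) / D ^ k)" if k: "k \<le> m" and t: "t \<in> {x g..x (Suc g)}" for k t
    unfolding E_def
  proof (rule leibniz_bound)
    fix r assume r: "r \<le> k"
    have dist: "\<bar>t - s\<bar> \<le> D" if s: "s \<in> S" for s
    proof -
      obtain p where p: "s = x p" "Suc i \<le> p" "p < i + m" using s by (auto simp: S_def)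
      have "x i \<le> s" "s \<le> x (i + m)" using xle[of i p] xle[of p "i + m"] p by auto
      moreover have "x i \<le> t" "t \<le> x (i + m)" using xle[of i g] xle[of "Suc g" "i + m"] g t by auto
      ultimately show ?thesis by (simp add: D_def abs_le_iff)
    qed
    \<comment> \<open>The power D^k is shared: D^r cancels the scaling of \<open>T\<close>, and D^(k
      - r) restores the degree that differentiation takes from the nodal polynomial.\<close>
    have "\<bar>T r t\<bar> * D ^ r = (D / h) ^ r * \<bar>H r ((t - x g) / h)\<bar>"
      using h D by (simp add: T abs_mult power_divide)
    also have "\<dots> \<le> real m ^ m * B"
    proof (rule mult_mono)
      have "(D / h) ^ r \<le> real m ^ r" using Dh h D by (intro power_mono) (simp_all add: divide_le_eq)
      also have "\<dots> \<le> real m ^ m" using m r k by (intro power_increasing) auto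
      finally show "(D / h) ^ r \<le> real m ^ m" .
      show "\<bar>H r ((t - x g) / h)\<bar> \<le> B" using HB r k by simp
    qed auto
    finally have TD: "\<bar>T r t\<bar> * D ^ r \<le> real m ^ m * B" .
    have PD: "\<bar>P (k - r) t\<bar> * D ^ (k - r) \<le> fact m * D ^ (m - 1)"
    proof (cases "k - r < m")
      case True
      have "\<bar>P (k - r) t\<bar> * D ^ (k - r) \<le> (fact m * D ^ (m - 1 - (k - r))) * D ^ (k - r)"
        using PL[OF dist True] D by (intro mult_right_mono) auto
      also have "\<dots> = fact m * D ^ (m - 1 - (k - r) + (k - r))" by (simp only: power_add mult.assoc)
      also have "m - 1 - (k - r) + (k - r) = m - 1" using True by simp
      finally show ?thesis .
    next
      case False
      then show ?thesis using P0[of "k - r" t] D by simp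
    qed
    have "\<bar>T r t * P (k - r) t\<bar> * D ^ k = (\<bar>T r t\<bar> * D ^ r) * (\<bar>P (k - r) t\<bar> * D ^ (k - r))"
      using r by (simp add: abs_mult flip: power_add)
    also have "\<dots> \<le> (real m ^ m * B) * (fact m * D ^ (m - 1))"
      by (rule mult_mono[OF TD PD]) (use D B in auto)
    also have "\<dots> = M * D ^ (m - 1)" by (simp add: M_def)
    finally show "\<bar>T r t * P (k - r) t\<bar> \<le> M * D ^ (m - 1) / D ^ k" using D by (simp add: pos_le_divide_eq)
  qed
  have gapm: "D * \<bar>E m t\<bar> \<le> 2 ^ m * M" if t: "t \<in> {x g..x (Suc g)}" for t
  proof -
    have "D * \<bar>E m t\<bar> \<le> D * (2 ^ m * (M * D ^ (m - 1) / D ^ m))"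
      using gap[OF order_refl t] D by (intro mult_left_mono) auto
    also have "\<dots> = 2 ^ m * M * (D * D ^ (m - 1) / D ^ m)" by simp
    also have "D * D ^ (m - 1) = D ^ m" using m by (simp flip: power_Suc)
    finally show ?thesis using D by simp
  qed
  have Em0: "E m t = 0" if t: "t \<notin> {x g<..<x (Suc g)}" for t
  proof (cases "t \<le> x g")
    case True then show ?thesis using E0 by simp
  next
    case False then show ?thesis using E1[of m t] P0[of m t] t by simp
  qed
  have low: "\<bar>E k t\<bar> \<le> 2 ^ m * (B * real m ^ m * fact m) * 2 ^ m"
    if t: "t \<in> {u - 1..u + 1}" and k: "k < m" for t k
  proof -
    have "\<bar>E k t\<bar> \<le> 2 ^ m * M * 2 ^ m"
    proof -
      consider "t \<le> x g" | "t \<ge> x (Suc g)" | "t \<in> {x g..x (Suc g)}" by fastforce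
      then show ?thesis
      proof cases
        case 1 then show ?thesis using E0[of k t] k Mpos by simp
      next
        case 2
        have "\<bar>P k t\<bar> \<le> fact m * 2 ^ (m - 1 - k)"
        proof (rule PL[OF _ k])
          fix s assume "s \<in> S"
          then have "s \<in> {u - 1..u + 1}" using xin by (auto simp: S_def)
          then show "\<bar>t - s\<bar> \<le> 2" using t by (auto simp: abs_le_iff)
        qed
        also have "\<dots> \<le> M * 2 ^ m" using Mf Mpos by (intro mult_mono power_increasing) auto
        also have "\<dots> \<le> 2 ^ m * (M * 2 ^ m)" using Mpos mult_right_mono[of 1 "2 ^ m" "M * 2 ^ m"] by simp
        finally show ?thesis using E1[of k t] 2 k by (simp add: mult.assoc)
      next
        case 3
        have "\<bar>E k t\<bar> \<le> 2 ^ k * (M * D ^ (m - 1) / D ^ k)" using gap[of k t] 3 k by simp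
        also have "M * D ^ (m - 1) / D ^ k = M * D ^ (m - 1 - k)"
        proof -
          have "m - 1 = (m - 1 - k) + k" using k by simp
          then have "D ^ (m - 1) = D ^ (m - 1 - k) * D ^ k" by (metis power_add)
          then show ?thesis using D by simp
        qed
        also have "2 ^ k * (M * D ^ (m - 1 - k)) \<le> 2 ^ m * (M * 2 ^ m)"
        proof (intro mult_mono)
          have "D ^ (m - 1 - k) \<le> 2 ^ (m - 1 - k)" using D D2 by (intro power_mono) auto
          also have "\<dots> \<le> 2 ^ m" by (intro power_increasing) auto
          finally show "D ^ (m - 1 - k) \<le> 2 ^ m" .
        qed (use k Mpos D in auto)
        finally show ?thesis by (simp add: mult.assoc)
      qed
    qed
    then show ?thesis by (simp add: M_def)
  qed
  show ?thesis
  proof (intro exI[of _ E] conjI allI ballI impI)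
    show "deriv_chain (Suc m) E" by (rule chE)
    show "E 0 t = 0" if "t \<le> x g" for t using E0[OF _ that] by simp
    show "E 0 t = poly (\<Prod>s\<in>x ` {Suc i..<i + m}. [:- s, 1:]) t" if "t \<ge> x (Suc g)" for t
      using E1[OF _ that, of 0] by (simp add: P_def Q_def S_def)
    show "E m t = 0" if "t \<notin> {x g<..<x (Suc g)}" for t by (rule Em0[OF that])
    show "(x (i + m) - x i) * \<bar>E m t\<bar> \<le> 2 ^ m * (B * real m ^ m * fact m)" for t
    proof (cases "t \<in> {x g<..<x (Suc g)}")
      case True then show ?thesis using gapm[of t] by (simp add: D_def M_def)
    next
      case False then show ?thesis using Em0[of t] B by simp
    qed
    show "\<bar>E k t\<bar> \<le> 2 ^ m * (B * real m ^ m * fact m) * 2 ^ m"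
      if "t \<in> {u - 1..u + 1}" "k < m" for t k by (rule low[OF that])
  qed
qed

lemma largest_gap:
  fixes x :: "nat \<Rightarrow> real"
  assumes "m \<ge> 1"
  shows "\<exists>g. i \<le> g \<and> g < i + m \<and> x (i + m) - x i \<le> m * (x (Suc g) - x g)"
proof (rule ccontr)
  assume neg: "\<nexists>g. i \<le> g \<and> g < i + m \<and> x (i + m) - x i \<le> m * (x (Suc g) - x g)"
  have "(\<Sum>g\<in>{i..<i + m}. real m * (x (Suc g) - x g)) < (\<Sum>g\<in>{i..<i + m}. x (i + m) - x i)"
    using neg assms by (intro sum_strict_mono) (auto simp: not_le)
  moreover have "(\<Sum>g\<in>{i..<i + m}. x (Suc g) - x g) = x (i + m) - x i"
    by (rule sum_Suc_diff') simp
  ultimately show False by (simp flip: sum_distrib_left)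
qed

text \<open>The Newton coefficients of the interpolant at the first points of the index range; fewer
  than m of them if the range is short.\<close>

definition dd_low :: "nat \<Rightarrow> (nat \<Rightarrow> real) \<Rightarrow> (real \<Rightarrow> real) \<Rightarrow> nat \<Rightarrow> nat \<Rightarrow> real" where
  "dd_low m x f a b = (\<Sum>j | j < m \<and> a + j \<le> b. \<bar>divided_difference f (x ` {a..a + j})\<bar>)"

definition dd_top :: "nat \<Rightarrow> (nat \<Rightarrow> real) \<Rightarrow> (real \<Rightarrow> real) \<Rightarrow> nat \<Rightarrow> nat \<Rightarrow> real" where
  "dd_top m x f a b = (\<Sum>i | a \<le> i \<and> i + m \<le> b. (x (i + m) - x i) * \<bar>divided_difference f (x ` {i..i + m})\<bar>)"

text \<open>The majorant for order m as a function of t. Window i counts only on the gap chosen for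
  it, so that the integral of its term is at most the window length times the difference.\<close>

definition dd_gap :: "nat \<Rightarrow> (nat \<Rightarrow> real) \<Rightarrow> (real \<Rightarrow> real) \<Rightarrow> (nat \<Rightarrow> nat) \<Rightarrow> nat \<Rightarrow> nat \<Rightarrow> real \<Rightarrow> real" where
  "dd_gap m x f g a b t = (\<Sum>i | a \<le> i \<and> i + m \<le> b.
     if t \<in> {x (g i)<..<x (Suc (g i))} then \<bar>divided_difference f (x ` {i..i + m})\<bar> else 0)"

lemma finite_windows: "finite {i. a \<le> i \<and> i + m \<le> (b::nat)}" "finite {j. j < m \<and> a + j \<le> (b::nat)}"
proof -
  show "finite {i. a \<le> i \<and> i + m \<le> (b::nat)}" by (rule finite_subset[of _ "{..b}"]) auto
  show "finite {j. j < m \<and> a + j \<le> (b::nat)}" by (rule finite_subset[of _ "{..b}"]) auto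
qed

lemma windows_Suc:
  assumes "a + m \<le> Suc b"
  shows "{i. a \<le> i \<and> i + m \<le> Suc b} = insert (Suc b - m) {i. a \<le> i \<and> i + m \<le> b}"
    "Suc b - m \<notin> {i. a \<le> i \<and> i + m \<le> b}"
  using assms by auto

text \<open>Induction on the right end of the index range. For up to m points the interpolation
  polynomial does; each further point is reached by adding a multiple of the transition term of the
  window that ends there, at the price of a single difference of order m.\<close>

lemma local_extension:
  assumes m: "m \<ge> 1"
  shows "\<exists>C\<ge>1. \<forall>x f u a b. a \<le> b \<longrightarrow> strict_mono_on {a..b} x \<longrightarrow> x ` {a..b} \<subseteq> {u - 1..u + 1} \<longrightarrow>
    (\<exists>D g. deriv_chain (Suc m) D \<and> (\<forall>i\<in>{a..b}. D 0 (x i) = f (x i)) \<and>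
      (\<forall>i. i \<le> g i \<and> g i < i + m) \<and>
      (\<forall>t\<in>{u - 1..u + 1}. \<forall>k<m. \<bar>D k t\<bar> \<le> C * (dd_low m x f a b + dd_top m x f a b)) \<and>
      (\<forall>t. \<bar>D m t\<bar> \<le> C * dd_gap m x f g a b t))"
proof -
  obtain H B where H: "deriv_chain (Suc m) H" "B \<ge> (1::real)"
    "\<And>k t. k \<le> Suc m \<Longrightarrow> t \<le> 0 \<Longrightarrow> H k t = 0" "\<And>t. t \<ge> 1 \<Longrightarrow> H 0 t = 1"
    "\<And>k t. 0 < k \<Longrightarrow> k \<le> Suc m \<Longrightarrow> t \<ge> 1 \<Longrightarrow> H k t = 0"
    "\<And>k t. k \<le> m \<Longrightarrow> \<bar>H k t\<bar> \<le> B"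
    by (rule smoothstep_exists[of m]) (rule that)
  define K0 :: real where "K0 = fact (Suc m) * 2 ^ m"
  define K :: real where "K = 2 ^ m * (B * real m ^ m * fact m)"
  define C where "C = K0 + K * 2 ^ m + K"
  have K: "K \<ge> 0" using H(2) by (simp add: K_def)
  have K0: "K0 \<ge> 1" 
    using mult_mono[of "1::real" "fact (Suc m)" 1 "2 ^ m"] fact_ge_1[of "Suc m", where 'a = real]
    by (simp add: K0_def)
  have "0 \<le> K * 2 ^ m" using K by simp
  then have C: "K0 \<le> C" "K * 2 ^ m \<le> C" "K \<le> C" "C \<ge> 1" using K K0 unfolding C_def by linarith+
  show ?thesis
  proof (intro exI[of _ C] conjI allI impI C(4))
    fix x :: "nat \<Rightarrow> real" and f u a b
    assume ab: "a \<le> b" and x: "strict_mono_on {a..b} x" and xu: "x ` {a..b} \<subseteq> {u - 1..u + 1}"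
    obtain g where g: "\<And>i. i \<le> g i \<and> g i < i + m \<and> x (i + m) - x i \<le> m * (x (Suc (g i)) - x (g i))"
      using largest_gap[OF m, of _ x] by metis
    let ?dd = "divided_difference f"
    \<comment> \<open>The last clause carries the induction: right of the last point the extension
      is the interpolant at the last m points, from which the next transition starts. It is vacuous
      as long as there are fewer than m points.\<close>
    define I where "I c D \<longleftrightarrow> deriv_chain (Suc m) D \<and> (\<forall>i\<in>{a..c}. D 0 (x i) = f (x i)) \<and>
      (\<forall>t\<in>{u - 1..u + 1}. \<forall>k<m. \<bar>D k t\<bar> \<le> C * (dd_low m x f a c + dd_top m x f a c)) \<and>
      (\<forall>t. \<bar>D m t\<bar> \<le> C * dd_gap m x f g a c t) \<and>
      (a + m \<le> Suc c \<longrightarrow> (\<forall>t\<ge>x c. D 0 t = poly (lagrange_poly f (x ` {Suc c - m..c})) t))" for c D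
    have xin: "x p \<in> {u - 1..u + 1}" if "a \<le> p" "p \<le> b" for p
      by (rule subsetD[OF xu imageI]) (use that in simp)
    have xle: "x p \<le> x q" if "a \<le> p" "p \<le> q" "q \<le> b" for p q
      using strict_mono_onD[OF x, of p q] that by (cases "p = q") auto
    have inj: "inj_on x {a..b}" using x by (rule strict_mono_on_imp_inj_on)
    have cardx: "card (x ` J) = card J" if "J \<subseteq> {a..b}" for J
      by (rule card_image[OF inj_on_subset[OF inj that]])
    have lowpos: "dd_low m x f a c \<ge> 0" for c unfolding dd_low_def by (intro sum_nonneg) simp
    have toppos: "dd_top m x f a c \<ge> 0" if "c \<le> b" for c
      unfolding dd_top_def using xle that by (intro sum_nonneg mult_nonneg_nonneg) auto
    have base: "\<exists>D. I (a + n) D" if n: "a + n \<le> b" "n < m" for n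
    proof -
      let ?P = "lagrange_poly f (x ` {a..a + n})"
      have cd: "card (x ` {a..a + n}) = Suc n"
        by (subst cardx) (use n in auto)
      have deg: "degree ?P < m" using lagrange_poly_props(1)[of "x ` {a..a + n}" f] cd n by simp
      have "I (a + n) (\<lambda>k. poly ((pderiv ^^ k) ?P))"
        unfolding I_def
      proof (intro conjI ballI allI impI)
        show "deriv_chain (Suc m) (\<lambda>k. poly ((pderiv ^^ k) ?P))" by (rule deriv_chain_poly)
        show "poly ((pderiv ^^ 0) ?P) (x i) = f (x i)" if "i \<in> {a..a + n}" for i
          using lagrange_poly_props(2)[of "x ` {a..a + n}" "x i" f] that by simp
        show "\<bar>poly ((pderiv ^^ k) ?P) t\<bar> \<le> C * (dd_low m x f a (a + n) + dd_top m x f a (a + n))"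
          if "t \<in> {u - 1..u + 1}" "k < m" for t k
        proof -
          have eq: "{j. j < m \<and> a + j \<le> a + n} = {..n}" using n by auto
          have "\<bar>poly ((pderiv ^^ k) ?P) t\<bar> \<le> K0 * dd_low m x f a (a + n)"
            using lagrange_poly_higher_pderiv_bound[OF x xu that(1) n, of k f]
            unfolding dd_low_def eq K0_def .
          also have "\<dots> \<le> C * (dd_low m x f a (a + n) + dd_top m x f a (a + n))"
            using C lowpos[of "a + n"] toppos[OF n(1)] by (intro mult_mono) auto
          finally show ?thesis .
        qed
        show "\<bar>poly ((pderiv ^^ m) ?P) t\<bar> \<le> C * dd_gap m x f g a (a + n) t" for t
        proof -
          have "0 \<le> dd_gap m x f g a (a + n) t" unfolding dd_gap_def by (intro sum_nonneg) simp
          then show ?thesis using higher_pderiv_degree_less[OF deg] C(4) by simp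
        qed
        show "poly ((pderiv ^^ 0) ?P) t = poly (lagrange_poly f (x ` {Suc (a + n) - m..a + n})) t"
          if "a + m \<le> Suc (a + n)" for t
        proof -
          have "Suc (a + n) - m = a" using that n by simp
          then show ?thesis by simp
        qed
      qed
      then show ?thesis by blast
    qed
    have "\<exists>D. I (a + n) D" if "a + n \<le> b" for n
      using that
    proof (induction n)
      case 0
      then show ?case using base[of 0] m by simp
    next
      case (Suc n)
      show ?case
      proof (cases "Suc n < m")
        case True
        then show ?thesis using base[of "Suc n"] Suc.prems by simp
      next
        case False
        define c where "c = a + n"
        obtain D where "I c D" using Suc.IH Suc.prems by (auto simp: c_def)
        then have D: "deriv_chain (Suc m) D" "\<forall>i\<in>{a..c}. D 0 (x i) = f (x i)"
          "\<forall>t\<in>{u - 1..u + 1}. \<forall>k<m. \<bar>D k t\<bar> \<le> C * (dd_low m x f a c + dd_top m x f a c)"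
          "\<forall>t. \<bar>D m t\<bar> \<le> C * dd_gap m x f g a c t"
          "a + m \<le> Suc c \<longrightarrow> (\<forall>t\<ge>x c. D 0 t = poly (lagrange_poly f (x ` {Suc c - m..c})) t)"
          unfolding I_def by blast+
        define i where "i = Suc c - m"
        have ic: "i + m = Suc c" "a \<le> i" "Suc c \<le> b" "a + m \<le> Suc c" "i \<le> c"
          using False Suc.prems m by (auto simp: i_def c_def)
        have xi: "strict_mono_on {i..i + m} x" 
          using ic by (intro monotone_on_subset[OF x]) auto
        have xui: "x ` {i..i + m} \<subseteq> {u - 1..u + 1}" using xin ic by auto
        obtain E where E: "deriv_chain (Suc m) E" "\<forall>t\<le>x (g i). E 0 t = 0"
          "\<forall>t\<ge>x (Suc (g i)). E 0 t = poly (\<Prod>s\<in>x ` {Suc i..<i + m}. [:- s, 1:]) t"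
          "\<forall>t. t \<notin> {x (g i)<..<x (Suc (g i))} \<longrightarrow> E m t = 0"
          "\<forall>t. (x (i + m) - x i) * \<bar>E m t\<bar> \<le> K"
          "\<forall>t\<in>{u - 1..u + 1}. \<forall>k<m. \<bar>E k t\<bar> \<le> K * 2 ^ m"
          using transition_term[OF m H xi xui] g[of i] unfolding K_def by blast
        let ?Q = "\<Prod>s\<in>x ` {Suc i..<i + m}. [:- s, 1::real:]"
        define d where "d = ?dd (x ` {i..i + m})"
        define w where "w = x (i + m) - x i"
        have w: "w > 0" unfolding w_def using strict_mono_onD[OF x, of i "i + m"] ic m by simp
        define D' where "D' k t = D k t + (w * d) * E k t" for k t
        let ?L = "lagrange_poly f (x ` {i..c})" and ?y = "x (Suc c)"
        have set1: "{Suc i..<i + m} = {Suc i..c}" using ic by auto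
        have set2: "{i..i + m} = insert (Suc c) {i..c}" using ic by auto
        have set3: "{i..c} = insert i {Suc i..c}" using ic by auto
        have nin1: "?y \<notin> x ` {i..c}" 
        proof
          assume "?y \<in> x ` {i..c}"
          then obtain j where "?y = x j" "j \<in> {i..c}" by (rule imageE)
          then show False using strict_mono_onD[OF x, of j "Suc c"] ic by simp
        qed
        have nin2: "x i \<notin> x ` {Suc i..c}" 
        proof
          assume "x i \<in> x ` {Suc i..c}"
          then obtain j where "x i = x j" "j \<in> {Suc i..c}" by (rule imageE)
          then show False using strict_mono_onD[OF x, of i j] ic by simp
        qed
        have nod: "(\<Prod>s\<in>x ` {i..c}. [:- s, 1::real:]) = [:- x i, 1:] * ?Q"
          unfolding set1 set3 image_insert using nin2 by (subst prod.insert) auto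
        have ins: "lagrange_poly f (insert ?y (x ` {i..c})) = ?L + smult d ([:- x i, 1:] * ?Q)"
          using lagrange_poly_insert[OF _ _ nin1, of f] ic unfolding nod d_def set2 by simp
        have key: "f ?y = poly ?L ?y + w * d * poly ?Q ?y"
        proof -
          have "f ?y = poly (lagrange_poly f (insert ?y (x ` {i..c}))) ?y"
            by (rule lagrange_poly_props(2)[symmetric]) auto
          also have "\<dots> = poly ?L ?y + w * d * poly ?Q ?y"
            unfolding ins w_def using ic(1) by (simp add: algebra_simps)
          finally show ?thesis .
        qed
        have Qz: "poly ?Q (x j) = 0" if "j \<in> {Suc i..c}" for j
          unfolding set1 poly_prod using that by (intro prod_zero) auto
        \<comment> \<open>This is P_{i+1} - P_i = w d Q: at the common nodes \<open>Q\<close>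
          vanishes, and \<open>key\<close> settles the new node.\<close>
        have Ltail: "lagrange_poly f (x ` {Suc i..Suc c}) = ?L + smult (w * d) ?Q"
        proof (rule lagrange_poly_eqI)
          have c1: "card (x ` {Suc i..Suc c}) = m"
            by (subst cardx) (use ic in auto)
          have c2: "card (x ` {i..c}) = m"
            by (subst cardx) (use ic in auto)
          have c3: "card (x ` {Suc i..<i + m}) = m - 1"
            by (subst cardx) (use ic in auto)
          have "degree ?L \<le> m - 1" using lagrange_poly_props(1)[of "x ` {i..c}" f] c2 ic by simp
          moreover have "degree ?Q \<le> m - 1" using degree_nodal_poly[of "x ` {Suc i..<i + m}"] c3 by simp
          ultimately show "degree (?L + smult (w * d) ?Q) \<le> card (x ` {Suc i..Suc c}) - 1"
            unfolding c1 by (intro degree_add_le order.trans[OF degree_smult_le])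
          fix t assume "t \<in> x ` {Suc i..Suc c}"
          then obtain j where j: "t = x j" "Suc i \<le> j" "j \<le> Suc c" by auto
          show "poly (?L + smult (w * d) ?Q) t = f t"
          proof (cases "j = Suc c")
            case True then show ?thesis using key j by simp
          next
            case False
            then have "poly ?L t = f t" using j by (intro lagrange_poly_props(2)) auto
            then show ?thesis using Qz[of j] j False by simp
          qed
        qed (use ic in auto)
        have Dtail: "D 0 t = poly ?L t" if "t \<ge> x c" for t
          using D(5) ic(4) that by (simp add: i_def)
        have gi: "i \<le> g i" "g i \<le> c" "Suc (g i) \<le> Suc c" using g[of i] ic by auto
        have E0tail: "E 0 t = poly ?Q t" if "t \<ge> x (Suc c)" for t
        proof -
          have "x (Suc (g i)) \<le> x (Suc c)" using xle[of "Suc (g i)" "Suc c"] gi ic by simp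
          then show ?thesis using E(3) that by auto
        qed
        have "I (Suc c) D'"
          unfolding I_def
        proof (intro conjI ballI allI impI)
          show "deriv_chain (Suc m) D'"
            unfolding D'_def by (intro deriv_chain_add deriv_chain_cmult D(1) E(1))
          show "D' 0 (x j) = f (x j)" if j: "j \<in> {a..Suc c}" for j
          proof (cases "j = Suc c")
            case True
            have "D' 0 ?y = poly ?L ?y + w * d * poly ?Q ?y"
              using Dtail[of ?y] E0tail[of ?y] xle[of c "Suc c"] ic by (simp add: D'_def)
            then show ?thesis using True key by simp
          next
            case False
            then have jc: "j \<in> {a..c}" using j by auto
            \<comment> \<open>Old values survive the correction: left of the gap \<open>E 0\<close>
              is zero, right of it \<open>E 0\<close> is \<open>Q\<close>, which vanishes at the
              inner nodes of the window.\<close>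
            have "E 0 (x j) = 0"
            proof (cases "j \<le> g i")
              case True
              then have "x j \<le> x (g i)" using xle[of j "g i"] jc gi ic by auto
              then show ?thesis using E(2) by simp
            next
              case False
              then have "x (Suc (g i)) \<le> x j" using xle[of "Suc (g i)" j] jc gi ic by auto
              then have "E 0 (x j) = poly ?Q (x j)" using E(3) by simp
              also have "\<dots> = 0" using False jc gi by (intro Qz) auto
              finally show ?thesis .
            qed
            then show ?thesis using D(2) jc by (simp add: D'_def)
          qed
          have low: "dd_low m x f a c \<le> dd_low m x f a (Suc c)"
            unfolding dd_low_def by (intro sum_mono2 finite_windows) auto
          have top: "dd_top m x f a (Suc c) = dd_top m x f a c + w * \<bar>d\<bar>"
            unfolding dd_top_def windows_Suc(1)[OF ic(4)]
            by (subst sum.insert) (simp_all add: finite_windows windows_Suc(2)[OF ic(4)] w_def d_def i_def[symmetric] ic(1))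
          show "\<bar>D' k t\<bar> \<le> C * (dd_low m x f a (Suc c) + dd_top m x f a (Suc c))"
            if t: "t \<in> {u - 1..u + 1}" and k: "k < m" for t k
          proof -
            have "\<bar>D' k t\<bar> \<le> \<bar>D k t\<bar> + w * \<bar>d\<bar> * \<bar>E k t\<bar>"
              unfolding D'_def using w by (intro order_trans[OF abs_triangle_ineq]) (simp add: abs_mult)
            also have "\<dots> \<le> C * (dd_low m x f a c + dd_top m x f a c) + w * \<bar>d\<bar> * C"
            proof (intro add_mono mult_left_mono)
              show "\<bar>D k t\<bar> \<le> C * (dd_low m x f a c + dd_top m x f a c)" using D(3) t k by blast
              show "\<bar>E k t\<bar> \<le> C" using E(6) t k C(2) by force
            qed (use w in simp)
            also have "\<dots> \<le> C * (dd_low m x f a (Suc c) + dd_top m x f a (Suc c))"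
              unfolding top using mult_left_mono[OF low, of C] C(4) by (simp add: algebra_simps)
            finally show ?thesis .
          qed
          show "\<bar>D' m t\<bar> \<le> C * dd_gap m x f g a (Suc c) t" for t
          proof -
            let ?ind = "if t \<in> {x (g i)<..<x (Suc (g i))} then \<bar>d\<bar> else 0"
            have gapS: "dd_gap m x f g a (Suc c) t = dd_gap m x f g a c t + ?ind"
              unfolding dd_gap_def windows_Suc(1)[OF ic(4)]
              by (subst sum.insert) (simp_all add: finite_windows windows_Suc(2)[OF ic(4)] d_def i_def[symmetric] ic(1))
            have "w * \<bar>d\<bar> * \<bar>E m t\<bar> \<le> C * ?ind"
            proof (cases "t \<in> {x (g i)<..<x (Suc (g i))}")
              case True
              have "w * \<bar>E m t\<bar> \<le> C" using E(5)[rule_format, of t] C(3) by (simp add: w_def)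
              then have "\<bar>d\<bar> * (w * \<bar>E m t\<bar>) \<le> \<bar>d\<bar> * C" by (rule mult_left_mono) simp
              then show ?thesis using True by (simp add: mult.commute mult.left_commute)
            next
              case False
              then have "E m t = 0" using E(4) by blast
              then show ?thesis using C(4) by simp
            qed
            moreover have "\<bar>D' m t\<bar> \<le> \<bar>D m t\<bar> + w * \<bar>d\<bar> * \<bar>E m t\<bar>"
              unfolding D'_def using w by (intro order_trans[OF abs_triangle_ineq]) (simp add: abs_mult)
            moreover have "\<bar>D m t\<bar> \<le> C * dd_gap m x f g a c t" using D(4) by blast
            ultimately show ?thesis unfolding gapS distrib_left by linarith
          qed
          show "D' 0 t = poly (lagrange_poly f (x ` {Suc (Suc c) - m..Suc c})) t" if t: "t \<ge> x (Suc c)" for t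
          proof -
            have s: "Suc (Suc c) - m = Suc i" using ic m by simp
            have "x c \<le> x (Suc c)" using xle[of c "Suc c"] ic by simp
            then show ?thesis unfolding s Ltail using Dtail[of t] E0tail[OF t] t by (simp add: D'_def)
          qed
        qed
        then show ?thesis by (auto simp: c_def)
      qed
    qed
    then obtain D where "I b D" using ab by (metis le_add_diff_inverse order_refl)
    then show "\<exists>D g. deriv_chain (Suc m) D \<and> (\<forall>i\<in>{a..b}. D 0 (x i) = f (x i)) \<and>
      (\<forall>i. i \<le> g i \<and> g i < i + m) \<and>
      (\<forall>t\<in>{u - 1..u + 1}. \<forall>k<m. \<bar>D k t\<bar> \<le> C * (dd_low m x f a b + dd_top m x f a b)) \<and>
      (\<forall>t. \<bar>D m t\<bar> \<le> C * dd_gap m x f g a b t)"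
      using g by (intro exI[of _ D] exI[of _ g]) (simp add: I_def)
  qed
qed

section \<open>Power means and the discrete functional\<close>

lemma powr_pred_mult: "c \<ge> 0 \<Longrightarrow> c powr (p - 1) * c = c powr (p::real)"
  using powr_mult_base[of c "p - 1"] by (simp add: mult.commute)

text \<open>Convexity in tangent form, out of Young's inequality with the exponents p and p / (p -
  1). With c a mean value, summation and integration turn it into Jensen's inequality for finite
  sums and for integrals.\<close>

lemma powr_tangent:
  fixes a c p :: real
  assumes "p > 1" "a \<ge> 0" "c \<ge> 0"
  shows "c powr p + p * c powr (p - 1) * (a - c) \<le> a powr p"
proof -
  define q where "q = p / (p - 1)"
  have q: "q > 1" "1 / p + 1 / q = 1" "(p - 1) * q = p" using assms(1) by (simp_all add: q_def field_simps)
  have "a * c powr (p - 1) \<le> a powr p / p + (c powr (p - 1)) powr q / q"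
    using assms q by (intro Youngs_inequality) auto
  also have "(c powr (p - 1)) powr q = c powr p" by (simp add: powr_powr q(3))
  also have "c powr p / q = c powr p * (p - 1) / p" using assms(1) by (simp add: q_def)
  finally have "p * (a * c powr (p - 1)) \<le> p * (a powr p / p + c powr p * (p - 1) / p)"
    using assms(1) by (intro mult_left_mono) auto
  also have "\<dots> = a powr p + c powr p * (p - 1)" using assms(1) by (simp add: field_simps)
  finally have 1: "p * (a * c powr (p - 1)) \<le> a powr p + c powr p * (p - 1)" .
  have "p * c powr (p - 1) * (a - c) = p * (a * c powr (p - 1)) - p * (c powr (p - 1) * c)"
    by (simp add: algebra_simps)
  then have "p * c powr (p - 1) * (a - c) = p * (a * c powr (p - 1)) - p * c powr p"
    by (simp only: powr_pred_mult[OF assms(3)])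
  moreover have "c powr p * (p - 1) = p * c powr p - c powr p" by (simp add: algebra_simps)
  ultimately show ?thesis using 1 by linarith
qed

text \<open>Jensen's inequality, with the tangent taken at X / V. A total weight below
  \<open>V\<close> does no harm, since the deficit V - sum w enters with the factor p >= 1. The
  constant is recorded as a full p-th power, like all others.\<close>

lemma weighted_power_mean:
  fixes w a :: "'i \<Rightarrow> real"
  assumes p: "p > 1" and w: "\<And>i. i \<in> I \<Longrightarrow> w i \<ge> 0" and a: "\<And>i. i \<in> I \<Longrightarrow> a i \<ge> 0"
    and V: "sum w I \<le> V" "V \<ge> 1"
  shows "(\<Sum>i\<in>I. w i * a i) powr p \<le> V powr p * (\<Sum>i\<in>I. w i * a i powr p)"
proof -
  let ?X = "\<Sum>i\<in>I. w i * a i" and ?Y = "\<Sum>i\<in>I. w i * a i powr p"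
  have X: "?X \<ge> 0" and Y: "?Y \<ge> 0" using w a by (auto intro!: sum_nonneg)
  define c where "c = ?X / V"
  have c: "c \<ge> 0" using X V by (simp add: c_def)
  have "(\<Sum>i\<in>I. w i * (c powr p + p * c powr (p - 1) * (a i - c))) \<le> ?Y"
    using powr_tangent[OF p a c] w by (intro sum_mono mult_left_mono) auto
  also have "(\<Sum>i\<in>I. w i * (c powr p + p * c powr (p - 1) * (a i - c))) =
      sum w I * c powr p + p * c powr (p - 1) * (?X - sum w I * c)"
    by (simp add: algebra_simps sum.distrib sum_subtractf sum_distrib_left sum_distrib_right)
  finally have 1: "sum w I * c powr p + p * c powr (p - 1) * (?X - sum w I * c) \<le> ?Y" .
  have cc: "c powr (p - 1) * c = c powr p" by (rule powr_pred_mult[OF c])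
  have "?X = V * c" using V by (simp add: c_def)
  then have "p * c powr (p - 1) * (?X - sum w I * c) = p * (V - sum w I) * (c powr (p - 1) * c)"
    by (simp only:) (simp add: algebra_simps)
  also have "\<dots> = p * (V - sum w I) * c powr p" by (simp only: cc)
  finally have "sum w I * c powr p + p * (V - sum w I) * c powr p \<le> ?Y" using 1 by linarith
  moreover have "(V - sum w I) * c powr p \<le> p * (V - sum w I) * c powr p"
    using p V mult_right_mono[of 1 p "V - sum w I"] by (intro mult_right_mono) auto
  ultimately have "V * c powr p \<le> ?Y" by (simp add: algebra_simps)
  moreover have "1 * c powr p \<le> V * c powr p" using V by (intro mult_right_mono) auto
  ultimately have "c powr p \<le> ?Y" by linarith
  moreover have "?X powr p = V powr p * c powr p"
    using V X by (simp add: c_def powr_divide)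
  ultimately show ?thesis by (simp add: mult_left_mono)
qed

text \<open>For sums of bounded overlap: \<open>J\<close> holds the terms that can be nonzero, and
  the factor does not depend on the number of summands.\<close>

lemma powr_sum_le:
  fixes a :: "'i \<Rightarrow> real"
  assumes p: "p > 1" and fin: "finite I" and a: "\<And>i. i \<in> I \<Longrightarrow> a i \<ge> 0"
    and J: "J \<subseteq> I" "\<And>i. i \<in> I - J \<Longrightarrow> a i = 0" "card J \<le> N" and N: "N \<ge> 1"
  shows "(\<Sum>i\<in>I. a i) powr p \<le> real N powr p * (\<Sum>i\<in>I. a i powr p)"
proof -
  have "(\<Sum>i\<in>J. 1 * a i) powr p \<le> real N powr p * (\<Sum>i\<in>J. 1 * a i powr p)"
    using a J N by (intro weighted_power_mean[OF p]) auto
  moreover have "sum a I = sum a J" using fin J by (intro sum.mono_neutral_right) auto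
  moreover have "(\<Sum>i\<in>I. a i powr p) = (\<Sum>i\<in>J. a i powr p)" using fin J by (intro sum.mono_neutral_right) auto
  ultimately show ?thesis by simp
qed

section \<open>The sum inside \<open>W_functional\<close> for a single sequence\<close>

definition W_sum :: "nat \<Rightarrow> real \<Rightarrow> nat \<Rightarrow> (nat \<Rightarrow> real) \<Rightarrow> (real \<Rightarrow> real) \<Rightarrow> real" where
  "W_sum m p n x f = (\<Sum>k\<le>m. \<Sum>i\<le>n - k. W_weight m n x i * \<bar>divided_difference f (x ` {i..i + k})\<bar> powr p)"

lemma W_weight_nonneg:
  assumes "strict_mono_on {..n} x" shows "0 \<le> W_weight m n x i"
proof (cases "i + m \<le> n")
  case True
  have "x i \<le> x (i + m)" using strict_mono_onD[OF assms, of i "i + m"] True by (cases "m = 0") auto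
  then show ?thesis by (simp add: W_weight_def)
qed (simp add: W_weight_def)

lemma W_sum_part_le:
  assumes x: "strict_mono_on {..n} x" and I: "I \<subseteq> {(k, i). k \<le> m \<and> i \<le> n - k}"
  shows "(\<Sum>(k, i)\<in>I. W_weight m n x i * \<bar>divided_difference f (x ` {i..i + k})\<bar> powr p) \<le> W_sum m p n x f"
proof -
  have eq: "{(k, i). k \<le> m \<and> i \<le> n - k} = Sigma {..m} (\<lambda>k. {..n - k})" by auto
  have "W_sum m p n x f = (\<Sum>(k, i)\<in>{(k, i). k \<le> m \<and> i \<le> n - k}.
      W_weight m n x i * \<bar>divided_difference f (x ` {i..i + k})\<bar> powr p)"
    unfolding W_sum_def eq by (subst sum.Sigma) auto
  moreover have "finite {(k, i). k \<le> m \<and> i \<le> n - k}" unfolding eq by auto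
  ultimately show ?thesis
    using I W_weight_nonneg[OF x] by (auto intro!: sum_mono2)
qed

lemma W_sum_term_le:
  assumes x: "strict_mono_on {..n} x" and "k \<le> m" "i \<le> n - k"
  shows "W_weight m n x i * \<bar>divided_difference f (x ` {i..i + k})\<bar> powr p \<le> W_sum m p n x f"
  using W_sum_part_le[OF x, of "{(k, i)}" m f p] assms(2,3) by simp

text \<open>The functional is applied to a block of m + 1 consecutive points containing the window.
  There only the start 0 can have a weight other than 1, so windows with start i >= 1 are bounded by
  \<open>A\<close> at once. If the block has length D < 1, order m gives D * d 0 m <= A, and the
  recursion passes from order k + 1 down to order k, adding \<open>A\<close> each time.\<close>

lemma consecutive_divided_difference_bound:
  assumes m: "m \<ge> 1" and p: "p > 1" and x: "strict_mono_on {..n} x" and n: "m \<le> n" and A: "A \<ge> 0"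
    and W: "\<And>n' y. m \<le> n' \<Longrightarrow> strict_mono_on {..n'} y \<Longrightarrow> y ` {..n'} \<subseteq> x ` {..n} \<Longrightarrow> W_sum m p n' y f \<le> A powr p"
    and ak: "a + k \<le> n" "k < m"
  shows "\<bar>divided_difference f (x ` {a..a + k})\<bar> \<le> (real m + 1) * A"
proof -
  \<comment> \<open>The block starts at \<open>a\<close>, or further left if fewer than m points
    follow \<open>a\<close>.\<close>
  define s where "s = min a (n - m)"
  define y where "y i = x (s + i)" for i
  have sn: "s + m \<le> n" using n by (simp add: s_def)
  have y: "strict_mono_on {..m} y"
    unfolding y_def using sn by (intro strict_mono_onI strict_mono_onD[OF x]) auto
  have ys: "y ` {..m} \<subseteq> x ` {..n}" using sn by (auto simp: y_def)
  define d where "d i k = \<bar>divided_difference f (y ` {i..i + k})\<bar>" for i k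
  have T: "W_weight m m y i * d i k powr p \<le> A powr p" if "i + k \<le> m" for i k
  proof -
    have "k \<le> m" "i \<le> m - k" using that by simp_all
    from W_sum_term_le[OF y this, of f p] W[OF order_refl y ys] show ?thesis unfolding d_def by linarith
  qed
  have powr_le: "u \<le> A" if "u powr p \<le> A powr p" "u \<ge> 0" for u
    using that p A by (metis less_eq_real_def linorder_not_le order_less_trans powr_less_mono2 zero_less_one)
  have d0: "d i k \<ge> 0" for i k by (simp add: d_def)
  have d1: "d i k \<le> A" if "i \<ge> 1" "i + k \<le> m" for i k
    using T[OF that(2)] that(1) powr_le[OF _ d0] by (simp add: W_weight_def)
  define D where "D = y m - y 0"
  have D: "D > 0" using strict_mono_onD[OF y, of 0 m] m by (simp add: D_def)
  have d2: "d 0 k \<le> (real m + 1) * A" if k: "k < m" for k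
  proof (cases "D \<ge> 1")
    case True
    then have "d 0 k powr p \<le> A powr p" using T[of 0 k] k by (simp add: W_weight_def D_def)
    then have "d 0 k \<le> A" by (rule powr_le[OF _ d0])
    also have "A \<le> (real m + 1) * A" using A by (simp add: mult_le_cancel_right1)
    finally show ?thesis .
  next
    case False
    have step: "d 0 k \<le> A + D * d 0 (Suc k)" if k: "k < m" for k
    proof -
      have "inj_on y {0..0 + Suc k}"
        using inj_on_subset[OF strict_mono_on_imp_inj_on[OF y], of "{0..0 + Suc k}"] k by auto
      from divided_difference_step[OF this, of f]
      have "divided_difference f (y ` {0..0 + k}) = divided_difference f (y ` {1..1 + k}) -
          (y (Suc k) - y 0) * divided_difference f (y ` {0..0 + Suc k})" by simp
      moreover have w: "0 < y (Suc k) - y 0" using strict_mono_onD[OF y, of 0 "Suc k"] k by simp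
      ultimately have "d 0 k \<le> d 1 k + (y (Suc k) - y 0) * d 0 (Suc k)"
        unfolding d_def by (simp only: abs_mult[of "y (Suc k) - y 0", unfolded abs_of_pos[OF w], symmetric] abs_triangle_ineq4)
      moreover have "y (Suc k) - y 0 \<le> D"
        using strict_mono_onD[OF y, of "Suc k" m] k by (cases "Suc k = m") (simp_all add: D_def less_imp_le)
      then have "(y (Suc k) - y 0) * d 0 (Suc k) \<le> D * d 0 (Suc k)" by (rule mult_right_mono[OF _ d0])
      moreover have "d 1 k \<le> A" using d1[of 1 k] k by simp
      ultimately show ?thesis by linarith
    qed
    \<comment> \<open>Since D < 1 < p, the power D^p is at most D, the weight of the block.\<close>
    have top: "D * d 0 m \<le> A"
    proof (rule powr_le)
      have "(D * d 0 m) powr p = D powr p * d 0 m powr p" using D d0 by (simp add: powr_mult)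
      also have "\<dots> \<le> D powr 1 * d 0 m powr p"
        using D False p by (intro mult_right_mono powr_mono') auto
      also have "\<dots> \<le> A powr p" using T[of 0 m] False D by (simp add: W_weight_def D_def)
      finally show "(D * d 0 m) powr p \<le> A powr p" .
    qed (use D d0 in simp)
    have "D * d 0 (m - j) \<le> (real j + 1) * A \<and> (j > 0 \<longrightarrow> d 0 (m - j) \<le> (real j + 1) * A)" if "j \<le> m" for j
      using that
    proof (induction j)
      case 0 then show ?case using top by simp
    next
      case (Suc j)
      have e: "Suc (m - Suc j) = m - j" using Suc.prems by simp
      have "d 0 (m - Suc j) \<le> A + D * d 0 (m - j)" using step[of "m - Suc j"] Suc.prems unfolding e by simp
      also have "\<dots> \<le> A + (real j + 1) * A" using Suc by simp
      finally have 1: "d 0 (m - Suc j) \<le> (real (Suc j) + 1) * A" by (simp add: algebra_simps)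
      have "D * d 0 (m - Suc j) \<le> 1 * d 0 (m - Suc j)" using False d0 by (intro mult_right_mono) auto
      then show ?case using 1 by simp
    qed
    from this[of "m - k"] have "d 0 k \<le> (real (m - k) + 1) * A" using k by simp
    also have "\<dots> \<le> (real m + 1) * A" using A by (intro mult_right_mono) auto
    finally show ?thesis .
  qed
  define i where "i = a - s"
  have sa: "s + i = a" by (simp add: i_def s_def)
  have ik: "i + k \<le> m" using ak n by (auto simp: i_def s_def)
  have im: "y ` {i..i + k} = x ` {a..a + k}"
  proof -
    have "y ` {i..i + k} = x ` ((+) s ` {i..i + k})" by (simp only: y_def[abs_def] image_image)
    also have "(+) s ` {i..i + k} = {a..a + k}" by (simp add: sa[symmetric] add.assoc)
    finally show ?thesis .
  qed
  have "d i k \<le> (real m + 1) * A"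
  proof (cases "i \<ge> 1")
    case True
    have "d i k \<le> A" by (rule d1[OF True ik])
    also have "A \<le> (real m + 1) * A" using A by (simp add: mult_le_cancel_right1)
    finally show ?thesis .
  next
    case False
    then have "i = 0" by simp
    then show ?thesis using d2[OF ak(2)] by simp
  qed
  then show ?thesis by (simp add: d_def im)
qed

text \<open>The third clause locates an element through the number of smaller ones; it determines
  the positions of the clusters in a thinned sequence.\<close>

lemma finite_set_enumeration:
  fixes T :: "real set"
  assumes T: "finite T"
  obtains y :: "nat \<Rightarrow> real" where "strict_mono_on {..<card T} y" "y ` {..<card T} = T"
    "\<And>s. s \<in> T \<Longrightarrow> y (card {t \<in> T. t < s}) = s"
proof -
  define l where "l = sorted_list_of_set T"
  have l: "sorted_wrt (<) l" "set l = T" "length l = card T" 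
    using T by (simp_all add: l_def)
  have mono: "l ! i < l ! j" if "i < j" "j < card T" for i j
    using sorted_wrt_nth_less[OF l(1), of i j] that l(3) by simp
  show ?thesis
  proof (rule that[of "\<lambda>i. l ! i"])
    show "strict_mono_on {..<card T} ((!) l)" using mono by (intro strict_mono_onI) auto
    show im: "(!) l ` {..<card T} = T" using nth_image[of "card T" l] l(2,3) by (simp add: lessThan_atLeast0)
    fix s assume "s \<in> T"
    then obtain i where i: "i < card T" "s = l ! i" using im by auto
    have "{t \<in> T. t < s} = (!) l ` {..<i}"
    proof
      show "{t \<in> T. t < s} \<subseteq> (!) l ` {..<i}"
      proof
        fix t assume t: "t \<in> {t \<in> T. t < s}"
        then obtain j where j: "j < card T" "t = l ! j" using im by auto
        have "j < i"
        proof (rule ccontr)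
          assume "\<not> j < i"
          then have "l ! i \<le> l ! j" using mono[of i j] j(1) by (cases "i = j") auto
          then show False using t i j by simp
        qed
        then show "t \<in> (!) l ` {..<i}" using j by simp
      qed
      show "(!) l ` {..<i} \<subseteq> {t \<in> T. t < s}"
      proof
        fix t assume "t \<in> (!) l ` {..<i}"
        then obtain q where q: "t = l ! q" "q < i" by auto
        have "l ! q \<in> (!) l ` {..<card T}" by (rule imageI) (use q i in simp)
        then show "t \<in> {t \<in> T. t < s}" using q i mono[of q i] unfolding im by simp
      qed
    qed
    moreover have "inj_on ((!) l) {..<i}"
    proof (rule inj_onI)
      fix p q assume "p \<in> {..<i}" "q \<in> {..<i}" "l ! p = l ! q"
      then show "p = q" using mono[of p q] mono[of q p] i(1) by (cases p q rule: linorder_cases) auto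
    qed
    ultimately have "card {t \<in> T. t < s} = i" by (simp add: card_image)
    then show "l ! card {t \<in> T. t < s} = s" using i by simp
  qed
qed

definition dd_low_p :: "nat \<Rightarrow> real \<Rightarrow> (nat \<Rightarrow> real) \<Rightarrow> (real \<Rightarrow> real) \<Rightarrow> nat \<Rightarrow> nat \<Rightarrow> real" where
  "dd_low_p m p x f a b = (\<Sum>j | j < m \<and> a + j \<le> b. \<bar>divided_difference f (x ` {a..a + j})\<bar> powr p)"

text \<open>
  Only the first \<open>m\<close> points of each cluster are kept; in the resulting subsequence the first window
  of every cluster has weight 1, since the next clusters are at distance at least 1.
\<close>

lemma separated_clusters_low_order:
  fixes x :: "nat \<Rightarrow> real" and a b :: "int \<Rightarrow> nat"
  assumes m: "m \<ge> 1" and p: "p > 1" and x: "strict_mono_on {..n} x" and n: "m \<le> n" and A: "A \<ge> 0"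
    and W: "\<And>n' y. m \<le> n' \<Longrightarrow> strict_mono_on {..n'} y \<Longrightarrow> y ` {..n'} \<subseteq> x ` {..n} \<Longrightarrow> W_sum m p n' y f \<le> A powr p"
    and Z: "finite Z" "\<And>z z'. z \<in> Z \<Longrightarrow> z' \<in> Z \<Longrightarrow> z < z' \<Longrightarrow> z + 3 \<le> z'"
    and ab: "\<And>z. z \<in> Z \<Longrightarrow> a z \<le> b z \<and> b z \<le> n \<and> x ` {a z..b z} \<subseteq> {of_int z - 1..of_int z + 1}"
  shows "(\<Sum>z\<in>Z. dd_low_p m p x f (a z) (b z)) \<le> (real m * real m * (real m + 1) * A) powr p"
proof -
  define e where "e z = min (b z) (a z + m - 1)" for z
  define T where "T = (\<Union>z\<in>Z. x ` {a z..e z})"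
  have e: "a z \<le> e z" "e z \<le> b z" "e z < a z + m" "e z \<le> n" if "z \<in> Z" for z
    using ab[OF that] m by (auto simp: e_def)
  have finT: "finite T" using Z(1) by (auto simp: T_def)
  have Tx: "T \<subseteq> x ` {..n}" using e(4) by (fastforce simp: T_def)
  have xlt: "x i < x j" if "i < j" "j \<le> n" for i j using strict_mono_onD[OF x, of i j] that by simp
  have xle: "x i \<le> x j" if "i \<le> j" "j \<le> n" for i j using xlt[of i j] that by (cases "i = j") auto
  have xz: "of_int z - 1 \<le> x i \<and> x i \<le> of_int z + 1" if "z \<in> Z" "i \<in> {a z..b z}" for z i
    using ab[OF that(1)] that(2) by (metis atLeastAtMost_iff imageI subsetD)
  have sep: "x i + 1 \<le> x j" if "z \<in> Z" "z' \<in> Z" "z < z'" "i \<in> {a z..b z}" "j \<in> {a z'..b z'}" for z z' i j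
  proof -
    have "of_int z + (3::real) \<le> of_int z'" using Z(2)[OF that(1-3)] by linarith
    then show ?thesis using xz[OF that(1,4)] xz[OF that(2,5)] by linarith
  qed
  have aT: "x (a z) \<in> T" if "z \<in> Z" for z
    unfolding T_def by (intro UN_I[OF that] imageI) (use e(1)[OF that] in simp)
  have inja: "z = z'" if "z \<in> Z" "z' \<in> Z" "x (a z) = x (a z')" for z z'
    using sep[of z z' "a z" "a z'"] sep[of z' z "a z'" "a z"] that ab
    by (cases z z' rule: linorder_cases) fastforce+
  have ddb: "\<bar>divided_difference f (x ` {a z..a z + j})\<bar> \<le> (real m + 1) * A"
    if "z \<in> Z" "j < m" "a z + j \<le> b z" for z j
    by (rule consecutive_divided_difference_bound[OF m p x n A W]) (use that ab[OF that(1)] in auto)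
  have m1: "1 \<le> real m" using m by simp
  have AM: "A \<le> real m * real m * (real m + 1) * A"
  proof -
    have "1 * 1 * 1 \<le> real m * real m * (real m + 1)" using m1 by (intro mult_mono) auto
    then have "1 * A \<le> real m * real m * (real m + 1) * A" using A by (intro mult_right_mono) auto
    then show ?thesis by simp
  qed
  show ?thesis
  \<comment> \<open>A set of at most m points is too small for the functional. But then there are at
    most m clusters, and the bound for single differences is enough.\<close>
  proof (cases "card T \<le> m")
    case True
    have "card Z = card ((\<lambda>z. x (a z)) ` Z)" using inja by (intro card_image[symmetric] inj_onI)
    also have "\<dots> \<le> card T" using aT by (intro card_mono finT) auto
    finally have cZ: "card Z \<le> m" using True by simp
    have "dd_low_p m p x f (a z) (b z) \<le> real m * ((real m + 1) * A) powr p" if z: "z \<in> Z" for z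
    proof -
      have "dd_low_p m p x f (a z) (b z) \<le> (\<Sum>j | j < m \<and> a z + j \<le> b z. ((real m + 1) * A) powr p)"
        unfolding dd_low_p_def using ddb[OF z] p by (intro sum_mono powr_mono2) auto
      also have "\<dots> = real (card {j. j < m \<and> a z + j \<le> b z}) * ((real m + 1) * A) powr p" by simp
      also have "\<dots> \<le> real m * ((real m + 1) * A) powr p"
      proof (rule mult_right_mono)
        have "card {j. j < m \<and> a z + j \<le> b z} \<le> card {..<m}" by (rule card_mono) auto
        then show "real (card {j. j < m \<and> a z + j \<le> b z}) \<le> real m" by simp
      qed simp
      finally show ?thesis .
    qed
    then have "(\<Sum>z\<in>Z. dd_low_p m p x f (a z) (b z)) \<le> real (card Z) * (real m * ((real m + 1) * A) powr p)"
      by (rule sum_bounded_above)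
    also have "\<dots> \<le> real m * (real m * ((real m + 1) * A) powr p)"
      using cZ by (intro mult_right_mono) auto
    also have "\<dots> \<le> real m powr p * (real m powr p * ((real m + 1) * A) powr p)"
      using m1 p powr_mono[of 1 p "real m"] by (intro mult_mono) auto
    also have "\<dots> = (real m * real m * (real m + 1) * A) powr p"
      using A by (simp add: powr_mult mult.assoc)
    finally show ?thesis .
  next
    case False
    obtain y where y: "strict_mono_on {..<card T} y" "y ` {..<card T} = T"
      "\<And>s. s \<in> T \<Longrightarrow> y (card {t \<in> T. t < s}) = s"
      by (rule finite_set_enumeration[OF finT]) (rule that)
    define n' where "n' = card T - 1"
    have n': "{..<card T} = {..n'}" "m \<le> n'" using False by (auto simp: n'_def)
    have ymono: "strict_mono_on {..n'} y" and yT: "y ` {..n'} = T" using y n' by auto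
    have WT: "W_sum m p n' y f \<le> A powr p" using W[OF n'(2) ymono] Tx yT by simp
    \<comment> \<open>The index, in the thinned sequence \<open>y\<close>, of the first point of
      cluster z.\<close>
    define pos where "pos z = card {t \<in> T. t < x (a z)}" for z
    have ypos: "y (pos z + q) = x (a z + q)" and posn: "pos z + q \<le> n'" if z: "z \<in> Z" and q: "a z + q \<le> e z" for z q
    proof -
      have "{t \<in> T. t < x (a z + q)} = {t \<in> T. t < x (a z)} \<union> x ` {a z..<a z + q}"
      proof
        show "{t \<in> T. t < x (a z + q)} \<subseteq> {t \<in> T. t < x (a z)} \<union> x ` {a z..<a z + q}"
        proof
          fix t assume t: "t \<in> {t \<in> T. t < x (a z + q)}"
          then obtain i where i: "i \<le> n" "t = x i" using Tx by auto
          have "i < a z + q" using t i xle[of "a z + q" i] by (cases "i < a z + q") auto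
          then show "t \<in> {t \<in> T. t < x (a z)} \<union> x ` {a z..<a z + q}"
            using t i xlt[of i "a z"] e[OF z] by (cases "i < a z") auto
        qed
        show "{t \<in> T. t < x (a z)} \<union> x ` {a z..<a z + q} \<subseteq> {t \<in> T. t < x (a z + q)}"
        proof
          fix t assume "t \<in> {t \<in> T. t < x (a z)} \<union> x ` {a z..<a z + q}"
          then show "t \<in> {t \<in> T. t < x (a z + q)}"
          proof
            assume t: "t \<in> {t \<in> T. t < x (a z)}"
            have "x (a z) \<le> x (a z + q)" using xle q e(4)[OF z] by simp
            then show ?thesis using t by auto
          next
            assume "t \<in> x ` {a z..<a z + q}"
            then obtain i where i: "i \<in> {a z..<a z + q}" "t = x i" by auto
            have "t \<in> T" unfolding T_def i(2) by (intro UN_I[OF z] imageI) (use q i(1) in simp)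
            moreover have "t < x (a z + q)" using i q e(4)[OF z] xlt by simp
            ultimately show ?thesis by simp
          qed
        qed
      qed
      moreover have "{t \<in> T. t < x (a z)} \<inter> x ` {a z..<a z + q} = {}"
      proof -
        have "\<not> x i < x (a z)" if "i \<in> {a z..<a z + q}" for i
          using xle[of "a z" i] that q e(4)[OF z] by auto
        then show ?thesis by auto
      qed
      moreover have "card (x ` {a z..<a z + q}) = q"
      proof -
        have "inj_on x {a z..<a z + q}"
          by (rule inj_on_subset[OF strict_mono_on_imp_inj_on[OF x]]) (use q e(4)[OF z] in auto)
        then show ?thesis by (simp add: card_image)
      qed
      ultimately have c: "card {t \<in> T. t < x (a z + q)} = pos z + q"
        using finT by (simp add: card_Un_disjoint pos_def)
      have xT: "x (a z + q) \<in> T" unfolding T_def by (intro UN_I[OF z] imageI) (use q in simp)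
      from y(3)[OF this] c show "y (pos z + q) = x (a z + q)" by simp
      have "card {t \<in> T. t < x (a z + q)} < card T" using xT finT by (intro psubset_card_mono) auto
      then show "pos z + q \<le> n'" using c by (simp add: n'_def)
    qed
    have ypos0: "y (pos z) = x (a z)" if "z \<in> Z" for z using ypos[OF that, of 0] e(1)[OF that] by simp
    have yim: "y ` {pos z..pos z + j} = x ` {a z..a z + j}" if z: "z \<in> Z" and j: "a z + j \<le> e z" for z j
    proof -
      have "y ` {pos z..pos z + j} = (\<lambda>q. y (pos z + q)) ` {0..j}" by (auto simp: image_iff) (metis atLeastAtMost_iff le0 le_add_diff_inverse nat_add_left_cancel_le)
      also have "\<dots> = (\<lambda>q. x (a z + q)) ` {0..j}" using ypos[OF z] j by (intro image_cong) auto
      also have "\<dots> = x ` {a z..a z + j}" by (auto simp: image_iff) (metis atLeastAtMost_iff le0 le_add_diff_inverse nat_add_left_cancel_le)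
      finally show ?thesis .
    qed
    have wt: "W_weight m n' y (pos z) = 1" if z: "z \<in> Z" for z
    proof (cases "pos z + m \<le> n'")
      case True
      have ylt: "y (pos z) < y (pos z + m)" using strict_mono_onD[OF ymono, of "pos z" "pos z + m"] True m by simp
      have "y (pos z + m) \<in> T" using yT True by blast
      then obtain z' i where i: "z' \<in> Z" "i \<in> {a z'..e z'}" "y (pos z + m) = x i" by (auto simp: T_def)
      have "z < z'"
      proof (rule ccontr)
        assume "\<not> z < z'"
        then consider "z' < z" | "z' = z" by linarith
        then show False
        proof cases
          case 1
          have "x i + 1 \<le> x (a z)" using i e[OF i(1)] e[OF z] by (intro sep[OF i(1) z 1]) auto
          then show False using ylt i ypos0[OF z] by simp
        next
          case 2
          define q where "q = i - a z"
          have q: "a z + q = i" "q < m" using i 2 e[OF z] by (auto simp: q_def)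
          then have "y (pos z + m) = y (pos z + q)" using ypos[OF z, of q] i 2 by simp
          moreover have "y (pos z + q) < y (pos z + m)" using strict_mono_onD[OF ymono, of "pos z + q" "pos z + m"] True q by simp
          ultimately show False by simp
        qed
      qed
      then have "x (a z) + 1 \<le> x i" using i e[OF i(1)] e[OF z] by (intro sep[OF z i(1)]) auto
      then show ?thesis using ypos0[OF z] i(3) True by (simp add: W_weight_def)
    qed (simp add: W_weight_def)
    \<comment> \<open>Different clusters start at different positions, so their low-order terms are
      distinct summands of \<open>W_sum\<close> for \<open>y\<close>.\<close>
    have posinj: "inj_on pos Z" using inja ypos0 by (intro inj_onI) metis
    let ?t = "\<lambda>k i. W_weight m n' y i * \<bar>divided_difference f (y ` {i..i + k})\<bar> powr p"
    let ?S = "Sigma Z (\<lambda>z. {j. j < m \<and> a z + j \<le> b z})"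
    have fS: "finite {j. j < m \<and> a z + j \<le> b z}" for z by (rule finite_windows)
    have je: "a z + j \<le> e z" if "j < m" "a z + j \<le> b z" for z j using that by (simp add: e_def)
    have "(\<Sum>z\<in>Z. dd_low_p m p x f (a z) (b z)) = (\<Sum>(z, j)\<in>?S. ?t j (pos z))"
      unfolding dd_low_p_def
      by (subst sum.Sigma[symmetric]) (use Z(1) fS wt yim je in \<open>auto intro!: sum.cong\<close>)
    also have "\<dots> = (\<Sum>(k, i)\<in>(\<lambda>(z, j). (j, pos z)) ` ?S. ?t k i)"
    proof (subst sum.reindex)
      show "inj_on (\<lambda>(z, j). (j, pos z)) ?S" using posinj by (auto simp: inj_on_def)
    qed (simp add: case_prod_beta comp_def)
    also have "\<dots> \<le> W_sum m p n' y f"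
    proof (rule W_sum_part_le[OF ymono])
      show "(\<lambda>(z, j). (j, pos z)) ` ?S \<subseteq> {(k, i). k \<le> m \<and> i \<le> n' - k}"
      proof clarify
        fix z j assume "z \<in> Z" "j < m" "a z + j \<le> b z"
        then show "j \<le> m \<and> pos z \<le> n' - j" using posn[of z j] je[of j z] by simp
      qed
    qed
    also have "\<dots> \<le> A powr p" by (rule WT)
    also have "\<dots> \<le> (real m * real m * (real m + 1) * A) powr p" using AM A p by (intro powr_mono2) auto
    finally show ?thesis .
  qed
qed

section \<open>Extension from a finite set\<close>

lemma powr_add3_le:
  fixes u v w p :: real
  assumes "p > 1" "u \<ge> 0" "v \<ge> 0" "w \<ge> 0"
  shows "(u + v + w) powr p \<le> 3 powr p * (u powr p + v powr p + w powr p)"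
proof -
  have eq: "{..<3::nat} = {0, 1, 2}" by auto
  have "(\<Sum>i<3. [u, v, w] ! i) powr p \<le> real 3 powr p * (\<Sum>i<3. ([u, v, w] ! i) powr p)"
    using assms by (intro powr_sum_le[where J = "{..<3}"]) (auto simp: eq)
  then show ?thesis by (simp add: eq add.assoc)
qed

text \<open>Each gap between neighbouring points lies in at most m windows; when the sum is arranged
  by the position j of the gap in its window, every inner sum telescopes.\<close>

lemma top_window_weights:
  fixes x :: "nat \<Rightarrow> real"
  assumes "a \<le> b" "strict_mono_on {a..b} x"
  shows "(\<Sum>i | a \<le> i \<and> i + m \<le> b. x (i + m) - x i) \<le> real m * (x b - x a)"
proof -
  have xle: "x p \<le> x q" if "a \<le> p" "p \<le> q" "q \<le> b" for p q
    using strict_mono_onD[OF assms(2), of p q] that by (cases "p = q") auto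
  show ?thesis
  proof (cases "a + m \<le> b")
    case False
    then have "{i. a \<le> i \<and> i + m \<le> b} = {}" by auto
    then have "(\<Sum>i | a \<le> i \<and> i + m \<le> b. x (i + m) - x i) = 0" by (simp only: sum.empty)
    moreover have "0 \<le> real m * (x b - x a)" using xle[of a b] assms(1) by simp
    ultimately show ?thesis by simp
  next
    case True
    have eq: "{i. a \<le> i \<and> i + m \<le> b} = {a..<Suc b - m}" using True by auto
    have "(\<Sum>i\<in>{a..<Suc b - m}. x (i + m) - x i) = (\<Sum>i\<in>{a..<Suc b - m}. \<Sum>j<m. x (Suc (i + j)) - x (i + j))"
      by (rule sum.cong[OF refl]) (use sum_lessThan_telescope[of "\<lambda>j. x (i + j)" m for i] in simp)
    also have "\<dots> = (\<Sum>j<m. \<Sum>i\<in>{a..<Suc b - m}. x (Suc i + j) - x (i + j))"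
      by (subst sum.swap) simp
    also have "\<dots> = (\<Sum>j<m. x (Suc b - m + j) - x (a + j))"
      using True by (intro sum.cong refl sum_Suc_diff') simp
    also have "\<dots> \<le> (\<Sum>j<m. x b - x a)"
      using True by (intro sum_mono diff_mono xle) auto
    finally show ?thesis unfolding eq by simp
  qed
qed

lemma card_int_near:
  fixes t :: real
  shows "card {z \<in> Z. \<bar>t - of_int z\<bar> < 1} \<le> 2" "card {z \<in> Z. \<bar>t - of_int z\<bar> \<le> 1} \<le> 3"
proof -
  have "{z \<in> Z. \<bar>t - of_int z\<bar> < 1} \<subseteq> {\<lfloor>t\<rfloor>..\<lfloor>t\<rfloor> + 1}"
  proof clarify
    fix z :: int assume "\<bar>t - of_int z\<bar> < 1"
    then show "z \<in> {\<lfloor>t\<rfloor>..\<lfloor>t\<rfloor> + 1}" by simp linarith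
  qed
  from card_mono[OF _ this] show "card {z \<in> Z. \<bar>t - of_int z\<bar> < 1} \<le> 2" by simp
  have "{z \<in> Z. \<bar>t - of_int z\<bar> \<le> 1} \<subseteq> {\<lfloor>t\<rfloor> - 1..\<lfloor>t\<rfloor> + 1}"
  proof clarify
    fix z :: int assume "\<bar>t - of_int z\<bar> \<le> 1"
    then show "z \<in> {\<lfloor>t\<rfloor> - 1..\<lfloor>t\<rfloor> + 1}" by simp linarith
  qed
  from card_mono[OF _ this] show "card {z \<in> Z. \<bar>t - of_int z\<bar> \<le> 1} \<le> 3" by simp
qed

text \<open>\<open>\<phi> z\<close> is H (t - z + 1) - H (t - z): it goes from 0 to 1 on [z - 1, z]
  and back on [z, z + 1]. The sum over z telescopes, and only the two integers next to t
  matter.\<close>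

lemma partition_of_unity_exists:
  obtains \<phi> :: "int \<Rightarrow> nat \<Rightarrow> real \<Rightarrow> real" and B where
    "\<And>z. deriv_chain (Suc m) (\<phi> z)" "B \<ge> (1::real)"
    "\<And>z k t. k \<le> m \<Longrightarrow> 1 \<le> \<bar>t - of_int z\<bar> \<Longrightarrow> \<phi> z k t = 0"
    "\<And>z k t. k \<le> m \<Longrightarrow> \<bar>\<phi> z k t\<bar> \<le> B"
    "\<And>t. \<phi> \<lfloor>t\<rfloor> 0 t + \<phi> (\<lfloor>t\<rfloor> + 1) 0 t = 1"
proof -
  obtain H B where H: "deriv_chain (Suc m) H" "B \<ge> (1::real)"
    "\<And>k t. k \<le> Suc m \<Longrightarrow> t \<le> 0 \<Longrightarrow> H k t = 0" "\<And>t. t \<ge> 1 \<Longrightarrow> H 0 t = 1"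
    "\<And>k t. 0 < k \<Longrightarrow> k \<le> Suc m \<Longrightarrow> t \<ge> 1 \<Longrightarrow> H k t = 0"
    "\<And>k t. k \<le> m \<Longrightarrow> \<bar>H k t\<bar> \<le> B"
    by (rule smoothstep_exists[of m]) (rule that)
  define \<phi> where "\<phi> z k t = H k (t + (1 - of_int z)) - H k (t + (- of_int z))" for z :: int and k t
  show ?thesis
  proof (rule that[of \<phi> "2 * B"])
    show "deriv_chain (Suc m) (\<phi> z)" for z
      unfolding \<phi>_def[abs_def]
      using deriv_chain_diff[OF deriv_chain_affine[OF H(1), of 1 "1 - of_int z"] deriv_chain_affine[OF H(1), of 1 "- of_int z"]]
      by simp
    show "2 * B \<ge> 1" using H(2) by simp
    show "\<phi> z k t = 0" if k: "k \<le> m" and t: "1 \<le> \<bar>t - of_int z\<bar>" for z k t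
    proof (cases "t \<le> of_int z")
      case True
      then show ?thesis using t k H(3)[of k "t + (1 - of_int z)"] H(3)[of k "t + (- of_int z)"] by (simp add: \<phi>_def)
    next
      case False
      then have "t + (- of_int z) \<ge> 1" "t + (1 - of_int z) \<ge> 1" using t by auto
      then show ?thesis
        using k H(4)[of "t + (1 - of_int z)"] H(4)[of "t + (- of_int z)"]
          H(5)[of k "t + (1 - of_int z)"] H(5)[of k "t + (- of_int z)"] by (cases "k = 0") (simp_all add: \<phi>_def)
    qed
    show "\<bar>\<phi> z k t\<bar> \<le> 2 * B" if "k \<le> m" for z k t
      using H(6)[OF that, of "t + (1 - of_int z)"] H(6)[OF that, of "t + (- of_int z)"] unfolding \<phi>_def by linarith
    show "\<phi> \<lfloor>t\<rfloor> 0 t + \<phi> (\<lfloor>t\<rfloor> + 1) 0 t = 1" for t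
    proof -
      have "t + (1 - of_int \<lfloor>t\<rfloor>) \<ge> 1" "t + (- of_int (\<lfloor>t\<rfloor> + 1)) \<le> 0" by linarith+
      moreover have "t + (1 - of_int (\<lfloor>t\<rfloor> + 1)) = t + (- of_int \<lfloor>t\<rfloor>)" by simp
      ultimately show ?thesis using H(3,4) by (simp add: \<phi>_def)
    qed
  qed
qed

text \<open>The p-th power of |F k t| is bounded pointwise by a combination of indicator functions,
  which is then integrated exactly: the low-order and top-order sums \<open>LL\<close> and
  \<open>TT\<close> of cluster z live on [z - 1, z + 1], the gap terms \<open>GG\<close> on their
  gaps. The hypothesis ranges over all subsequences because the low-order sums are tested on thinned
  ones.\<close>

lemma finite_extension:
  assumes m: "m \<ge> 1"
  shows "\<exists>K\<ge>1. \<forall>p n x f A. 1 < p \<longrightarrow> m \<le> n \<longrightarrow> strict_mono_on {..n} x \<longrightarrow> 0 \<le> A \<longrightarrow>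
    (\<forall>n' y. m \<le> n' \<longrightarrow> strict_mono_on {..n'} y \<longrightarrow> y ` {..n'} \<subseteq> x ` {..n} \<longrightarrow> W_sum m p n' y f \<le> A powr p) \<longrightarrow>
    (\<exists>F. deriv_chain (Suc m) F \<and> (\<forall>i\<le>n. F 0 (x i) = f (x i)) \<and>
      (\<forall>k\<le>m. (\<integral>\<^sup>+ t. ennreal (\<bar>F k t\<bar> powr p) \<partial>lborel) \<le> ennreal ((K * A) powr p)))"
proof -
  define loc where "loc C x f u a b D g \<longleftrightarrow> deriv_chain (Suc m) D \<and> (\<forall>i\<in>{a..b}. D 0 (x i) = f (x i)) \<and>
      (\<forall>i. i \<le> g i \<and> g i < i + m) \<and>
      (\<forall>t\<in>{u - 1..u + 1}. \<forall>k<m. \<bar>D k t\<bar> \<le> C * (dd_low m x f a b + dd_top m x f a b)) \<and>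
      (\<forall>t. \<bar>D m t\<bar> \<le> C * dd_gap m x f g a b t)" for C x f u a b D g
  obtain C where C: "C \<ge> 1" and Cloc: "\<And>x f u a b. a \<le> b \<Longrightarrow> strict_mono_on {a..b} x \<Longrightarrow>
      x ` {a..b} \<subseteq> {u - 1..u + 1} \<Longrightarrow> \<exists>D g. loc C x f u a b D g"
    using local_extension[OF m] unfolding loc_def by blast
  obtain \<phi> :: "int \<Rightarrow> nat \<Rightarrow> real \<Rightarrow> real" and B where \<phi>:
    "\<And>z. deriv_chain (Suc m) (\<phi> z)" "B \<ge> (1::real)"
    "\<And>z k t. k \<le> m \<Longrightarrow> 1 \<le> \<bar>t - of_int z\<bar> \<Longrightarrow> \<phi> z k t = 0"
    "\<And>z k t. k \<le> m \<Longrightarrow> \<bar>\<phi> z k t\<bar> \<le> B"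
    "\<And>t. \<phi> \<lfloor>t\<rfloor> 0 t + \<phi> (\<lfloor>t\<rfloor> + 1) 0 t = 1"
    by (rule partition_of_unity_exists[of m]) (rule that)
  define K1 where "K1 = 2 ^ m * (B * C)"
  define M where "M = real m * real m * (real m + 1)"
  \<comment> \<open>12 m = 2 * 3 * 2 m: at most two partition functions overlap, three kinds of
    terms are added, and the windows of a cluster have total length at most 2 m. 27 = 3 * 3 + 3 * 6
    comes from \<open>LLsum\<close> and \<open>TTsum\<close>, and \<open>M\<close> from the
    separated clusters.\<close>
  define K where "K = 12 * real m * K1 * 27 * M"
  have m1: "1 \<le> real m" using m by simp
  have "1 * 1 \<le> B * C" using \<phi>(2) C by (intro mult_mono) auto
  then have "1 * 1 \<le> 2 ^ m * (B * C)" by (intro mult_mono[of 1 "2 ^ m" 1 "B * C"]) simp_all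
  then have K1: "K1 \<ge> 1" by (simp add: K1_def)
  have M: "M \<ge> 1" unfolding M_def using mult_mono[of 1 "real m * real m" 1 "real m + 1"] mult_mono[of 1 "real m" 1 "real m"] m1 by simp
  have "1 * 1 * 1 * 1 * 1 \<le> K" unfolding K_def using m1 K1 M by (intro mult_mono) auto
  then have K: "K \<ge> 1" by simp
  show ?thesis
  proof (intro exI[of _ K] conjI allI impI K)
    fix p :: real and n and x :: "nat \<Rightarrow> real" and f A
    assume p: "1 < p" and n: "m \<le> n" and x: "strict_mono_on {..n} x" and A: "0 \<le> A"
      and W: "\<forall>n' y. m \<le> n' \<longrightarrow> strict_mono_on {..n'} y \<longrightarrow> y ` {..n'} \<subseteq> x ` {..n} \<longrightarrow> W_sum m p n' y f \<le> A powr p"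
    have W': "W_sum m p n' y f \<le> A powr p" if "m \<le> n'" "strict_mono_on {..n'} y" "y ` {..n'} \<subseteq> x ` {..n}" for n' y
      using W that by blast
    have xlt: "x i < x j" if "i < j" "j \<le> n" for i j using strict_mono_onD[OF x, of i j] that by simp
    have xle: "x i \<le> x j" if "i \<le> j" "j \<le> n" for i j using xlt[of i j] that by (cases "i = j") auto
    \<comment> \<open>The clusters are cut out by closed intervals of radius 1 and overlap: each
      \<phi> z that is nonzero at a point x i multiplies a local extension through that
      point.\<close>
    define J where "J z = {i. i \<le> n \<and> \<bar>x i - of_int z\<bar> \<le> 1}" for z
    define Z where "Z = {z. J z \<noteq> {}}"
    define a where "a z = Min (J z)" for z
    define b where "b z = Max (J z)" for z
    have finJ: "finite (J z)" for z by (rule finite_subset[of _ "{..n}"]) (auto simp: J_def)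
    have "Z \<subseteq> (\<Union>i\<le>n. {\<lfloor>x i\<rfloor> - 1..\<lfloor>x i\<rfloor> + 1})"
    proof
      fix z assume "z \<in> Z"
      then obtain i where i: "i \<le> n" "\<bar>x i - of_int z\<bar> \<le> 1" by (auto simp: Z_def J_def)
      then have "z \<in> {\<lfloor>x i\<rfloor> - 1..\<lfloor>x i\<rfloor> + 1}" by simp linarith
      then show "z \<in> (\<Union>i\<le>n. {\<lfloor>x i\<rfloor> - 1..\<lfloor>x i\<rfloor> + 1})" using i(1) by blast
    qed
    then have finZ: "finite Z" by (rule finite_subset) simp
    have aJ: "a z \<in> J z" and bJ: "b z \<in> J z" if "z \<in> Z" for z
      using that finJ unfolding a_def b_def Z_def by simp_all
    have Jeq: "J z = {a z..b z}" if z: "z \<in> Z" for z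
    proof
      show "J z \<subseteq> {a z..b z}" using finJ[of z] by (auto simp: a_def b_def)
      show "{a z..b z} \<subseteq> J z"
      proof
        fix i assume i: "i \<in> {a z..b z}"
        have 1: "a z \<le> n" "b z \<le> n" "\<bar>x (a z) - of_int z\<bar> \<le> 1" "\<bar>x (b z) - of_int z\<bar> \<le> 1"
          using aJ[OF z] bJ[OF z] by (auto simp: J_def)
        have "x (a z) \<le> x i" "x i \<le> x (b z)" using i 1 xle by auto
        then show "i \<in> J z" using 1 i by (simp add: J_def abs_le_iff)
      qed
    qed
    have ab: "a z \<le> b z" "b z \<le> n" if "z \<in> Z" for z
      using bJ[OF that] aJ[OF that] finJ[of z] by (auto simp: J_def a_def)
    have xJ: "x ` {a z..b z} \<subseteq> {of_int z - 1..of_int z + 1}" if "z \<in> Z" for z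
      unfolding Jeq[OF that, symmetric] by (auto simp: J_def abs_le_iff)
    have xab: "strict_mono_on {a z..b z} x" if "z \<in> Z" for z
      by (rule monotone_on_subset[OF x]) (use ab[OF that] in auto)
    have "\<forall>z\<in>Z. \<exists>D g. loc C x f (of_int z) (a z) (b z) D g"
      using Cloc ab xab xJ by blast
    then obtain D g where Dg: "\<And>z. z \<in> Z \<Longrightarrow> loc C x f (of_int z) (a z) (b z) (D z) (g z)" by metis
    have D: "deriv_chain (Suc m) (D z)" "\<And>i. i \<in> {a z..b z} \<Longrightarrow> D z 0 (x i) = f (x i)"
      "\<And>i. i \<le> g z i \<and> g z i < i + m"
      "\<And>t k. t \<in> {of_int z - 1..of_int z + 1} \<Longrightarrow> k < m \<Longrightarrow> \<bar>D z k t\<bar> \<le> C * (dd_low m x f (a z) (b z) + dd_top m x f (a z) (b z))"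
      "\<And>t. \<bar>D z m t\<bar> \<le> C * dd_gap m x f (g z) (a z) (b z) t" if "z \<in> Z" for z
      using Dg[OF that] unfolding loc_def by blast+
    define F where "F k t = (\<Sum>z\<in>Z. leibniz (\<phi> z) (D z) k t)" for k t
    define \<beta> where "\<beta> i = \<bar>divided_difference f (x ` {i..i + m})\<bar>" for i
    define I where "I z = {i. a z \<le> i \<and> i + m \<le> b z}" for z
    have finI: "finite (I z)" for z unfolding I_def by (rule finite_windows)
    define LL where "LL z = dd_low_p m p x f (a z) (b z)" for z
    define TT where "TT z = (\<Sum>i\<in>I z. (x (i + m) - x i) * \<beta> i powr p)" for z
    define gp where "gp z i = {x (g z i)<..<x (Suc (g z i))}" for z i
    define GG where "GG z t = (\<Sum>i\<in>I z. \<beta> i powr p * indicator (gp z i) t)" for z t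
    have Dpos: "0 \<le> x (i + m) - x i" if "i \<in> I z" "z \<in> Z" for i z
      using xle[of i "i + m"] that ab[of z] by (simp add: I_def)
    have LLpos: "0 \<le> LL z" for z unfolding LL_def dd_low_p_def by (intro sum_nonneg) simp
    have TTpos: "0 \<le> TT z" if "z \<in> Z" for z
      unfolding TT_def using Dpos[OF _ that] by (intro sum_nonneg mult_nonneg_nonneg) simp_all
    have GGpos: "0 \<le> GG z t" for z t unfolding GG_def by (intro sum_nonneg) simp
    show "\<exists>F. deriv_chain (Suc m) F \<and> (\<forall>i\<le>n. F 0 (x i) = f (x i)) \<and>
      (\<forall>k\<le>m. (\<integral>\<^sup>+ t. ennreal (\<bar>F k t\<bar> powr p) \<partial>lborel) \<le> ennreal ((K * A) powr p))"
    proof (intro exI[of _ F] conjI allI impI)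
      show "deriv_chain (Suc m) F" unfolding F_def
        by (intro deriv_chain_sum deriv_chain_leibniz \<phi>(1) D(1))
      show "F 0 (x i) = f (x i)" if i: "i \<le> n" for i
      proof -
        let ?w = "\<lfloor>x i\<rfloor>"
        have "\<bar>x i - of_int ?w\<bar> \<le> 1" "\<bar>x i - of_int (?w + 1)\<bar> \<le> 1" by (simp_all add: abs_le_iff) linarith+
        then have w: "{?w, ?w + 1} \<subseteq> Z" using i by (auto simp: Z_def J_def)
        have "F 0 (x i) = (\<Sum>z\<in>Z. \<phi> z 0 (x i) * f (x i))"
          unfolding F_def leibniz_0
        proof (rule sum.cong[OF refl])
          fix z assume z: "z \<in> Z"
          show "\<phi> z 0 (x i) * D z 0 (x i) = \<phi> z 0 (x i) * f (x i)"
          proof (cases "1 \<le> \<bar>x i - of_int z\<bar>")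
            case True
            then show ?thesis using \<phi>(3)[of 0] by simp
          next
            case False
            then have "i \<in> {a z..b z}" using i unfolding Jeq[OF z, symmetric] by (simp add: J_def)
            then show ?thesis using D(2)[OF z] by simp
          qed
        qed
        also have "\<dots> = (\<Sum>z\<in>{?w, ?w + 1}. \<phi> z 0 (x i) * f (x i))"
        proof (rule sum.mono_neutral_right[OF finZ w])
          show "\<forall>z\<in>Z - {?w, ?w + 1}. \<phi> z 0 (x i) * f (x i) = 0"
          proof
            fix z assume "z \<in> Z - {?w, ?w + 1}"
            then have "z < ?w \<or> z > ?w + 1" by auto
            then have "1 \<le> \<bar>x i - of_int z\<bar>" by (elim disjE) linarith+
            then show "\<phi> z 0 (x i) * f (x i) = 0" using \<phi>(3)[of 0] by simp
          qed
        qed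
        also have "\<dots> = (\<phi> ?w 0 (x i) + \<phi> (?w + 1) 0 (x i)) * f (x i)" by (simp add: algebra_simps)
        finally show ?thesis by (simp only: \<phi>(5) mult_1)
      qed
      fix k assume k: "k \<le> m"
      have point: "\<bar>F k t\<bar> powr p \<le> (12 * real m * K1) powr p *
          (\<Sum>z\<in>Z. (LL z + TT z) * indicator {of_int z - 1..of_int z + 1} t + GG z t)" for t
      proof -
        define N where "N = {z \<in> Z. \<bar>t - of_int z\<bar> < 1}"
        have finN: "finite N" and NZ: "N \<subseteq> Z" using finZ by (auto simp: N_def)
        define S where "S z = dd_low m x f (a z) (b z) + dd_top m x f (a z) (b z) + dd_gap m x f (g z) (a z) (b z) t" for z
        have lo: "0 \<le> dd_low m x f (a z) (b z)" for z unfolding dd_low_def by (intro sum_nonneg) simp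
        have to: "0 \<le> dd_top m x f (a z) (b z)" if "z \<in> Z" for z
          unfolding dd_top_def using Dpos[OF _ that] unfolding I_def by (intro sum_nonneg mult_nonneg_nonneg) simp_all
        have ga: "0 \<le> dd_gap m x f (g z) (a z) (b z) t" for z unfolding dd_gap_def by (intro sum_nonneg) simp
        have S0: "0 \<le> S z" if "z \<in> Z" for z using lo to[OF that] ga by (simp add: S_def)
        have tm: "\<bar>leibniz (\<phi> z) (D z) k t\<bar> \<le> K1 * S z" if z: "z \<in> N" for z
        proof -
          have zZ: "z \<in> Z" and tz: "t \<in> {of_int z - 1..of_int z + 1}" using z by (auto simp: N_def)
          have Dl: "\<bar>D z l t\<bar> \<le> C * S z" if l: "l \<le> m" for l
          proof (cases "l = m")
            case True
            have "\<bar>D z m t\<bar> \<le> C * dd_gap m x f (g z) (a z) (b z) t" by (rule D(5)[OF zZ])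
            also have "\<dots> \<le> C * S z" using C lo[of z] to[OF zZ] by (intro mult_left_mono) (auto simp: S_def)
            finally show ?thesis using True by simp
          next
            case False
            have "\<bar>D z l t\<bar> \<le> C * (dd_low m x f (a z) (b z) + dd_top m x f (a z) (b z))"
              using D(4)[OF zZ tz] False l by simp
            also have "\<dots> \<le> C * S z" using C ga[of z] by (intro mult_left_mono) (auto simp: S_def)
            finally show ?thesis .
          qed
          have "\<bar>leibniz (\<phi> z) (D z) k t\<bar> \<le> 2 ^ k * (B * (C * S z))"
          proof (rule leibniz_bound)
            fix r assume "r \<le> k"
            then show "\<bar>\<phi> z r t * D z (k - r) t\<bar> \<le> B * (C * S z)"
              unfolding abs_mult using \<phi>(4)[of r z t] Dl[of "k - r"] k \<phi>(2) by (intro mult_mono) auto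
          qed
          also have "\<dots> \<le> 2 ^ m * (B * (C * S z))"
            using k \<phi>(2) C S0[OF zZ] by (intro mult_right_mono power_increasing) auto
          finally show ?thesis by (simp add: K1_def mult.assoc)
        qed
        have Fk: "F k t = (\<Sum>z\<in>N. leibniz (\<phi> z) (D z) k t)"
          unfolding F_def
        proof (rule sum.mono_neutral_right[OF finZ NZ])
          show "\<forall>z\<in>Z - N. leibniz (\<phi> z) (D z) k t = 0"
          proof
            fix z assume "z \<in> Z - N"
            then have "1 \<le> \<bar>t - of_int z\<bar>" by (auto simp: N_def)
            then show "leibniz (\<phi> z) (D z) k t = 0"
              unfolding leibniz_def using \<phi>(3) k by (intro sum.neutral) auto
          qed
        qed
        have "\<bar>F k t\<bar> \<le> (\<Sum>z\<in>N. \<bar>leibniz (\<phi> z) (D z) k t\<bar>)" unfolding Fk by (rule sum_abs)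
        also have "\<dots> \<le> (\<Sum>z\<in>N. K1 * S z)" by (intro sum_mono tm)
        finally have "\<bar>F k t\<bar> powr p \<le> (\<Sum>z\<in>N. K1 * S z) powr p" using p by (intro powr_mono2) auto
        also have "\<dots> \<le> real 2 powr p * (\<Sum>z\<in>N. (K1 * S z) powr p)"
        proof (rule powr_sum_le[OF p finN _ order_refl])
          show "card N \<le> 2" unfolding N_def by (rule card_int_near)
        qed (use S0 NZ K1 in auto)
        also have "(\<Sum>z\<in>N. (K1 * S z) powr p) \<le> (\<Sum>z\<in>N. (6 * real m * K1) powr p * (LL z + TT z + GG z t))"
        proof (rule sum_mono)
          fix z assume "z \<in> N"
          then have zZ: "z \<in> Z" using NZ by blast
          have l: "dd_low m x f (a z) (b z) powr p \<le> real m powr p * LL z"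
            unfolding dd_low_def LL_def dd_low_p_def
          proof (rule powr_sum_le[OF p _ _ order_refl])
            show "card {j. j < m \<and> a z + j \<le> b z} \<le> m"
              using card_mono[of "{..<m}" "{j. j < m \<and> a z + j \<le> b z}"] by auto
          qed (use finite_windows m in auto)
          have t1: "dd_top m x f (a z) (b z) powr p \<le> (2 * real m) powr p * TT z"
            unfolding dd_top_def TT_def \<beta>_def I_def
          proof (rule weighted_power_mean[OF p])
            show "0 \<le> x (i + m) - x i" if "i \<in> {i. a z \<le> i \<and> i + m \<le> b z}" for i
              using Dpos[OF _ zZ] that by (simp add: I_def)
            have "x (b z) - x (a z) \<le> 2"
              using aJ[OF zZ] bJ[OF zZ] by (auto simp: J_def abs_le_iff)
            then have "real m * (x (b z) - x (a z)) \<le> real m * 2" by (intro mult_left_mono) auto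
            then show "(\<Sum>i | a z \<le> i \<and> i + m \<le> b z. x (i + m) - x i) \<le> 2 * real m"
              using top_window_weights[OF ab(1)[OF zZ] xab[OF zZ], of m] by simp
            show "1 \<le> 2 * real m" using m1 by simp
          qed simp
          have t2: "dd_gap m x f (g z) (a z) (b z) t powr p \<le> real m powr p * GG z t"
          proof -
            let ?i = "\<lambda>i. if t \<in> gp z i then \<beta> i else 0"
            have "(\<Sum>i\<in>I z. ?i i) powr p \<le> real m powr p * (\<Sum>i\<in>I z. ?i i powr p)"
            proof (rule powr_sum_le[OF p finI])
              let ?J = "{i \<in> I z. t \<in> gp z i}"
              show "?J \<subseteq> I z" by auto
              show "?i i = 0" if "i \<in> I z - ?J" for i using that by auto
              \<comment> \<open>The gap chosen for i has an index in i..i + m - 1, so windows whose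
                starts are at least m apart have disjoint gaps, and \<open>t\<close> lies in the
                gaps of at most m windows.\<close>
              have "\<exists>c. ?J \<subseteq> {c..<c + m}"
              proof (cases "?J = {}")
                case False
                define c where "c = Min ?J"
                have fJ: "finite ?J" using finI by simp
                have cJ: "c \<in> ?J" unfolding c_def by (rule Min_in[OF fJ False])
                have cm: "c \<le> i" if "i \<in> ?J" for i unfolding c_def by (rule Min_le[OF fJ that])
                have "i < c + m" if i: "i \<in> ?J" for i
                proof (rule ccontr)
                  assume "\<not> i < c + m"
                  then have "Suc (g z c) \<le> g z i" using D(3)[OF zZ, of c] D(3)[OF zZ, of i] by linarith
                  moreover have "g z i \<le> n" using i D(3)[OF zZ, of i] ab[OF zZ] by (auto simp: I_def)
                  ultimately have "x (Suc (g z c)) \<le> x (g z i)" by (rule xle)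
                  then show False using i cJ by (auto simp: gp_def)
                qed
                then have "?J \<subseteq> {c..<c + m}" using cm by (intro subsetI) (simp only: atLeastLessThan_iff)
                then show ?thesis by blast
              qed auto
              then obtain c where "?J \<subseteq> {c..<c + m}" by blast
              from card_mono[OF _ this] show "card ?J \<le> m" by simp
            qed (use m in \<open>auto simp: \<beta>_def\<close>)
            moreover have "(\<Sum>i\<in>I z. ?i i powr p) = GG z t"
              unfolding GG_def by (intro sum.cong) auto
            ultimately show ?thesis unfolding dd_gap_def by (simp only: I_def \<beta>_def gp_def)
          qed
          have "S z powr p \<le> 3 powr p * (dd_low m x f (a z) (b z) powr p + dd_top m x f (a z) (b z) powr p +
              dd_gap m x f (g z) (a z) (b z) t powr p)"
            unfolding S_def by (rule powr_add3_le[OF p lo to[OF zZ] ga])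
          also have "\<dots> \<le> 3 powr p * ((2 * real m) powr p * LL z + (2 * real m) powr p * TT z + (2 * real m) powr p * GG z t)"
          proof (intro mult_left_mono add_mono)
            have mm: "real m powr p \<le> (2 * real m) powr p" using p by (intro powr_mono2) auto
            show "dd_low m x f (a z) (b z) powr p \<le> (2 * real m) powr p * LL z"
              using l mult_right_mono[OF mm LLpos[of z]] by linarith
            show "dd_top m x f (a z) (b z) powr p \<le> (2 * real m) powr p * TT z" by (rule t1)
            show "dd_gap m x f (g z) (a z) (b z) t powr p \<le> (2 * real m) powr p * GG z t"
              using t2 mult_right_mono[OF mm GGpos[of z t]] by linarith
          qed simp
          also have "\<dots> = (3 * (2 * real m)) powr p * (LL z + TT z + GG z t)"
            by (subst powr_mult) (simp_all add: algebra_simps)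
          finally have "K1 powr p * S z powr p \<le> K1 powr p * ((3 * (2 * real m)) powr p * (LL z + TT z + GG z t))"
            by (rule mult_left_mono) simp
          moreover have "(K1 * S z) powr p = K1 powr p * S z powr p" using K1 S0[OF zZ] by (simp add: powr_mult)
          moreover have "(6 * real m * K1) powr p = K1 powr p * (3 * (2 * real m)) powr p"
          proof -
            have "6 * real m * K1 = K1 * (3 * (2 * real m))" by simp
            then show ?thesis using K1 by (simp add: powr_mult)
          qed
          ultimately show "(K1 * S z) powr p \<le> (6 * real m * K1) powr p * (LL z + TT z + GG z t)"
            by (simp only: mult.assoc)
        qed
        also have "\<dots> = (6 * real m * K1) powr p * (\<Sum>z\<in>N. LL z + TT z + GG z t)" by (simp add: sum_distrib_left)
        also have "(\<Sum>z\<in>N. LL z + TT z + GG z t) \<le>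
            (\<Sum>z\<in>Z. (LL z + TT z) * indicator {of_int z - 1..of_int z + 1} t + GG z t)"
        proof (rule order_trans[OF _ sum_mono2[OF finZ NZ]])
          show "(\<Sum>z\<in>N. LL z + TT z + GG z t) \<le> (\<Sum>z\<in>N. (LL z + TT z) * indicator {of_int z - 1..of_int z + 1} t + GG z t)"
          proof (rule sum_mono)
            fix z assume "z \<in> N"
            then have "t \<in> {real_of_int z - 1..real_of_int z + 1}" by (auto simp: N_def abs_less_iff)
            then show "LL z + TT z + GG z t \<le> (LL z + TT z) * indicator {of_int z - 1..of_int z + 1} t + GG z t"
              by simp
          qed
          show "0 \<le> (LL z + TT z) * indicator {of_int z - 1..of_int z + 1} t + GG z t" if "z \<in> Z - N" for z
            using LLpos[of z] TTpos[of z] GGpos[of z t] that by simp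
        qed
        finally have "\<bar>F k t\<bar> powr p \<le> real 2 powr p * ((6 * real m * K1) powr p *
            (\<Sum>z\<in>Z. (LL z + TT z) * indicator {of_int z - 1..of_int z + 1} t + GG z t))"
          by (simp add: mult_left_mono)
        also have "\<dots> = (2 * (6 * real m * K1)) powr p *
            (\<Sum>z\<in>Z. (LL z + TT z) * indicator {of_int z - 1..of_int z + 1} t + GG z t)"
          using K1 by (subst powr_mult[of 2]) (simp_all add: mult.assoc)
        finally show ?thesis by (simp add: mult.assoc)
      qed
      define R where "R t = (\<Sum>z\<in>Z. (LL z + TT z) * indicator {of_int z - 1..of_int z + 1} t + GG z t)" for t :: real
      have hb: "has_bochner_integral lborel R (\<Sum>z\<in>Z. (LL z + TT z) * 2 + (\<Sum>i\<in>I z. \<beta> i powr p * (x (Suc (g z i)) - x (g z i))))"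
        unfolding R_def GG_def
      proof (intro has_bochner_integral_sum has_bochner_integral_add has_bochner_integral_mult_right)
        fix z :: int assume z: "z \<in> Z"
        show "has_bochner_integral lborel (indicat_real {real_of_int z - 1..real_of_int z + 1}) 2"
          using has_bochner_integral_real_indicator[of "{of_int z - 1..of_int z + 1 :: real}" lborel] by simp
        fix i assume i: "i \<in> I z"
        have "Suc (g z i) \<le> n" using i D(3)[OF z, of i] ab[OF z] by (auto simp: I_def)
        then have "x (g z i) \<le> x (Suc (g z i))" by (intro xle) auto
        then show "has_bochner_integral lborel (indicat_real (gp z i)) (x (Suc (g z i)) - x (g z i))"
          using has_bochner_integral_real_indicator[of "gp z i" lborel] by (simp add: gp_def)
      qed
      \<comment> \<open>A window start is within distance 1 of at most 3 integers, and a window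
        inside a cluster has length at most 2, hence at most twice its weight: 6 = 3 * 2.\<close>
      have TTsum: "(\<Sum>z\<in>Z. TT z) \<le> 6 * A powr p"
      proof -
        let ?w = "\<lambda>i. W_weight m n x i * \<beta> i powr p"
        have w0: "0 \<le> ?w i" for i using W_weight_nonneg[OF x] by simp
        have "TT z \<le> (\<Sum>i\<le>n - m. if \<bar>x i - of_int z\<bar> \<le> 1 then 2 * ?w i else 0)" if z: "z \<in> Z" for z
        proof -
          have "TT z \<le> (\<Sum>i\<in>I z. if \<bar>x i - of_int z\<bar> \<le> 1 then 2 * ?w i else 0)"
            unfolding TT_def
          proof (rule sum_mono)
            fix i assume i: "i \<in> I z"
            have "i \<in> J z" "i + m \<in> J z" using i m unfolding Jeq[OF z] by (auto simp: I_def)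
            then have xi: "\<bar>x i - of_int z\<bar> \<le> 1" "\<bar>x (i + m) - of_int z\<bar> \<le> 1" "i + m \<le> n" by (auto simp: J_def)
            then have "x (i + m) - x i \<le> 2" by linarith
            then have "x (i + m) - x i \<le> 2 * W_weight m n x i"
              using xi(3) Dpos[OF i z] by (simp add: W_weight_def min_def)
            then have "(x (i + m) - x i) * \<beta> i powr p \<le> 2 * W_weight m n x i * \<beta> i powr p" by (rule mult_right_mono) simp
            then show "(x (i + m) - x i) * \<beta> i powr p \<le> (if \<bar>x i - of_int z\<bar> \<le> 1 then 2 * ?w i else 0)"
              using xi(1) by (simp add: mult.assoc)
          qed
          also have "\<dots> \<le> (\<Sum>i\<le>n - m. if \<bar>x i - of_int z\<bar> \<le> 1 then 2 * ?w i else 0)"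
          proof (rule sum_mono2)
            show "I z \<subseteq> {..n - m}" using ab[OF z] by (auto simp: I_def)
          qed (use w0 in auto)
          finally show ?thesis .
        qed
        then have "(\<Sum>z\<in>Z. TT z) \<le> (\<Sum>z\<in>Z. \<Sum>i\<le>n - m. if \<bar>x i - of_int z\<bar> \<le> 1 then 2 * ?w i else 0)" by (rule sum_mono)
        also have "\<dots> = (\<Sum>i\<le>n - m. \<Sum>z\<in>Z. if \<bar>x i - of_int z\<bar> \<le> 1 then 2 * ?w i else 0)" by (rule sum.swap)
        also have "\<dots> \<le> (\<Sum>i\<le>n - m. 6 * ?w i)"
        proof (rule sum_mono)
          fix i
          have "(\<Sum>z\<in>Z. if \<bar>x i - of_int z\<bar> \<le> 1 then 2 * ?w i else 0) = real (card {z \<in> Z. \<bar>x i - of_int z\<bar> \<le> 1}) * (2 * ?w i)"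
            using finZ by (simp add: sum.If_cases Int_def)
          also have "\<dots> \<le> 3 * (2 * ?w i)"
          proof (rule mult_right_mono)
            show "real (card {z \<in> Z. \<bar>x i - of_int z\<bar> \<le> 1}) \<le> 3" using card_int_near(2)[of Z "x i"] by linarith
          qed (use w0 in simp)
          finally show "(\<Sum>z\<in>Z. if \<bar>x i - of_int z\<bar> \<le> 1 then 2 * ?w i else 0) \<le> 6 * ?w i" by simp
        qed
        also have "\<dots> = 6 * (\<Sum>(k, i)\<in>Pair m ` {..n - m}. W_weight m n x i * \<bar>divided_difference f (x ` {i..i + k})\<bar> powr p)"
          by (subst sum.reindex) (simp_all add: inj_on_def sum_distrib_left \<beta>_def)
        also have "\<dots> \<le> 6 * W_sum m p n x f"
          by (intro mult_left_mono W_sum_part_le[OF x]) auto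
        also have "\<dots> \<le> 6 * A powr p" using W'[OF n x] by simp
        finally show ?thesis .
      qed
      \<comment> \<open>Centres congruent mod 3 are at least 3 apart, so that their clusters of
        radius 1 are separated by at least 1.\<close>
      have LLsum: "(\<Sum>z\<in>Z. LL z) \<le> 3 * (M * A) powr p"
      proof -
        have "(\<Sum>z\<in>Z. LL z) = (\<Sum>r\<in>{0, 1, 2}. \<Sum>z\<in>{z \<in> Z. z mod 3 = r}. LL z)"
        proof (rule sum.group[symmetric, OF finZ])
          show "(\<lambda>z. z mod 3) ` Z \<subseteq> {0, 1, 2}"
          proof
            fix r assume "r \<in> (\<lambda>z. z mod 3) ` Z"
            then obtain z where "r = z mod 3" by blast
            then have "0 \<le> r" "r < 3" by simp_all
            then show "r \<in> {0, 1, 2}" by auto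
          qed
        qed simp
        also have "\<dots> \<le> (\<Sum>r\<in>{0, 1, 2::int}. (M * A) powr p)"
        proof (rule sum_mono)
          fix r :: int
          let ?Z = "{z \<in> Z. z mod 3 = r}"
          have "(\<Sum>z\<in>?Z. dd_low_p m p x f (a z) (b z)) \<le> (real m * real m * (real m + 1) * A) powr p"
          proof (rule separated_clusters_low_order[OF m p x n A])
            show "W_sum m p n' y f \<le> A powr p" if "m \<le> n'" "strict_mono_on {..n'} y" "y ` {..n'} \<subseteq> x ` {..n}" for n' y
              by (rule W'[OF that])
            show "finite ?Z" using finZ by simp
            show "z + 3 \<le> z'" if "z \<in> ?Z" "z' \<in> ?Z" "z < z'" for z z'
            proof -
              have "z mod 3 = z' mod 3" using that by simp
              then show ?thesis using that(3) by presburger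
            qed
            show "a z \<le> b z \<and> b z \<le> n \<and> x ` {a z..b z} \<subseteq> {of_int z - 1..of_int z + 1}" if "z \<in> ?Z" for z
              using ab[of z] xJ[of z] that by simp
          qed
          then show "(\<Sum>z\<in>?Z. LL z) \<le> (M * A) powr p" by (simp add: LL_def M_def)
        qed
        also have "\<dots> = 3 * (M * A) powr p" by simp
        finally show ?thesis .
      qed
      \<comment> \<open>The 2 is the length of [z - 1, z + 1]. Each gap is contained in its window,
        so the gap terms integrate to at most \<open>TT z\<close>.\<close>
      have "(\<Sum>z\<in>Z. (LL z + TT z) * 2 + (\<Sum>i\<in>I z. \<beta> i powr p * (x (Suc (g z i)) - x (g z i)))) \<le>
          (\<Sum>z\<in>Z. (LL z + TT z) * 2 + TT z)"
      proof (intro sum_mono add_left_mono)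
        fix z assume z: "z \<in> Z"
        show "(\<Sum>i\<in>I z. \<beta> i powr p * (x (Suc (g z i)) - x (g z i))) \<le> TT z"
          unfolding TT_def
        proof (rule sum_mono)
          fix i assume i: "i \<in> I z"
          have "i + m \<le> n" using i ab[OF z] by (auto simp: I_def)
          then have "x i \<le> x (g z i)" "x (Suc (g z i)) \<le> x (i + m)"
            using D(3)[OF z, of i] by (auto intro!: xle)
          then show "\<beta> i powr p * (x (Suc (g z i)) - x (g z i)) \<le> (x (i + m) - x i) * \<beta> i powr p"
            by (subst mult.commute) (intro mult_right_mono, auto)
        qed
      qed
      also have "\<dots> \<le> (\<Sum>z\<in>Z. 3 * LL z + 3 * TT z)"
        using LLpos by (intro sum_mono) (simp add: algebra_simps)
      also have "\<dots> = 3 * (\<Sum>z\<in>Z. LL z) + 3 * (\<Sum>z\<in>Z. TT z)" by (simp add: sum.distrib sum_distrib_left)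
      also have "\<dots> \<le> 3 * (3 * (M * A) powr p) + 3 * (6 * A powr p)" using LLsum TTsum by simp
      also have "\<dots> \<le> 27 * (M * A) powr p"
      proof -
        have "A \<le> M * A" using M A mult_right_mono[of 1 M A] by simp
        then have "A powr p \<le> (M * A) powr p" using A p by (intro powr_mono2) auto
        then show ?thesis by simp
      qed
      also have "\<dots> \<le> 27 powr p * (M * A) powr p" using p powr_mono[of 1 p 27] by (intro mult_right_mono) auto
      finally have le: "(\<Sum>z\<in>Z. (LL z + TT z) * 2 + (\<Sum>i\<in>I z. \<beta> i powr p * (x (Suc (g z i)) - x (g z i)))) \<le> 27 powr p * (M * A) powr p" .
      let ?c = "(12 * real m * K1) powr p"
      have Rpos: "0 \<le> R t" for t
        unfolding R_def using LLpos TTpos GGpos by (intro sum_nonneg add_nonneg_nonneg mult_nonneg_nonneg) auto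
      have "(\<integral>\<^sup>+ t. ennreal (\<bar>F k t\<bar> powr p) \<partial>lborel) \<le> (\<integral>\<^sup>+ t. ennreal (?c * R t) \<partial>lborel)"
        using point unfolding R_def by (intro nn_integral_mono ennreal_leI) 
      also have "\<dots> = ennreal (\<integral>t. ?c * R t \<partial>lborel)"
        using hb Rpos by (intro nn_integral_eq_integral) (auto simp: has_bochner_integral_iff)
      also have "(\<integral>t. ?c * R t \<partial>lborel) = ?c * (\<Sum>z\<in>Z. (LL z + TT z) * 2 + (\<Sum>i\<in>I z. \<beta> i powr p * (x (Suc (g z i)) - x (g z i))))"
        using hb by (simp add: has_bochner_integral_iff)
      also have "ennreal \<dots> \<le> ennreal (?c * (27 powr p * (M * A) powr p))"
        using le by (intro ennreal_leI mult_left_mono) auto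
      also have "?c * (27 powr p * (M * A) powr p) = (K * A) powr p"
      proof -
        have KA: "K * A = (12 * real m * K1) * (27 * (M * A))" by (simp add: K_def)
        have "(27 * (M * A)) powr p = 27 powr p * (M * A) powr p"
          by (rule powr_mult)
        moreover have "((12 * real m * K1) * (27 * (M * A))) powr p = ?c * (27 * (M * A)) powr p"
          by (rule powr_mult)
        ultimately show ?thesis unfolding KA by (simp only:)
      qed
      finally show "(\<integral>\<^sup>+ t. ennreal (\<bar>F k t\<bar> powr p) \<partial>lborel) \<le> ennreal ((K * A) powr p)" .
    qed
  qed
qed

section \<open>Necessity\<close>

definition Lint :: "real \<Rightarrow> real set \<Rightarrow> (real \<Rightarrow> real) \<Rightarrow> real" where
  "Lint p S g = (LINT t|lebesgue. indicator S t * \<bar>g t\<bar> powr p)"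

lemma Lint_integrable:
  assumes "g \<in> Lp_space p" "S \<in> sets lebesgue"
  shows "integrable lebesgue (\<lambda>t. indicator S t * \<bar>g t\<bar> powr p)"
proof -
  have "integrable lebesgue (\<lambda>t. \<bar>g t\<bar> powr p)" using assms(1) by (simp add: Lp_space_def)
  from integrable_real_mult_indicator[OF assms(2) this] show ?thesis by (simp add: mult.commute)
qed

lemma Lint_nonneg: "0 \<le> Lint p S g"
  unfolding Lint_def by (intro Bochner_Integration.integral_nonneg) simp

lemma Lint_mono:
  assumes "g \<in> Lp_space p" "S \<in> sets lebesgue" "T \<in> sets lebesgue" "S \<subseteq> T"
  shows "Lint p S g \<le> Lint p T g"
  unfolding Lint_def
  by (rule integral_mono[OF Lint_integrable[OF assms(1,2)] Lint_integrable[OF assms(1,3)]])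
    (use assms(4) in \<open>auto simp: indicator_def\<close>)

lemma Lint_UNIV: "p > 1 \<Longrightarrow> Lint p UNIV g = Lp_norm p g powr p"
  unfolding Lint_def Lp_norm_def by (simp add: powr_powr Bochner_Integration.integral_nonneg)

text \<open>Hoelder's inequality, by integrating \<open>powr_tangent\<close> at the mean value of
  |g|. The first claim, from |g| <= 1 + |g|^p, passes to the gauge integral, in which the increment
  bounds are stated.\<close>

lemma Lp_power_mean:
  assumes p: "p > 1" and g: "g \<in> Lp_space p" and S: "S \<in> lmeasurable"
  shows "(\<lambda>t. \<bar>g t\<bar>) integrable_on S"
    "integral S (\<lambda>t. \<bar>g t\<bar>) powr p \<le> measure lebesgue S powr (p - 1) * Lint p S g"
proof -
  have Sm: "S \<in> sets lebesgue" using S by (rule fmeasurableD)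
  have gm: "g \<in> borel_measurable lebesgue" using g by (simp add: Lp_space_def)
  let ?L = "measure lebesgue S"
  have iS: "integrable lebesgue (indicat_real S)" using S by (intro integrable_real_indicator) (auto simp: fmeasurable_def)
  have ip: "integrable lebesgue (\<lambda>t. indicat_real S t * \<bar>g t\<bar> powr p)" by (rule Lint_integrable[OF g Sm])
  have i1: "integrable lebesgue (\<lambda>t. indicat_real S t * \<bar>g t\<bar>)"
  proof (rule Bochner_Integration.integrable_bound[OF Bochner_Integration.integrable_add[OF iS ip]])
    show "(\<lambda>t. indicat_real S t * \<bar>g t\<bar>) \<in> borel_measurable lebesgue" using gm Sm by measurable
    have "\<bar>g t\<bar> \<le> 1 + \<bar>g t\<bar> powr p" for t
    proof (cases "\<bar>g t\<bar> \<le> 1")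
      case True
      then show ?thesis using powr_ge_zero[of "\<bar>g t\<bar>" p] by linarith
    next
      case False
      then have "\<bar>g t\<bar> powr 1 \<le> \<bar>g t\<bar> powr p" using p by (intro powr_mono) auto
      then show ?thesis using False by simp
    qed
    then show "AE t in lebesgue. norm (indicat_real S t * \<bar>g t\<bar>) \<le> norm (indicat_real S t + indicat_real S t * \<bar>g t\<bar> powr p)"
      by (auto simp: indicator_def)
  qed
  have si: "set_integrable lebesgue S (\<lambda>t. \<bar>g t\<bar>)" using i1 by (simp add: set_integrable_def)
  show "(\<lambda>t. \<bar>g t\<bar>) integrable_on S" by (rule set_lebesgue_integral_eq_integral(1)[OF si])
  have eq: "integral S (\<lambda>t. \<bar>g t\<bar>) = (LINT t|lebesgue. indicat_real S t * \<bar>g t\<bar>)"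
    using set_lebesgue_integral_eq_integral(2)[OF si] by (simp add: set_lebesgue_integral_def)
  let ?X = "integral S (\<lambda>t. \<bar>g t\<bar>)"
  have X: "0 \<le> ?X" unfolding eq by (intro Bochner_Integration.integral_nonneg) simp
  show "?X powr p \<le> ?L powr (p - 1) * Lint p S g"
  proof (cases "?L = 0")
    case True
    then have "negligible S" using S negligible_iff_measure by blast
    then have "?X = 0" by (rule integral_negligible) 
    then show ?thesis using Lint_nonneg by simp
  next
    case False
    then have L: "?L > 0" by (simp add: less_le)
    define c where "c = ?X / ?L"
    have c: "c \<ge> 0" using X L by (simp add: c_def)
    have Xc: "?X = ?L * c" using L by (simp add: c_def)
    have "(LINT t|lebesgue. (c powr p - p * c powr (p - 1) * c) * indicat_real S t + p * c powr (p - 1) * (indicat_real S t * \<bar>g t\<bar>))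
        \<le> Lint p S g"
      unfolding Lint_def
    proof (rule integral_mono[OF _ ip])
      show "integrable lebesgue (\<lambda>t. (c powr p - p * c powr (p - 1) * c) * indicat_real S t + p * c powr (p - 1) * (indicat_real S t * \<bar>g t\<bar>))"
        using iS i1 by simp
      show "(c powr p - p * c powr (p - 1) * c) * indicat_real S t + p * c powr (p - 1) * (indicat_real S t * \<bar>g t\<bar>)
          \<le> indicat_real S t * \<bar>g t\<bar> powr p" for t
        using powr_tangent[OF p abs_ge_zero[of "g t"] c] by (simp add: indicator_def algebra_simps)
    qed
    also have "(LINT t|lebesgue. (c powr p - p * c powr (p - 1) * c) * indicat_real S t + p * c powr (p - 1) * (indicat_real S t * \<bar>g t\<bar>))
        = (c powr p - p * c powr (p - 1) * c) * ?L + p * c powr (p - 1) * ?X"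
      unfolding eq using iS i1 S by simp
    also have "\<dots> = ?L * c powr p" unfolding Xc by (simp add: algebra_simps)
    finally have 1: "?L * c powr p \<le> Lint p S g" .
    have "?X powr p = ?L powr p * c powr p" unfolding Xc by (rule powr_mult)
    also have "?L powr p = ?L powr (p - 1) * ?L" using powr_pred_mult[of ?L p] L by simp
    also have "?L powr (p - 1) * ?L * c powr p = ?L powr (p - 1) * (?L * c powr p)" by simp
    also have "\<dots> \<le> ?L powr (p - 1) * Lint p S g" using 1 by (rule mult_left_mono) simp
    finally show ?thesis .
  qed
qed

text \<open>|G \<xi>| is at most |G y| plus the integral of |v|, and this is averaged over y in
  [a, b]. The assumption b - a <= 1 absorbs the power of the length in the second term.\<close>

lemma Lp_pointwise_bound:
  assumes p: "p > 1" and G: "G \<in> Lp_space p" and v: "v \<in> Lp_space p"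
    and ftc: "\<And>s t. s \<le> t \<Longrightarrow> \<bar>G t - G s\<bar> \<le> integral {s..t} (\<lambda>t. \<bar>v t\<bar>)"
    and L: "a < b" "b - a \<le> 1" and \<xi>: "\<xi> \<in> {a..b}"
  shows "(b - a) * \<bar>G \<xi>\<bar> powr p \<le> 2 powr p * (Lint p {a..b} G + Lint p {a..b} v)"
proof -
  let ?L = "b - a" and ?I = "integral {a..b} (\<lambda>t. \<bar>v t\<bar>)" and ?X = "integral {a..b} (\<lambda>t. \<bar>G t\<bar>)"
  have m: "{s..t} \<in> lmeasurable" for s t :: real by simp
  note pmG = Lp_power_mean[OF p G m] and pmv = Lp_power_mean[OF p v m]
  have I: "integral {s..t} (\<lambda>t. \<bar>v t\<bar>) \<le> ?I" if "a \<le> s" "t \<le> b" for s t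
    by (rule integral_subset_le) (use that pmv(1) in auto)
  have near: "\<bar>G \<xi>\<bar> \<le> \<bar>G y\<bar> + ?I" if "y \<in> {a..b}" for y
  proof (cases "y \<le> \<xi>")
    case True
    then show ?thesis using ftc[OF True] I[of y \<xi>] that \<xi> by simp
  next
    case False
    then show ?thesis using ftc[of \<xi> y] I[of \<xi> y] that \<xi> by simp
  qed
  have "integral {a..b} (\<lambda>y. \<bar>G \<xi>\<bar> - ?I) \<le> ?X"
    by (rule integral_le[OF integrable_const_ivl pmG(1)]) (use near in force)
  then have 1: "?L * \<bar>G \<xi>\<bar> \<le> ?X + ?L * ?I" using L by (simp add: algebra_simps)
  have X0: "0 \<le> ?X" "0 \<le> ?I" by (intro Henstock_Kurzweil_Integration.integral_nonneg pmG(1) pmv(1), simp)+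
  have "(?L * \<bar>G \<xi>\<bar>) powr p \<le> (1 * ?X + 1 * (?L * ?I)) powr p" using 1 L p by (intro powr_mono2) auto
  also have "\<dots> = (\<Sum>i<2::nat. (if i = 0 then ?X else ?L * ?I)) powr p" by (simp add: numeral_2_eq_2)
  also have "\<dots> \<le> real 2 powr p * (\<Sum>i<2::nat. (if i = 0 then ?X else ?L * ?I) powr p)"
    using X0 L by (intro powr_sum_le[OF p, where J = "{..<2}"]) auto
  also have "(\<Sum>i<2::nat. (if i = 0 then ?X else ?L * ?I) powr p) = ?X powr p + (?L * ?I) powr p"
    by (simp add: numeral_2_eq_2)
  also have "(?L * ?I) powr p = ?L powr p * ?I powr p" by (rule powr_mult)
  also have "?L powr p * ?I powr p \<le> 1 * ?I powr p"
    using L p powr_mono2[of p ?L 1] by (intro mult_right_mono) auto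
  also have "?X powr p + 1 * ?I powr p \<le> ?L powr (p - 1) * Lint p {a..b} G + ?L powr (p - 1) * Lint p {a..b} v"
    using pmG(2)[of a b] pmv(2)[of a b] L by simp
  finally have "(?L * \<bar>G \<xi>\<bar>) powr p \<le> 2 powr p * (?L powr (p - 1) * (Lint p {a..b} G + Lint p {a..b} v))"
    by (simp add: distrib_left)
  moreover have "(?L * \<bar>G \<xi>\<bar>) powr p = ?L powr (p - 1) * (?L * \<bar>G \<xi>\<bar> powr p)"
    using powr_pred_mult[of ?L p] L by (simp add: powr_mult)
  ultimately have "?L powr (p - 1) * (?L * \<bar>G \<xi>\<bar> powr p) \<le> ?L powr (p - 1) * (2 powr p * (Lint p {a..b} G + Lint p {a..b} v))"
    by (simp add: mult.left_commute)
  then show ?thesis using L by (simp only: mult_le_cancel_left_pos powr_gt_zero)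
qed

lemma sobolev_chain:
  assumes "F \<in> sobolev m p"
  shows "deriv_chain (m - 1) (\<lambda>k. (deriv ^^ k) F)"
  using assms unfolding deriv_chain_def sobolev_def hom_sobolev_def
  by (auto simp: DERIV_deriv_iff_real_differentiable)

text \<open>Below order m - 1 this is the fundamental theorem of calculus; at order m - 1 the next
  derivative exists only almost everywhere, and \<open>ac_increment_bound\<close> takes
  over.\<close>

lemma sobolev_increment_bound:
  assumes p: "p > 1" and F: "F \<in> sobolev m p" and k: "k < m" and st: "s \<le> t"
  shows "\<bar>(deriv ^^ k) F t - (deriv ^^ k) F s\<bar> \<le> integral {s..t} (\<lambda>y. \<bar>(deriv ^^ Suc k) F y\<bar>)"
proof -
  let ?u = "(deriv ^^ k) F" and ?v = "(deriv ^^ Suc k) F"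
  have v: "?v \<in> Lp_space p" using F k by (simp add: sobolev_def del: funpow.simps)
  have vi: "(\<lambda>y. \<bar>?v y\<bar>) integrable_on {s..t}" by (rule Lp_power_mean(1)[OF p v]) simp
  show ?thesis
  proof (cases "k < m - 1")
    case True
    have der: "(?u has_real_derivative ?v y) (at y)" for y
      using deriv_chainD[OF sobolev_chain[OF F] True] .
    have "(?v has_integral ?u t - ?u s) {s..t}"
      using der by (intro fundamental_theorem_of_calculus[OF st])
        (simp add: has_real_derivative_iff_has_vector_derivative[symmetric] has_field_derivative_at_within)
    then have "?v integrable_on {s..t}" "integral {s..t} ?v = ?u t - ?u s" by blast+
    then show ?thesis using integral_norm_bound_integral[of ?v "{s..t}" "\<lambda>y. \<bar>?v y\<bar>"] vi by simp
  next
    case False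
    then have km: "k = m - 1" using k by simp
    have ac: "abs_continuous_on {s..t} ?u"
      using F unfolding sobolev_def hom_sobolev_def locally_abs_continuous_def km by blast
    let ?N = "{x \<in> {s<..<t}. \<not> ?u differentiable (at x)} \<union> {s, t}"
    have "negligible ?N" by (intro negligible_Un ac_differentiable_ae[OF ac]) simp
    then show ?thesis
    proof (rule ac_increment_bound[OF ac st _ _ vi])
      fix x assume "x \<in> {s..t} - ?N"
      then have "?u differentiable (at x)" by auto
      then show "(?u has_real_derivative ?v x) (at x)" by (simp add: DERIV_deriv_iff_real_differentiable)
    qed
  qed
qed

section \<open>Bounds for single windows and their summation\<close>

text \<open>The interval [a, b] is kept apart from the points for two reasons: the weight of a
  window of order k depends on x (i + m), beyond its last point, and both shorter windows of the
  recursion can keep the same [a, b]. When the points spread over more than 1, division by their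
  distance costs nothing, and a factor 4 per order covers the sum of two terms.\<close>

lemma lower_order_window_bound:
  assumes p: "p > 1" and F: "F \<in> sobolev m p" and k: "k < m"
    and x: "strict_mono_on {i..i + k} x" and ab: "a < b" "a \<le> x i" "x (i + k) \<le> b"
  shows "min 1 (b - a) * \<bar>divided_difference F (x ` {i..i + k})\<bar> powr p \<le>
    (2 * 4 ^ k) powr p * (\<Sum>j\<le>m. Lint p {a..b} ((deriv ^^ j) F))"
  using k x ab
proof (induction k arbitrary: i a b)
  let ?u = "\<lambda>k. (deriv ^^ k) F"
  let ?\<Phi> = "\<lambda>a b. \<Sum>j\<le>m. Lint p {a..b} (?u j)"
  have uL: "?u j \<in> Lp_space p" if "j \<le> m" for j using F that by (simp add: sobolev_def)
  have short: "(b - a) * \<bar>divided_difference F (x ` {i..i + k})\<bar> powr p \<le> 2 powr p * ?\<Phi> a b"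
    if k: "k < m" and x: "strict_mono_on {i..i + k} x" and ab: "a < b" "b - a \<le> 1" "a \<le> x i" "x (i + k) \<le> b" for i k a b
  proof -
    obtain \<xi> where \<xi>: "\<xi> \<in> {x i..x (i + k)}" "divided_difference (?u 0) (x ` {i..i + k}) = ?u k \<xi> / fact k"
      using divided_difference_mean_value[OF deriv_chain_mono[OF sobolev_chain[OF F]] x] k by fastforce
    have "\<bar>divided_difference F (x ` {i..i + k})\<bar> \<le> \<bar>?u k \<xi>\<bar>"
    proof -
      have "\<bar>?u k \<xi>\<bar> / fact k \<le> \<bar>?u k \<xi>\<bar> / 1" by (intro divide_left_mono fact_ge_1) auto
      then show ?thesis using \<xi>(2) by (simp add: abs_divide)
    qed
    then have "(b - a) * \<bar>divided_difference F (x ` {i..i + k})\<bar> powr p \<le> (b - a) * \<bar>?u k \<xi>\<bar> powr p"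
      using p ab by (intro mult_left_mono powr_mono2) auto
    also have "\<dots> \<le> 2 powr p * (Lint p {a..b} (?u k) + Lint p {a..b} (?u (Suc k)))"
      by (rule Lp_pointwise_bound[OF p uL uL sobolev_increment_bound[OF p F k] ab(1,2)])
        (use k \<xi> ab in auto)
    also have "Lint p {a..b} (?u k) + Lint p {a..b} (?u (Suc k)) = (\<Sum>j\<in>{k, Suc k}. Lint p {a..b} (?u j))" by simp
    also have "\<dots> \<le> ?\<Phi> a b"
      using k Lint_nonneg by (intro sum_mono2) auto
    finally show ?thesis by (simp add: mult_left_mono)
  qed
  have \<Phi>mono: "?\<Phi> s t \<le> ?\<Phi> a b" if "a \<le> s" "t \<le> b" for s t a b
    by (intro sum_mono Lint_mono uL) (use that in auto)
  have \<Phi>0: "0 \<le> ?\<Phi> a b" for a b by (intro sum_nonneg Lint_nonneg)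
  have main: "min 1 (b - a) * \<bar>divided_difference F (x ` {i..i + k})\<bar> powr p \<le> (2 * 4 ^ k) powr p * ?\<Phi> a b"
    if k: "k < m" and x: "strict_mono_on {i..i + k} x" and ab: "a < b" "a \<le> x i" "x (i + k) \<le> b"
      and len: "b - a \<le> 1 \<or> x (i + k) - x i \<le> 1" for i k a b
  proof -
    have c: "2 powr p \<le> (2 * 4 ^ k) powr p" using p by (intro powr_mono2) auto
    show ?thesis
    proof (cases "b - a \<le> 1")
      case True
      have "(b - a) * \<bar>divided_difference F (x ` {i..i + k})\<bar> powr p \<le> 2 powr p * ?\<Phi> a b"
        by (rule short[OF k x ab(1) True ab(2,3)])
      also have "\<dots> \<le> (2 * 4 ^ k) powr p * ?\<Phi> a b" by (rule mult_right_mono[OF c \<Phi>0])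
      finally show ?thesis using True by (simp add: min_def)
    next
      case False
      \<comment> \<open>[s, s + 1] is a unit interval inside [a, b] that contains all points of the
        window.\<close>
      define s where "s = min (x i) (b - 1)"
      have s: "a \<le> s" "s + 1 \<le> b" "s \<le> x i" "x (i + k) \<le> s + 1"
        using ab len False by (auto simp: s_def)
      have "(s + 1 - s) * \<bar>divided_difference F (x ` {i..i + k})\<bar> powr p \<le> 2 powr p * ?\<Phi> s (s + 1)"
        by (rule short[OF k x _ _ s(3,4)]) simp_all
      also have "\<dots> \<le> (2 * 4 ^ k) powr p * ?\<Phi> a b"
        by (rule mult_mono[OF c \<Phi>mono[OF s(1,2)] _ \<Phi>0]) simp
      finally show ?thesis using False by simp
    qed
  qed
  {
    case 0
    then show ?case using main[of 0 i a b] by simp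
  next
    case (Suc k)
    show ?case
    proof (cases "b - a \<le> 1 \<or> x (i + Suc k) - x i \<le> 1")
      case True
      then show ?thesis using main[OF Suc.prems] by blast
    next
      case False
      let ?d = "\<lambda>i k. divided_difference F (x ` {i..i + k})"
      have inj: "inj_on x {i..i + Suc k}" using Suc.prems(2) by (rule strict_mono_on_imp_inj_on)
      have x1: "strict_mono_on {Suc i..Suc i + k} x" and x2: "strict_mono_on {i..i + k} x"
        by (rule monotone_on_subset[OF Suc.prems(2)], simp)+
      have lt: "x i < x (Suc i)" "x (i + k) < x (i + Suc k)"
        using strict_mono_onD[OF Suc.prems(2), of i "Suc i"] strict_mono_onD[OF Suc.prems(2), of "i + k" "i + Suc k"] by auto
      have I1: "\<bar>?d (Suc i) k\<bar> powr p \<le> (2 * 4 ^ k) powr p * ?\<Phi> a b"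
        using Suc.IH[OF _ x1 Suc.prems(3)] Suc.prems lt False by simp
      have I2: "\<bar>?d i k\<bar> powr p \<le> (2 * 4 ^ k) powr p * ?\<Phi> a b"
        using Suc.IH[OF _ x2 Suc.prems(3,4)] Suc.prems lt False by simp
      have "1 * \<bar>?d i (Suc k)\<bar> \<le> (x (i + Suc k) - x i) * \<bar>?d i (Suc k)\<bar>"
        using False by (intro mult_right_mono) auto
      also have "\<dots> = \<bar>(x (i + Suc k) - x i) * ?d i (Suc k)\<bar>" using False by (simp add: abs_mult)
      also have "\<dots> = \<bar>?d (Suc i) k - ?d i k\<bar>" by (simp only: divided_difference_step[OF inj])
      also have "\<dots> \<le> \<bar>?d (Suc i) k\<bar> + \<bar>?d i k\<bar>" by (rule abs_triangle_ineq4)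
      also have "\<dots> \<le> 2 * max \<bar>?d (Suc i) k\<bar> \<bar>?d i k\<bar>" by simp
      finally have "\<bar>?d i (Suc k)\<bar> \<le> 2 * max \<bar>?d (Suc i) k\<bar> \<bar>?d i k\<bar>" by simp
      then have "\<bar>?d i (Suc k)\<bar> powr p \<le> (2 * max \<bar>?d (Suc i) k\<bar> \<bar>?d i k\<bar>) powr p"
        using p by (intro powr_mono2) auto
      also have "\<dots> = 2 powr p * max \<bar>?d (Suc i) k\<bar> \<bar>?d i k\<bar> powr p" by (rule powr_mult)
      also have "\<dots> \<le> 2 powr p * ((2 * 4 ^ k) powr p * ?\<Phi> a b)"
        using I1 I2 by (intro mult_left_mono) (auto simp: max_def)
      also have "\<dots> = (2 * (2 * 4 ^ k)) powr p * ?\<Phi> a b" by (simp only: powr_mult[of 2 "2 * 4 ^ k"] mult.assoc)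
      also have "\<dots> \<le> (2 * 4 ^ Suc k) powr p * ?\<Phi> a b"
        using p \<Phi>0 by (intro mult_right_mono powr_mono2) auto
      finally show ?thesis using False by simp
    qed
  }
qed

text \<open>With D the window length and d the difference, the recursion and the mean value theorem
  write D d as an increment of F^(m-1) divided by (m - 1)!. Hoelder's inequality then bounds (D
  |d|)^p by D^(p-1) times the integral over the window; what remains is exactly one factor D, the
  weight before it is cut off at 1.\<close>

lemma top_order_window_bound:
  assumes m: "m \<ge> 1" and p: "p > 1" and F: "F \<in> sobolev m p" and x: "strict_mono_on {i..i + m} x"
  shows "(x (i + m) - x i) * \<bar>divided_difference F (x ` {i..i + m})\<bar> powr p \<le> Lint p {x i..x (i + m)} ((deriv ^^ m) F)"
proof -
  let ?u = "\<lambda>k. (deriv ^^ k) F"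
  obtain k where k: "m = Suc k" using m by (cases m) auto
  let ?d = "\<lambda>i k. divided_difference F (x ` {i..i + k})"
  let ?D = "x (i + m) - x i" and ?I = "integral {x i..x (i + m)} (\<lambda>y. \<bar>?u m y\<bar>)"
  have uL: "?u m \<in> Lp_space p" using F by (simp add: sobolev_def)
  have D: "?D > 0" using strict_mono_onD[OF x, of i "i + m"] m by simp
  have inj: "inj_on x {i..i + Suc k}" using x k strict_mono_on_imp_inj_on by blast
  have x1: "strict_mono_on {Suc i..Suc i + k} x" and x2: "strict_mono_on {i..i + k} x"
    by (rule monotone_on_subset[OF x], simp add: k)+
  have ch: "deriv_chain k ?u" using sobolev_chain[OF F] k by simp
  obtain \<xi>1 where \<xi>1: "\<xi>1 \<in> {x (Suc i)..x (Suc i + k)}" "?d (Suc i) k = ?u k \<xi>1 / fact k"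
    using divided_difference_mean_value[OF ch x1] by auto
  obtain \<xi>2 where \<xi>2: "\<xi>2 \<in> {x i..x (i + k)}" "?d i k = ?u k \<xi>2 / fact k"
    using divided_difference_mean_value[OF ch x2] by auto
  have xx: "x i \<le> x (Suc i)" "x (i + k) \<le> x (i + m)"
    using strict_mono_onD[OF x, of i "Suc i"] strict_mono_onD[OF x, of "i + k" "i + m"] k by auto
  have in1: "\<xi>1 \<in> {x i..x (i + m)}" "\<xi>2 \<in> {x i..x (i + m)}" using \<xi>1 \<xi>2 xx k by auto
  have vi: "(\<lambda>y. \<bar>?u m y\<bar>) integrable_on {s..t}" for s t by (rule Lp_power_mean(1)[OF p uL]) simp
  have inc: "\<bar>?u k t - ?u k s\<bar> \<le> ?I" if "s \<le> t" "s \<in> {x i..x (i + m)}" "t \<in> {x i..x (i + m)}" for s t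
  proof -
    have "\<bar>?u k t - ?u k s\<bar> \<le> integral {s..t} (\<lambda>y. \<bar>?u m y\<bar>)"
      using sobolev_increment_bound[OF p F _ that(1), of k] k by simp
    also have "\<dots> \<le> ?I" by (rule integral_subset_le) (use that vi in auto)
    finally show ?thesis .
  qed
  have "\<bar>?u k \<xi>1 - ?u k \<xi>2\<bar> \<le> ?I"
    using inc[of \<xi>1 \<xi>2] inc[of \<xi>2 \<xi>1] in1 by (cases "\<xi>1 \<le> \<xi>2") (simp_all add: abs_minus_commute)
  moreover have "?D * ?d i m = (?u k \<xi>1 - ?u k \<xi>2) / fact k"
    using divided_difference_step[OF inj, of F] \<xi>1 \<xi>2 unfolding k by (simp add: diff_divide_distrib)
  moreover have "\<bar>(?u k \<xi>1 - ?u k \<xi>2) / fact k\<bar> \<le> \<bar>?u k \<xi>1 - ?u k \<xi>2\<bar> / 1"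
    unfolding abs_divide by (rule divide_left_mono) (auto simp: fact_ge_1)
  ultimately have "\<bar>?D * ?d i m\<bar> \<le> ?I" by simp
  then have "?D * \<bar>?d i m\<bar> \<le> ?I" using D by (simp add: abs_mult)
  then have "(?D * \<bar>?d i m\<bar>) powr p \<le> ?I powr p" using D p by (intro powr_mono2) auto
  also have "\<dots> \<le> measure lebesgue {x i..x (i + m)} powr (p - 1) * Lint p {x i..x (i + m)} (?u m)"
    by (rule Lp_power_mean(2)[OF p uL]) simp
  also have "measure lebesgue {x i..x (i + m)} = ?D" using D by simp
  also have "(?D * \<bar>?d i m\<bar>) powr p = ?D powr (p - 1) * (?D * \<bar>?d i m\<bar> powr p)"
    using powr_pred_mult[of ?D p] D by (simp add: powr_mult)
  finally show ?thesis using D by (simp only: mult_le_cancel_left_pos powr_gt_zero)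
qed

lemma Lint_windows_sum:
  assumes g: "g \<in> Lp_space p" and x: "strict_mono_on {..n} x"
  shows "(\<Sum>i | i + m \<le> n. Lint p {x i..x (i + m)} g) \<le> (real m + 1) * Lint p UNIV g"
proof -
  let ?I = "{i. i + m \<le> n}"
  have fin: "finite ?I" by (rule finite_subset[of _ "{..n}"]) auto
  have xle: "x i < x j" if "i < j" "j \<le> n" for i j using strict_mono_onD[OF x, of i j] that by simp
  have int: "integrable lebesgue (\<lambda>t. indicator {x i..x (i + m)} t * \<bar>g t\<bar> powr p)" for i
    by (rule Lint_integrable[OF g]) simp
  have "(\<Sum>i\<in>?I. Lint p {x i..x (i + m)} g) = (LINT t|lebesgue. (\<Sum>i\<in>?I. indicator {x i..x (i + m)} t * \<bar>g t\<bar> powr p))"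
    unfolding Lint_def by (rule Bochner_Integration.integral_sum[symmetric]) (rule int)
  also have "\<dots> \<le> (LINT t|lebesgue. (real m + 1) * (indicator UNIV t * \<bar>g t\<bar> powr p))"
  proof (rule integral_mono)
    show "integrable lebesgue (\<lambda>t. \<Sum>i\<in>?I. indicator {x i..x (i + m)} t * \<bar>g t\<bar> powr p)"
      by (rule Bochner_Integration.integrable_sum) (rule int)
    show "integrable lebesgue (\<lambda>t. (real m + 1) * (indicator UNIV t * \<bar>g t\<bar> powr p))"
      using Lint_integrable[OF g, of UNIV] by simp
    fix t
    let ?J = "{i \<in> ?I. t \<in> {x i..x (i + m)}}"
    \<comment> \<open>The windows are closed: a common end point of windows i and i + m belongs to m
      + 1 of them.\<close>
    have "card ?J \<le> m + 1"
    proof (cases "?J = {}")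
      case False
      define c where "c = Min ?J"
      have fJ: "finite ?J" using fin by simp
      have cJ: "c \<in> ?J" unfolding c_def by (rule Min_in[OF fJ False])
      have "?J \<subseteq> {c..c + m}"
      proof
        fix i assume i: "i \<in> ?J"
        have "c \<le> i" unfolding c_def by (rule Min_le[OF fJ i])
        moreover have "i \<le> c + m"
        proof (rule ccontr)
          assume "\<not> i \<le> c + m"
          then have "x (c + m) < x i" using i by (intro xle) auto
          then show False using i cJ by auto
        qed
        ultimately show "i \<in> {c..c + m}" by simp
      qed
      from card_mono[OF _ this] show ?thesis by simp
    next
      case True
      then show ?thesis by (simp only: card.empty)
    qed
    then have "real (card ?J) * \<bar>g t\<bar> powr p \<le> (real m + 1) * \<bar>g t\<bar> powr p" by (intro mult_right_mono) auto
    moreover have "(\<Sum>i\<in>?I. indicat_real {x i..x (i + m)} t) = (\<Sum>i\<in>?I. if t \<in> {x i..x (i + m)} then 1 else 0)"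
      by (intro sum.cong) (auto simp: indicator_def)
    then have "(\<Sum>i\<in>?I. indicat_real {x i..x (i + m)} t) = real (card ?J)"
      using fin by (simp add: sum.If_cases Int_def)
    ultimately show "(\<Sum>i\<in>?I. indicator {x i..x (i + m)} t * \<bar>g t\<bar> powr p) \<le> (real m + 1) * (indicator UNIV t * \<bar>g t\<bar> powr p)"
      by (simp flip: sum_distrib_right)
  qed
  also have "\<dots> = (real m + 1) * Lint p UNIV g" by (simp add: Lint_def)
  finally show ?thesis .
qed

text \<open>For each order k the windows with i + m <= n are summed by bounded overlap, while the at
  most m remaining starts are bounded one by one by the full norm: (m + 1) + m = 2 m + 1. The other
  two factors m + 1 count the orders k and the norms of the derivatives.\<close>

lemma W_sum_le_sobolev_norm:
  assumes m: "m \<ge> 1" and p: "p > 1" and F: "F \<in> sobolev m p" and n: "m \<le> n" and x: "strict_mono_on {..n} x"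
  shows "W_sum m p n x F \<le> ((real m + 1) * (2 * real m + 1) * (real m + 1) * (2 * 4 ^ m) * sobolev_norm m p F) powr p"
proof -
  let ?u = "\<lambda>k. (deriv ^^ k) F"
  let ?K = "2 * 4 ^ m :: real"
  define \<Phi> where "\<Phi> S = (\<Sum>j\<le>m. Lint p S (?u j))" for S
  have uL: "?u j \<in> Lp_space p" if "j \<le> m" for j using F that by (simp add: sobolev_def)
  have \<Phi>mono: "\<Phi> {s..t} \<le> \<Phi> UNIV" for s t unfolding \<Phi>_def by (intro sum_mono Lint_mono uL) auto
  have \<Phi>0: "0 \<le> \<Phi> S" for S unfolding \<Phi>_def by (intro sum_nonneg Lint_nonneg)
  have "(1::real) \<le> 4 ^ m" by (rule one_le_power) simp
  then have "1 \<le> ?K" by linarith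
  then have K1: "1 \<le> ?K powr p" by (rule ge_one_powr_ge_zero) (use p in simp)
  have sub: "strict_mono_on {i..i + k} x" if "i + k \<le> n" for i k
    by (rule monotone_on_subset[OF x]) (use that in auto)
  have xlt: "x i < x j" if "i < j" "j \<le> n" for i j using strict_mono_onD[OF x, of i j] that by simp
  have xle: "x i \<le> x j" if "i \<le> j" "j \<le> n" for i j using xlt[of i j] that by (cases "i = j") auto
  let ?t = "\<lambda>k i. W_weight m n x i * \<bar>divided_difference F (x ` {i..i + k})\<bar> powr p"
  have Kk: "(2 * 4 ^ k) powr p \<le> ?K powr p" if "k \<le> m" for k
    using that p by (intro powr_mono2 mult_left_mono power_increasing) auto
  have full: "?t k i \<le> ?K powr p * \<Phi> {x i..x (i + m)}" if k: "k \<le> m" and i: "i + m \<le> n" for k i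
  proof (cases "k = m")
    case True
    have "?t m i \<le> (x (i + m) - x i) * \<bar>divided_difference F (x ` {i..i + m})\<bar> powr p"
      using i by (intro mult_right_mono) (simp_all add: W_weight_def)
    also have "\<dots> \<le> Lint p {x i..x (i + m)} (?u m)" by (rule top_order_window_bound[OF m p F sub[OF i]])
    also have "\<dots> \<le> \<Phi> {x i..x (i + m)}" unfolding \<Phi>_def by (rule member_le_sum) (auto simp: Lint_nonneg)
    also have "\<dots> \<le> ?K powr p * \<Phi> {x i..x (i + m)}" using mult_right_mono[OF K1 \<Phi>0] by simp
    finally show ?thesis using True by simp
  next
    case False
    then have km: "k < m" using k by simp
    have "min 1 (x (i + m) - x i) * \<bar>divided_difference F (x ` {i..i + k})\<bar> powr p \<le> (2 * 4 ^ k) powr p * \<Phi> {x i..x (i + m)}"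
      unfolding \<Phi>_def
    proof (rule lower_order_window_bound[OF p F km])
      show "strict_mono_on {i..i + k} x" by (rule sub) (use i km in simp)
      show "x i < x (i + m)" by (rule xlt) (use i m in auto)
      show "x (i + k) \<le> x (i + m)" by (rule xle) (use i km in auto)
    qed simp
    also have "\<dots> \<le> ?K powr p * \<Phi> {x i..x (i + m)}" by (rule mult_right_mono[OF Kk[OF k] \<Phi>0])
    finally show ?thesis using i by (simp add: W_weight_def)
  qed
  \<comment> \<open>Near the end the weight is 1 by the convention x_j = +infinity; the interval
    [x i, x n + 1] has length at least 1 and reproduces it.\<close>
  have tail: "?t k i \<le> ?K powr p * \<Phi> UNIV" if k: "k \<le> m" and i: "i \<le> n - k" "\<not> i + m \<le> n" for k i
  proof -
    have km: "k < m" and ik: "i + k \<le> n" using k i n by (cases "k = m"; simp)+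
    have "min 1 (x n + 1 - x i) * \<bar>divided_difference F (x ` {i..i + k})\<bar> powr p \<le> (2 * 4 ^ k) powr p * \<Phi> {x i..x n + 1}"
      unfolding \<Phi>_def
      by (rule lower_order_window_bound[OF p F km sub[OF ik]]) (use xle[of i n] xle[of "i + k" n] ik in auto)
    also have "\<dots> \<le> ?K powr p * \<Phi> UNIV" by (rule mult_mono[OF Kk[OF k] \<Phi>mono _ \<Phi>0]) simp
    finally show ?thesis using i xle[of i n] ik by (simp add: W_weight_def min_def split: if_splits)
  qed
  have row: "(\<Sum>i\<le>n - k. ?t k i) \<le> (2 * real m + 1) * (?K powr p * \<Phi> UNIV)" if k: "k \<le> m" for k
  proof -
    let ?A = "{i. i + m \<le> n}" and ?B = "{i. i \<le> n - k \<and> \<not> i + m \<le> n}"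
    have fA: "finite ?A" by (rule finite_subset[of _ "{..n}"]) auto
    have fB: "finite ?B" by (rule finite_subset[of _ "{..n}"]) auto
    have "{..n - k} = ?A \<union> ?B" using k n by auto
    moreover have "sum (?t k) (?A \<union> ?B) = sum (?t k) ?A + sum (?t k) ?B" by (rule sum.union_disjoint[OF fA fB]) auto
    moreover have "sum (?t k) ?A \<le> (\<Sum>i\<in>?A. ?K powr p * \<Phi> {x i..x (i + m)})" by (rule sum_mono) (use full[OF k] in simp)
    moreover have "(\<Sum>i\<in>?A. ?K powr p * \<Phi> {x i..x (i + m)}) \<le> ?K powr p * ((real m + 1) * \<Phi> UNIV)"
    proof -
      have "(\<Sum>i\<in>?A. \<Phi> {x i..x (i + m)}) = (\<Sum>j\<le>m. \<Sum>i\<in>?A. Lint p {x i..x (i + m)} (?u j))"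
        unfolding \<Phi>_def by (rule sum.swap)
      also have "\<dots> \<le> (\<Sum>j\<le>m. (real m + 1) * Lint p UNIV (?u j))"
        by (intro sum_mono Lint_windows_sum[OF uL x]) simp
      also have "\<dots> = (real m + 1) * \<Phi> UNIV" by (simp add: \<Phi>_def sum_distrib_left)
      finally show ?thesis by (simp add: sum_distrib_left[symmetric] mult_left_mono)
    qed
    moreover have "sum (?t k) ?B \<le> real m * (?K powr p * \<Phi> UNIV)"
    proof -
      have "sum (?t k) ?B \<le> real (card ?B) * (?K powr p * \<Phi> UNIV)"
        by (rule sum_bounded_above) (use tail[OF k] in simp)
      also have "card ?B \<le> m"
      proof -
        have "?B \<subseteq> {Suc n - m..<Suc n}" by auto
        from card_mono[OF _ this] show ?thesis by simp
      qed
      then have "real (card ?B) * (?K powr p * \<Phi> UNIV) \<le> real m * (?K powr p * \<Phi> UNIV)"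
        using \<Phi>0 by (intro mult_right_mono) auto
      finally show ?thesis .
    qed
    ultimately show ?thesis by (simp add: algebra_simps)
  qed
  have "W_sum m p n x F \<le> (\<Sum>k\<le>m. (2 * real m + 1) * (?K powr p * \<Phi> UNIV))"
    unfolding W_sum_def by (rule sum_mono) (use row in simp)
  also have "\<dots> = (real m + 1) * (2 * real m + 1) * (?K powr p * \<Phi> UNIV)" by simp
  also have "\<Phi> UNIV \<le> (real m + 1) * sobolev_norm m p F powr p"
  proof -
    have N0: "0 \<le> Lp_norm p g" for g unfolding Lp_norm_def by simp
    have "Lint p UNIV (?u j) \<le> sobolev_norm m p F powr p" if "j \<le> m" for j
      unfolding Lint_UNIV[OF p] sobolev_norm_def
    proof (rule powr_mono2)
      show "Lp_norm p (?u j) \<le> (\<Sum>k\<le>m. Lp_norm p (?u k))" by (rule member_le_sum) (use that N0 in auto)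
    qed (use N0 p in auto)
    then have "\<Phi> UNIV \<le> real (card {..m}) * sobolev_norm m p F powr p"
      unfolding \<Phi>_def by (intro sum_bounded_above) auto
    then show ?thesis by (simp add: algebra_simps)
  qed
  finally have "W_sum m p n x F \<le> (real m + 1) * (2 * real m + 1) * (?K powr p * ((real m + 1) * sobolev_norm m p F powr p))"
    by (simp add: mult_left_mono)
  also have "\<dots> = ((real m + 1) * (2 * real m + 1) * (real m + 1)) * (?K powr p * sobolev_norm m p F powr p)" by simp
  also have "\<dots> \<le> ((real m + 1) * (2 * real m + 1) * (real m + 1)) powr p * (?K powr p * sobolev_norm m p F powr p)"
  proof (rule mult_right_mono)
    have "1 * 1 * 1 \<le> (real m + 1) * (2 * real m + 1) * (real m + 1)" by (intro mult_mono) auto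
    then show "(real m + 1) * (2 * real m + 1) * (real m + 1) \<le> ((real m + 1) * (2 * real m + 1) * (real m + 1)) powr p"
      using p powr_mono[of 1 p "(real m + 1) * (2 * real m + 1) * (real m + 1)"] by simp
  qed simp
  also have "\<dots> = ((real m + 1) * (2 * real m + 1) * (real m + 1) * ?K * sobolev_norm m p F) powr p"
    by (simp only: powr_mult mult.assoc)
  finally show ?thesis .
qed

section \<open>Limits of extensions\<close>

lemma powr_le_imp_le:
  fixes a b p :: real
  assumes "a powr p \<le> b powr p" "p > 0" "b \<ge> 0" shows "a \<le> b"
proof (rule ccontr)
  assume "\<not> a \<le> b"
  then have "b powr p < a powr p" using assms by (intro powr_less_mono2) auto
  then show False using assms by simp
qed

lemma fatou_bound:
  fixes u :: "nat \<Rightarrow> 'a \<Rightarrow> ennreal"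
  assumes "\<And>n. u n \<in> borel_measurable M" "AE x in M. (\<lambda>n. u n x) \<longlonglongrightarrow> v x" "\<And>n. (\<integral>\<^sup>+ x. u n x \<partial>M) \<le> B"
  shows "(\<integral>\<^sup>+ x. v x \<partial>M) \<le> B"
proof -
  have "(\<integral>\<^sup>+ x. v x \<partial>M) = (\<integral>\<^sup>+ x. liminf (\<lambda>n. u n x) \<partial>M)"
    using assms(2) by (intro nn_integral_cong_AE) (auto elim!: eventually_mono dest!: lim_imp_Liminf[rotated])
  also have "\<dots> \<le> liminf (\<lambda>n. \<integral>\<^sup>+ x. u n x \<partial>M)" by (rule nn_integral_liminf[OF assms(1)])
  also have "\<dots> \<le> limsup (\<lambda>n. \<integral>\<^sup>+ x. u n x \<partial>M)" by (rule Liminf_le_Limsup) simp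
  also have "\<dots> \<le> B" by (rule Limsup_bounded) (simp add: assms(3))
  finally show ?thesis .
qed

lemma Lp_of_nn_integral:
  assumes p: "p > 1" and M: "M \<ge> 0" and g: "g \<in> borel_measurable lebesgue"
    and le: "(\<integral>\<^sup>+ t. ennreal (\<bar>g t\<bar> powr p) \<partial>lebesgue) \<le> ennreal (M powr p)"
  shows "g \<in> Lp_space p" "S \<in> sets lebesgue \<Longrightarrow> Lint p S g \<le> M powr p" "Lp_norm p g \<le> M"
proof -
  have int: "integrable lebesgue (\<lambda>t. \<bar>g t\<bar> powr p)"
  proof (rule integrableI_nonneg)
    show "(\<integral>\<^sup>+ t. ennreal (\<bar>g t\<bar> powr p) \<partial>lebesgue) < \<infinity>" using le by (simp add: order.strict_trans1)
  qed (use g in auto)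
  then show L: "g \<in> Lp_space p" using g by (simp add: Lp_space_def)
  have "ennreal (LINT t|lebesgue. \<bar>g t\<bar> powr p) \<le> ennreal (M powr p)"
    using nn_integral_eq_integral[OF int] le by simp
  then have le': "(LINT t|lebesgue. \<bar>g t\<bar> powr p) \<le> M powr p" by simp
  then show "Lint p S g \<le> M powr p" if "S \<in> sets lebesgue"
    using Lint_mono[OF L that, of UNIV] by (simp add: Lint_def)
  have "(LINT t|lebesgue. \<bar>g t\<bar> powr p) powr (1 / p) \<le> (M powr p) powr (1 / p)"
    using le' p by (intro powr_mono2) (auto intro: Bochner_Integration.integral_nonneg)
  also have "\<dots> = M" using p M by (simp add: powr_powr)
  finally show "Lp_norm p g \<le> M" by (simp add: Lp_norm_def)
qed

lemma chain_increment_bound: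
  assumes p: "p > 1" and D: "deriv_chain (Suc m) D" and L: "D (Suc k) \<in> Lp_space p" and k: "k \<le> m" and st: "s \<le> t"
  shows "\<bar>D k t - D k s\<bar> \<le> integral {s..t} (\<lambda>y. \<bar>D (Suc k) y\<bar>)"
proof -
  have vi: "(\<lambda>y. \<bar>D (Suc k) y\<bar>) integrable_on {s..t}" by (rule Lp_power_mean(1)[OF p L]) simp
  have "(D (Suc k) has_integral D k t - D k s) {s..t}"
    using deriv_chainD[OF D, of k] k by (intro fundamental_theorem_of_calculus[OF st])
      (simp add: has_real_derivative_iff_has_vector_derivative[symmetric] has_field_derivative_at_within)
  then have "D (Suc k) integrable_on {s..t}" "integral {s..t} (D (Suc k)) = D k t - D k s" by blast+
  then show ?thesis using integral_norm_bound_integral[of "D (Suc k)" "{s..t}" "\<lambda>y. \<bar>D (Suc k) y\<bar>"] vi by simp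
qed

section \<open>Difference quotients and moduli of continuity\<close>

lemma nn_integral_window:
  fixes \<psi> :: "real \<Rightarrow> ennreal"
  assumes "\<psi> \<in> borel_measurable borel" "h \<ge> 0"
  shows "(\<integral>\<^sup>+ x. (\<integral>\<^sup>+ t. \<psi> t * indicator {x..x + h} t \<partial>lborel) \<partial>lborel) = ennreal h * (\<integral>\<^sup>+ t. \<psi> t \<partial>lborel)"
proof -
  have eq: "\<psi> t * indicator {x..x + h} t = (if x \<le> t \<and> t \<le> x + h then \<psi> t else 0)" for x t
    by (simp add: indicator_def)
  have meas: "(\<lambda>(x, t). if x \<le> t \<and> t \<le> x + h then \<psi> t else 0) \<in> borel_measurable (lborel \<Otimes>\<^sub>M lborel)"
    using assms(1) by measurable
  have "(\<integral>\<^sup>+ x. (\<integral>\<^sup>+ t. \<psi> t * indicator {x..x + h} t \<partial>lborel) \<partial>lborel) =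
      (\<integral>\<^sup>+ t. (\<integral>\<^sup>+ x. (if x \<le> t \<and> t \<le> x + h then \<psi> t else 0) \<partial>lborel) \<partial>lborel)"
    unfolding eq by (rule lborel_pair.Fubini'[OF meas, symmetric])
  also have "\<dots> = (\<integral>\<^sup>+ t. (\<integral>\<^sup>+ x. \<psi> t * indicator {t - h..t} x \<partial>lborel) \<partial>lborel)"
    by (intro nn_integral_cong) (auto simp: indicator_def)
  also have "\<dots> = (\<integral>\<^sup>+ t. \<psi> t * ennreal h \<partial>lborel)"
    using assms(2) by (intro nn_integral_cong) (simp add: nn_integral_cmult_indicator)
  also have "\<dots> = ennreal h * (\<integral>\<^sup>+ t. \<psi> t \<partial>lborel)"
    using assms(1) by (subst nn_integral_multc) (simp_all add: mult.commute)
  finally show ?thesis .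
qed

text \<open>Hoelder's inequality on [x, x + h] leaves the average of |v|^p over that interval, and
  averaging preserves the integral. So the bound is \<open>M\<close> itself for every h, which lets
  h tend to 0 afterwards.\<close>

lemma difference_quotient_nn_integral:
  assumes p: "p > 1" and M: "M \<ge> 0" and h: "h > 0" and v: "v \<in> borel_measurable borel"
    and le: "(\<integral>\<^sup>+ t. ennreal (\<bar>v t\<bar> powr p) \<partial>lborel) \<le> ennreal (M powr p)"
    and inc: "\<And>x. \<bar>g (x + h) - g x\<bar> \<le> integral {x..x + h} (\<lambda>y. \<bar>v y\<bar>)"
  shows "(\<integral>\<^sup>+ x. ennreal (\<bar>(g (x + h) - g x) / h\<bar> powr p) \<partial>lborel) \<le> ennreal (M powr p)"
proof -
  have vl: "v \<in> borel_measurable lebesgue" using v by (simp add: measurable_completion)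
  have vL: "v \<in> Lp_space p"
    by (rule Lp_of_nn_integral(1)[OF p M vl]) (use le in \<open>simp add: nn_integral_completion\<close>)
  have "ennreal (\<bar>(g (x + h) - g x) / h\<bar> powr p) \<le>
      ennreal (1 / h) * (\<integral>\<^sup>+ t. ennreal (\<bar>v t\<bar> powr p) * indicator {x..x + h} t \<partial>lborel)" for x
  proof -
    let ?J = "Lint p {x..x + h} v"
    have "\<bar>g (x + h) - g x\<bar> powr p \<le> integral {x..x + h} (\<lambda>y. \<bar>v y\<bar>) powr p"
      using inc p by (intro powr_mono2) auto
    also have "\<dots> \<le> measure lebesgue {x..x + h} powr (p - 1) * ?J"
      by (rule Lp_power_mean(2)[OF p vL]) simp
    also have "measure lebesgue {x..x + h} = h" using h by simp
    finally have 1: "\<bar>g (x + h) - g x\<bar> powr p \<le> h powr (p - 1) * ?J" .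
    have "\<bar>(g (x + h) - g x) / h\<bar> powr p = \<bar>g (x + h) - g x\<bar> powr p / h powr p"
      using h by (simp add: abs_divide powr_divide)
    also have "\<dots> \<le> h powr (p - 1) * ?J / h powr p" using 1 by (rule divide_right_mono) simp
    also have "h powr p = h powr (p - 1) * h" using powr_pred_mult[of h p] h by simp
    also have "h powr (p - 1) * ?J / (h powr (p - 1) * h) = 1 / h * ?J" using h by simp
    finally have "ennreal (\<bar>(g (x + h) - g x) / h\<bar> powr p) \<le> ennreal (1 / h * ?J)" by (rule ennreal_leI)
    also have "\<dots> = ennreal (1 / h) * ennreal ?J" using h Lint_nonneg by (intro ennreal_mult) auto
    also have "ennreal ?J = (\<integral>\<^sup>+ t. ennreal (indicator {x..x + h} t * \<bar>v t\<bar> powr p) \<partial>lebesgue)"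
      unfolding Lint_def by (rule nn_integral_eq_integral[symmetric]) (use Lint_integrable[OF vL, of "{x..x + h}"] in auto)
    also have "\<dots> = (\<integral>\<^sup>+ t. ennreal (\<bar>v t\<bar> powr p) * indicator {x..x + h} t \<partial>lborel)"
      unfolding nn_integral_completion by (intro nn_integral_cong) (auto simp: indicator_def)
    finally show ?thesis .
  qed
  then have "(\<integral>\<^sup>+ x. ennreal (\<bar>(g (x + h) - g x) / h\<bar> powr p) \<partial>lborel) \<le>
      (\<integral>\<^sup>+ x. ennreal (1 / h) * (\<integral>\<^sup>+ t. ennreal (\<bar>v t\<bar> powr p) * indicator {x..x + h} t \<partial>lborel) \<partial>lborel)"
    by (intro nn_integral_mono)
  also have "\<dots> = ennreal (1 / h) * (\<integral>\<^sup>+ x. (\<integral>\<^sup>+ t. ennreal (\<bar>v t\<bar> powr p) * indicator {x..x + h} t \<partial>lborel) \<partial>lborel)"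
  proof (rule nn_integral_cmult)
    have "(\<lambda>(x, t). if x \<le> t \<and> t \<le> x + h then ennreal (\<bar>v t\<bar> powr p) else 0) \<in> borel_measurable (lborel \<Otimes>\<^sub>M lborel)"
      using v by measurable
    from lborel.borel_measurable_nn_integral_fst[OF this]
    have "(\<lambda>x. \<integral>\<^sup>+ t. (if x \<le> t \<and> t \<le> x + h then ennreal (\<bar>v t\<bar> powr p) else 0) \<partial>lborel) \<in> borel_measurable lborel" by simp
    moreover have "(if x \<le> t \<and> t \<le> x + h then ennreal (\<bar>v t\<bar> powr p) else 0) = ennreal (\<bar>v t\<bar> powr p) * indicator {x..x + h} t" for x t
      by (simp add: indicator_def)
    ultimately show "(\<lambda>x. \<integral>\<^sup>+ t. ennreal (\<bar>v t\<bar> powr p) * indicator {x..x + h} t \<partial>lborel) \<in> borel_measurable lborel" by simp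
  qed
  also have "(\<integral>\<^sup>+ x. (\<integral>\<^sup>+ t. ennreal (\<bar>v t\<bar> powr p) * indicator {x..x + h} t \<partial>lborel) \<partial>lborel) =
      ennreal h * (\<integral>\<^sup>+ t. ennreal (\<bar>v t\<bar> powr p) \<partial>lborel)"
    by (rule nn_integral_window) (use v h in auto)
  also have "ennreal (1 / h) * (ennreal h * (\<integral>\<^sup>+ t. ennreal (\<bar>v t\<bar> powr p) \<partial>lborel)) = (\<integral>\<^sup>+ t. ennreal (\<bar>v t\<bar> powr p) \<partial>lborel)"
    using h by (simp add: mult.assoc[symmetric] ennreal_mult[symmetric])
  also have "\<dots> \<le> ennreal (M powr p)" by (rule le)
  finally show ?thesis .
qed

lemma borel_measurable_lebesgue_spike:
  fixes f g :: "real \<Rightarrow> real"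
  assumes f: "f \<in> borel_measurable lebesgue" and N: "negligible N" and eq: "\<And>x. x \<notin> N \<Longrightarrow> g x = f x"
  shows "g \<in> borel_measurable lebesgue"
proof (rule measurableI)
  fix A :: "real set" assume A: "A \<in> sets borel"
  have Nm: "N \<in> sets lebesgue" using N by (simp add: negligible_imp_measurable fmeasurableD)
  have 1: "g -` A \<inter> N \<in> sets lebesgue"
    using negligible_subset[OF N, of "g -` A \<inter> N"] by (simp add: negligible_imp_measurable fmeasurableD)
  have 2: "f -` A \<inter> space lebesgue - N \<in> sets lebesgue" using measurable_sets[OF f A] Nm by blast
  have "g -` A \<inter> space lebesgue = (f -` A \<inter> space lebesgue - N) \<union> (g -` A \<inter> N)" using eq by auto
  then show "g -` A \<inter> space lebesgue \<in> sets lebesgue" using sets.Un[OF 2 1] by (simp only:)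
qed simp

lemma tendsto_hoelder_modulus:
  fixes x :: real
  assumes "\<alpha> > 0"
  shows "((\<lambda>y. M * \<bar>y - x\<bar> powr \<alpha>) \<longlongrightarrow> 0) (at x)"
proof -
  have "((\<lambda>y. \<bar>y - x\<bar>) \<longlongrightarrow> \<bar>x - x\<bar>) (at x)"
    by (intro tendsto_rabs tendsto_diff tendsto_ident_at tendsto_const)
  then have "((\<lambda>y. \<bar>y - x\<bar>) \<longlongrightarrow> 0) (at x)" by simp
  then have "((\<lambda>y. \<bar>y - x\<bar> powr \<alpha>) \<longlongrightarrow> 0) (at x)"
    by (rule tendsto_zero_powrI[OF _ tendsto_const _ assms]) simp
  then show ?thesis by (rule tendsto_mult_right_zero)
qed

lemma continuous_of_hoelder:
  fixes g :: "real \<Rightarrow> real"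
  assumes "\<alpha> > 0" "\<And>x y. \<bar>g y - g x\<bar> \<le> M * \<bar>y - x\<bar> powr \<alpha>"
  shows "continuous_on UNIV g"
proof (rule continuous_at_imp_continuous_on, rule ballI)
  fix x
  have lim: "((\<lambda>y. M * \<bar>y - x\<bar> powr \<alpha>) \<longlongrightarrow> 0) (at x)" by (rule tendsto_hoelder_modulus[OF assms(1)])
  have "((\<lambda>y. g y - g x) \<longlongrightarrow> 0) (at x)"
    by (rule Lim_null_comparison[OF always_eventually lim]) (use assms(2) in simp)
  then show "isCont g x" unfolding isCont_def by (simp add: LIM_zero_iff)
qed

text \<open>A remainder bound of this kind holds uniformly along the sequence of extensions and
  survives pointwise limits; differentiability of the limit then requires no uniform convergence of
  derivatives.\<close>

lemma derivative_of_hoelder_remainder: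
  fixes g :: "real \<Rightarrow> real"
  assumes "\<alpha> > 0" "\<And>y. \<bar>g y - g x - (y - x) * d\<bar> \<le> M * \<bar>y - x\<bar> * \<bar>y - x\<bar> powr \<alpha>"
  shows "(g has_real_derivative d) (at x)"
proof -
  have lim: "((\<lambda>y. M * \<bar>y - x\<bar> powr \<alpha>) \<longlongrightarrow> 0) (at x)" by (rule tendsto_hoelder_modulus[OF assms(1)])
  have ev: "\<forall>\<^sub>F y in at x. norm ((g y - g x) / (y - x) - d) \<le> M * \<bar>y - x\<bar> powr \<alpha>"
  proof (rule eventually_at_topological[THEN iffD2], intro exI[of _ UNIV] conjI ballI impI)
    fix y :: real assume "y \<noteq> x"
    then have "(g y - g x) / (y - x) - d = (g y - g x - (y - x) * d) / (y - x)"
      by (simp add: diff_divide_distrib)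
    then have "norm ((g y - g x) / (y - x) - d) = \<bar>g y - g x - (y - x) * d\<bar> / \<bar>y - x\<bar>"
      by (simp only: real_norm_def abs_divide)
    also have "\<dots> \<le> M * \<bar>y - x\<bar> * \<bar>y - x\<bar> powr \<alpha> / \<bar>y - x\<bar>" by (rule divide_right_mono[OF assms(2)]) simp
    also have "\<dots> = M * \<bar>y - x\<bar> powr \<alpha>" using \<open>y \<noteq> x\<close> by simp
    finally show "norm ((g y - g x) / (y - x) - d) \<le> M * \<bar>y - x\<bar> powr \<alpha>" .
  qed auto
  have "((\<lambda>y. (g y - g x) / (y - x) - d) \<longlongrightarrow> 0) (at x)" by (rule Lim_null_comparison[OF ev lim])
  then show ?thesis unfolding has_field_derivative_iff by (simp add: LIM_zero_iff)
qed

text \<open>Only the orders below m are made to converge. Nothing is extracted at order m: the limit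
  of order m - 1 is absolutely continuous, hence differentiable almost everywhere, and its
  derivative is reached through difference quotients. The factor m + 1 is the number of norms in
  \<open>sobolev_norm\<close>.\<close>

lemma sobolev_limit:
  assumes m: "m \<ge> 1" and p: "p > 1" and M: "M \<ge> 0"
    and D: "\<And>n. deriv_chain (Suc m) (D n)"
    and B: "\<And>n k. k \<le> m \<Longrightarrow> (\<integral>\<^sup>+ t. ennreal (\<bar>D n k t\<bar> powr p) \<partial>lborel) \<le> ennreal (M powr p)"
  obtains s F where "strict_mono (s :: nat \<Rightarrow> nat)" "F \<in> sobolev m p" "sobolev_norm m p F \<le> (real m + 1) * M"
    "\<And>x. (\<lambda>n. D (s n) 0 x) \<longlonglongrightarrow> F x"
proof -
  \<comment> \<open>The exponent 1 - 1 / p of Hoelder's inequality.\<close>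
  define \<alpha> where "\<alpha> = (p - 1) / p"
  have \<alpha>: "\<alpha> > 0" "\<alpha> * p = p - 1" using p by (simp_all add: \<alpha>_def)
  have cont: "continuous_on UNIV (D n k)" if "k \<le> m" for n k
    by (rule deriv_chain_continuous[OF D]) (use that in simp)
  have bm: "D n k \<in> borel_measurable borel" if "k \<le> m" for n k
    by (rule borel_measurable_continuous_onI[OF cont[OF that]])
  have lm: "D n k \<in> borel_measurable lebesgue" if "k \<le> m" for n k
    using bm[OF that] by (simp add: measurable_completion)
  have nn: "(\<integral>\<^sup>+ t. ennreal (\<bar>D n k t\<bar> powr p) \<partial>lebesgue) \<le> ennreal (M powr p)" if "k \<le> m" for n k
    using B[OF that] by (simp add: nn_integral_completion)
  note Lp = Lp_of_nn_integral[OF p M lm nn]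
  have inc: "\<bar>D n k t - D n k r\<bar> \<le> integral {r..t} (\<lambda>y. \<bar>D n (Suc k) y\<bar>)" if "k < m" "r \<le> t" for n k r t
    by (rule chain_increment_bound[OF p D Lp(1)]) (use that in auto)
  have int_le: "integral S (\<lambda>y. \<bar>D n k y\<bar>) \<le> M * measure lebesgue S powr \<alpha>" if k: "k \<le> m" and S: "S \<in> lmeasurable" for n k S
  proof (rule powr_le_imp_le[of _ p])
    have "integral S (\<lambda>y. \<bar>D n k y\<bar>) powr p \<le> measure lebesgue S powr (p - 1) * Lint p S (D n k)"
      by (rule Lp_power_mean(2)[OF p Lp(1)[OF k k] S])
    also have "\<dots> \<le> measure lebesgue S powr (p - 1) * M powr p"
      by (intro mult_left_mono Lp(2)[OF k k] fmeasurableD[OF S]) simp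
    also have "\<dots> = (M * measure lebesgue S powr \<alpha>) powr p"
      by (simp add: powr_mult powr_powr \<alpha>(2))
    finally show "integral S (\<lambda>y. \<bar>D n k y\<bar>) powr p \<le> (M * measure lebesgue S powr \<alpha>) powr p" .
  qed (use p M in auto)
  have hoelder: "\<bar>D n k y - D n k x\<bar> \<le> M * \<bar>y - x\<bar> powr \<alpha>" if k: "k < m" for n k x y
  proof -
    have *: "\<bar>D n k t - D n k r\<bar> \<le> M * \<bar>t - r\<bar> powr \<alpha>" if "r \<le> t" for r t
      using inc[OF k that, of n] int_le[of "Suc k" "{r..t}" n] k that by simp
    show ?thesis using *[of x y] *[of y x] by (cases "x \<le> y") (simp_all add: abs_minus_commute)
  qed
  \<comment> \<open>Taken on the unit interval [x, x + 1]; the 4 comes from 2^p * 2 <= 4^p.\<close>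
  have bound: "\<bar>D n k x\<bar> \<le> 4 * M" if k: "k < m" for n k x
  proof (rule powr_le_imp_le[of _ p])
    have k': "k \<le> m" "Suc k \<le> m" using k by simp_all
    have "(x + 1 - x) * \<bar>D n k x\<bar> powr p \<le> 2 powr p * (Lint p {x..x + 1} (D n k) + Lint p {x..x + 1} (D n (Suc k)))"
      by (rule Lp_pointwise_bound[OF p Lp(1)[OF k'(1,1)] Lp(1)[OF k'(2,2)] inc[OF k]]) simp_all
    also have "\<dots> \<le> 2 powr p * (M powr p + M powr p)"
      by (intro mult_left_mono add_mono Lp(2)[OF k'(1,1)] Lp(2)[OF k'(2,2)]) simp_all
    also have "\<dots> = (2 powr p * 2) * M powr p" by simp
    also have "\<dots> \<le> (2 powr p * 2 powr p) * M powr p"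
      using p powr_mono[of 1 p 2] by (intro mult_right_mono mult_left_mono) simp_all
    also have "\<dots> = (2 * 2 * M) powr p" by (simp only: powr_mult)
    finally show "\<bar>D n k x\<bar> powr p \<le> (4 * M) powr p" by simp
  qed (use p M in auto)
  \<comment> \<open>A diagonal argument over the countably many pairs of an order and a rational
    point; the common Hoelder bound carries convergence from rational to real points.\<close>
  let ?S = "{..<m} \<times> (\<rat> :: real set)"
  have cS: "countable ?S" by (intro countable_SIGMA countable_rat) simp_all
  have bS: "norm ((\<lambda>(k, x). D n k x) z) \<le> 4 * M" if "z \<in> ?S" for n z
    using that bound by auto
  obtain s where s: "strict_mono (s :: nat \<Rightarrow> nat)"
    and sc: "\<And>z. z \<in> ?S \<Longrightarrow> \<exists>l. (\<lambda>n. (\<lambda>(k, x). D (s n) k x) z) \<longlonglongrightarrow> l"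
    using function_convergent_subsequence[of ?S "\<lambda>n (k, x). D n k x" "4 * M", OF cS bS] by blast
  have conv: "convergent (\<lambda>n. D (s n) k x)" if k: "k < m" for k x
  proof (rule Cauchy_convergent, rule CauchyI)
    fix e :: real assume e: "e > 0"
    define e' where "e' = e / (4 * (M + 1))"
    have e': "e' > 0" "M * e' \<le> e / 4" using e M by (simp_all add: e'_def field_simps)
    define \<delta> where "\<delta> = e' powr (1 / \<alpha>)"
    have \<delta>: "\<delta> > 0" using e' by (simp add: \<delta>_def)
    obtain q where q: "q \<in> \<rat>" "x < q" "q < x + \<delta>" using Rats_dense_in_real[of x "x + \<delta>"] \<delta> by auto
    have "\<bar>x - q\<bar> powr \<alpha> \<le> \<delta> powr \<alpha>" using q \<alpha> by (intro powr_mono2) auto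
    also have "\<dots> = e'" using \<alpha> e' by (simp add: \<delta>_def powr_powr)
    finally have "M * \<bar>x - q\<bar> powr \<alpha> \<le> M * e'" using M by (rule mult_left_mono)
    then have near: "\<bar>D n k x - D n k q\<bar> \<le> e / 4" for n using hoelder[OF k, of n x q] e'(2) by linarith
    have "\<exists>l. (\<lambda>n. D (s n) k q) \<longlonglongrightarrow> l" using sc[of "(k, q)"] q k by simp
    then have "Cauchy (\<lambda>n. D (s n) k q)" by (metis LIMSEQ_imp_Cauchy)
    then obtain N where N: "\<And>i j. i \<ge> N \<Longrightarrow> j \<ge> N \<Longrightarrow> norm (D (s i) k q - D (s j) k q) < e / 4"
      using CauchyD[of "\<lambda>n. D (s n) k q" "e / 4"] e by auto
    show "\<exists>N. \<forall>i\<ge>N. \<forall>j\<ge>N. norm (D (s i) k x - D (s j) k x) < e"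
    proof (intro exI[of _ N] allI impI)
      fix i j assume ij: "i \<ge> N" "j \<ge> N"
      have "\<bar>D (s i) k q - D (s j) k q\<bar> < e / 4" using N[OF ij] by simp
      then show "norm (D (s i) k x - D (s j) k x) < e"
        using near[of "s i"] near[of "s j"] e unfolding real_norm_def by linarith
    qed
  qed
  define G where "G k x = lim (\<lambda>n. D (s n) k x)" for k x
  have G: "(\<lambda>n. D (s n) k x) \<longlonglongrightarrow> G k x" if "k < m" for k x
    using conv[OF that, of x] unfolding G_def by (simp add: convergent_LIMSEQ_iff)
  have Ghoelder: "\<bar>G k y - G k x\<bar> \<le> M * \<bar>y - x\<bar> powr \<alpha>" if k: "k < m" for k x y
    by (rule LIMSEQ_le_const2[OF tendsto_rabs[OF tendsto_diff[OF G[OF k] G[OF k]]]]) (use hoelder[OF k] in blast)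
  have Gcont: "continuous_on UNIV (G k)" if "k < m" for k
    by (rule continuous_of_hoelder[OF \<alpha>(1) Ghoelder[OF that]])
  have Gder: "(G k has_real_derivative G (Suc k) x) (at x)" if k: "Suc k < m" for k x
  proof (rule derivative_of_hoelder_remainder[OF \<alpha>(1), where M = M])
    fix y
    have k': "k < m" using k by simp
    \<comment> \<open>By the mean value theorem the remainder is y - x times an increment of the
      next derivative, which obeys the same Hoelder bound for all n.\<close>
    have rem: "\<bar>D n k y - D n k x - (y - x) * D n (Suc k) x\<bar> \<le> M * \<bar>y - x\<bar> * \<bar>y - x\<bar> powr \<alpha>" for n
    proof -
      have "\<exists>\<xi>. \<bar>\<xi> - x\<bar> \<le> \<bar>y - x\<bar> \<and> D n k y - D n k x = (y - x) * D n (Suc k) \<xi>"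
      proof (cases y x rule: linorder_cases)
        case equal then show ?thesis by auto
      next
        case less
        obtain z where "y < z" "z < x" "D n k x - D n k y = (x - y) * D n (Suc k) z"
          using MVT2[OF less, of "D n k" "D n (Suc k)"] deriv_chainD[OF D, of k] k by auto
        then show ?thesis by (intro exI[of _ z]) (auto simp: algebra_simps)
      next
        case greater
        obtain z where "x < z" "z < y" "D n k y - D n k x = (y - x) * D n (Suc k) z"
          using MVT2[OF greater, of "D n k" "D n (Suc k)"] deriv_chainD[OF D, of k] k by auto
        then show ?thesis by (intro exI[of _ z]) auto
      qed
      then obtain \<xi> where \<xi>: "\<bar>\<xi> - x\<bar> \<le> \<bar>y - x\<bar>" "D n k y - D n k x = (y - x) * D n (Suc k) \<xi>" by blast
      have "\<bar>D n k y - D n k x - (y - x) * D n (Suc k) x\<bar> = \<bar>y - x\<bar> * \<bar>D n (Suc k) \<xi> - D n (Suc k) x\<bar>"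
        unfolding \<xi>(2) by (simp only: right_diff_distrib[symmetric] abs_mult)
      also have "\<dots> \<le> \<bar>y - x\<bar> * (M * \<bar>y - x\<bar> powr \<alpha>)"
      proof (intro mult_left_mono order_trans[OF hoelder[OF k]])
        show "\<bar>\<xi> - x\<bar> powr \<alpha> \<le> \<bar>y - x\<bar> powr \<alpha>" using \<xi>(1) \<alpha> by (intro powr_mono2) auto
      qed (use M in auto)
      finally show ?thesis by (simp add: algebra_simps)
    qed
    show "\<bar>G k y - G k x - (y - x) * G (Suc k) x\<bar> \<le> M * \<bar>y - x\<bar> * \<bar>y - x\<bar> powr \<alpha>"
      by (rule LIMSEQ_le_const2[OF tendsto_rabs[OF tendsto_diff[OF tendsto_diff[OF G[OF k'] G[OF k']]
        tendsto_mult[OF tendsto_const G[OF k]]]]]) (use rem in blast)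
  qed
  have dG: "(deriv ^^ k) (G 0) = G k" if "k < m" for k
    using that
  proof (induction k)
    case (Suc k)
    then have "(deriv ^^ Suc k) (G 0) = deriv (G k)" by simp
    also have "\<dots> = G (Suc k)" using Gder[OF Suc.prems] by (intro ext DERIV_imp_deriv)
    finally show ?case .
  qed simp
  let ?g = "G (m - 1)"
  have m1: "m - 1 < m" "Suc (m - 1) = m" using m by auto
  \<comment> \<open>For each n the variation over \<open>d\<close> is at most the integral of |D n
    m| over \<open>\<Union>d\<close>, thus at most \<open>M\<close> times the \<alpha>-th power of
    the total length. This bound does not involve n and passes to the limit.\<close>
  have ac: "abs_continuous_on S ?g" for S
    unfolding abs_continuous_on_def
  proof (intro allI impI)
    fix e :: real assume e: "e > 0"
    define e' where "e' = e / (2 * (M + 1))"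
    have e'0: "e' > 0" using e M by (simp add: e'_def)
    define c where "c = 2 * (M + 1)"
    have "c \<noteq> 0" using M by (simp add: c_def)
    then have "e' * c = e" unfolding e'_def c_def[symmetric] by simp
    then have "(M + 1) * e' = e / 2" by (simp add: c_def algebra_simps)
    moreover have "M * e' \<le> (M + 1) * e'" using e'0 by (intro mult_right_mono) simp_all
    ultimately have e': "e' > 0" "M * e' < e" using e e'0 by linarith+
    define \<delta> where "\<delta> = e' powr (1 / \<alpha>)"
    have \<delta>: "\<delta> > 0" using e' by (simp add: \<delta>_def)
    show "\<exists>\<delta>>0. \<forall>d. d division_of \<Union>d \<and> \<Union>d \<subseteq> S \<and> (\<Sum>K\<in>d. Sup K - Inf K) < \<delta> \<longrightarrow> (\<Sum>K\<in>d. \<bar>?g (Sup K) - ?g (Inf K)\<bar>) < e"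
    proof (intro exI[of _ \<delta>] conjI allI impI \<delta>)
      fix d :: "real set set" assume d: "d division_of \<Union>d \<and> \<Union>d \<subseteq> S \<and> (\<Sum>K\<in>d. Sup K - Inf K) < \<delta>"
      then have dd: "d division_of \<Union>d" by blast
      have meas: "\<Union>d \<in> lmeasurable" by (rule lmeasurable_division[OF dd])
      have len: "measure lebesgue (\<Union>d) < \<delta>" using measure_division_real[OF dd] d by simp
      have "(\<Sum>K\<in>d. \<bar>D n (m - 1) (Sup K) - D n (m - 1) (Inf K)\<bar>) \<le> M * e'" for n
      proof -
        have vi: "(\<lambda>y. \<bar>D n m y\<bar>) integrable_on K" if K: "K \<in> d" for K
        proof -
          obtain a b where "K = {a..b}" using division_of_real_interval[OF dd K] by blast
          then show ?thesis using Lp_power_mean(1)[OF p Lp(1)[OF order_refl order_refl], of "{a..b}" n] by simp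
        qed
        have "(\<Sum>K\<in>d. \<bar>D n (m - 1) (Sup K) - D n (m - 1) (Inf K)\<bar>) \<le> (\<Sum>K\<in>d. integral K (\<lambda>y. \<bar>D n m y\<bar>))"
        proof (rule sum_mono)
          fix K assume K: "K \<in> d"
          obtain a b where ab: "a \<le> b" "K = {a..b}" using division_of_real_interval[OF dd K] by blast
          then show "\<bar>D n (m - 1) (Sup K) - D n (m - 1) (Inf K)\<bar> \<le> integral K (\<lambda>y. \<bar>D n m y\<bar>)"
            using inc[OF m1(1) ab(1), of n] m1(2) by simp
        qed
        also have "\<dots> = integral (\<Union>d) (\<lambda>y. \<bar>D n m y\<bar>)"
          by (rule integral_combine_division_bottomup[OF dd vi, symmetric])
        also have "\<dots> \<le> M * measure lebesgue (\<Union>d) powr \<alpha>" by (rule int_le[OF order_refl meas])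
        also have "\<dots> \<le> M * \<delta> powr \<alpha>" using len \<alpha> M by (intro mult_left_mono powr_mono2) auto
        also have "\<delta> powr \<alpha> = e'" using \<alpha> e' by (simp add: \<delta>_def powr_powr)
        finally show ?thesis .
      qed
      note le = this
      have "(\<Sum>K\<in>d. \<bar>?g (Sup K) - ?g (Inf K)\<bar>) \<le> M * e'"
        by (rule LIMSEQ_le_const2[OF tendsto_sum[OF tendsto_rabs[OF tendsto_diff[OF G[OF m1(1)] G[OF m1(1)]]]]])
          (use le in blast)
      then show "(\<Sum>K\<in>d. \<bar>?g (Sup K) - ?g (Inf K)\<bar>) < e" using e'(2) by simp
    qed
  qed
  define N where "N = {x. \<not> ?g differentiable (at x)}"
  have negN: "negligible N"
  proof -
    have "N = (\<Union>n. {x \<in> {- real n<..<real n}. \<not> ?g differentiable (at x)})"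
    proof
      show "N \<subseteq> (\<Union>n. {x \<in> {- real n<..<real n}. \<not> ?g differentiable (at x)})"
      proof
        fix x assume x: "x \<in> N"
        obtain n where "\<bar>x\<bar> < real n" using reals_Archimedean2 by blast
        then have "x \<in> {- real n<..<real n}" by (simp add: abs_less_iff)
        then show "x \<in> (\<Union>n. {x \<in> {- real n<..<real n}. \<not> ?g differentiable (at x)})" using x by (auto simp: N_def)
      qed
    qed (auto simp: N_def)
    moreover have "negligible (\<Union>n. {x \<in> {- real n<..<real n}. \<not> ?g differentiable (at x)})"
      by (intro negligible_Union_nat ac_differentiable_ae ac)
    ultimately show ?thesis by simp
  qed
  define w where "w = deriv ?g"
  define h where "h j = 1 / real (Suc j)" for j
  have h: "h j > 0" for j by (simp add: h_def)
  have h0: "h \<longlonglongrightarrow> 0" unfolding h_def[abs_def] using LIMSEQ_inverse_real_of_nat by (simp add: inverse_eq_divide)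
  define q where "q j x = (?g (x + h j) - ?g x) / h j" for j x
  have qw: "(\<lambda>j. q j x) \<longlonglongrightarrow> w x" if "x \<notin> N" for x
  proof -
    have "(?g has_real_derivative w x) (at x)"
      using that by (simp add: N_def w_def DERIV_deriv_iff_real_differentiable)
    then have lim: "((\<lambda>h. (?g (x + h) - ?g x) / h) \<longlongrightarrow> w x) (at 0)" by (simp add: DERIV_def)
    have "h j \<noteq> 0" for j using h[of j] by simp
    then have "filterlim h (at 0) sequentially" by (intro filterlim_atI[OF h0] always_eventually allI)
    from filterlim_compose[OF lim this] show ?thesis unfolding q_def .
  qed
  have qm: "q j \<in> borel_measurable borel" for j
    unfolding q_def[abs_def] by (intro borel_measurable_continuous_onI continuous_intros
      continuous_on_compose2[OF Gcont[OF m1(1)]] Gcont[OF m1(1)]) (use h[of j] in auto)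
  \<comment> \<open>Off \<open>N\<close>, \<open>w\<close> is the limit of the continuous quotients
    \<open>q j\<close>; completeness of Lebesgue measure takes care of \<open>N\<close>.\<close>
  have wm: "w \<in> borel_measurable lebesgue"
  proof (rule borel_measurable_lebesgue_spike[OF _ negN])
    show "(\<lambda>x. lim (\<lambda>j. q j x)) \<in> borel_measurable lebesgue"
      using borel_measurable_lim_metric[of q borel] qm by (simp add: measurable_completion)
    show "w x = lim (\<lambda>j. q j x)" if "x \<notin> N" for x using limI[OF qw[OF that]] by simp
  qed
  \<comment> \<open>Fatou's lemma is applied twice: here along the extensions for a fixed step
    \<open>h j\<close>, and in \<open>wn\<close> as \<open>h j\<close> tends to 0.\<close>
  have qn: "(\<integral>\<^sup>+ x. ennreal (\<bar>q j x\<bar> powr p) \<partial>lborel) \<le> ennreal (M powr p)" for j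
  proof (rule fatou_bound)
    let ?q = "\<lambda>n x. (D (s n) (m - 1) (x + h j) - D (s n) (m - 1) x) / h j"
    show "(\<lambda>x. ennreal (\<bar>?q n x\<bar> powr p)) \<in> borel_measurable lborel" for n
    proof -
      define r where "r = ?q n"
      have "r \<in> borel_measurable borel"
        unfolding r_def by (intro borel_measurable_continuous_onI continuous_intros continuous_on_compose2[OF cont] cont)
          (use h[of j] in auto)
      then have "(\<lambda>x. ennreal (\<bar>r x\<bar> powr p)) \<in> borel_measurable lborel" by simp
      then show ?thesis unfolding r_def .
    qed
    show "AE x in lborel. (\<lambda>n. ennreal (\<bar>?q n x\<bar> powr p)) \<longlonglongrightarrow> ennreal (\<bar>q j x\<bar> powr p)"
      unfolding q_def using p h[of j]
      by (intro AE_I2 tendsto_ennrealI tendsto_powr2 tendsto_rabs tendsto_divide tendsto_diff G[OF m1(1)] tendsto_const) auto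
    show "(\<integral>\<^sup>+ x. ennreal (\<bar>?q n x\<bar> powr p) \<partial>lborel) \<le> ennreal (M powr p)" for n
      by (rule difference_quotient_nn_integral[OF p M h bm[OF order_refl, of "s n"] B[OF order_refl, of "s n"]])
        (use inc[OF m1(1)] m1(2) h[of j] in \<open>simp add: less_imp_le\<close>)
  qed
  have wn: "(\<integral>\<^sup>+ x. ennreal (\<bar>w x\<bar> powr p) \<partial>lebesgue) \<le> ennreal (M powr p)"
  proof (rule fatou_bound)
    show "(\<lambda>x. ennreal (\<bar>q j x\<bar> powr p)) \<in> borel_measurable lebesgue" for j
      using qm[of j] by (simp add: measurable_completion)
    have "AE x in lebesgue. x \<notin> N" using negN by (simp add: AE_not_in negligible_iff_null_sets)
    then show "AE x in lebesgue. (\<lambda>j. ennreal (\<bar>q j x\<bar> powr p)) \<longlonglongrightarrow> ennreal (\<bar>w x\<bar> powr p)"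
    proof (rule eventually_mono)
      fix x assume "x \<notin> N"
      then show "(\<lambda>j. ennreal (\<bar>q j x\<bar> powr p)) \<longlonglongrightarrow> ennreal (\<bar>w x\<bar> powr p)"
        using p by (intro tendsto_ennrealI tendsto_powr2 tendsto_rabs qw tendsto_const) auto
    qed
    show "(\<integral>\<^sup>+ x. ennreal (\<bar>q j x\<bar> powr p) \<partial>lebesgue) \<le> ennreal (M powr p)" for j
      using qn[of j] by (simp add: nn_integral_completion)
  qed
  have Gn: "(\<integral>\<^sup>+ x. ennreal (\<bar>G k x\<bar> powr p) \<partial>lborel) \<le> ennreal (M powr p)" if k: "k < m" for k
  proof (rule fatou_bound)
    show "(\<lambda>x. ennreal (\<bar>D (s n) k x\<bar> powr p)) \<in> borel_measurable lborel" for n using bm[of k "s n"] k by simp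
    show "AE x in lborel. (\<lambda>n. ennreal (\<bar>D (s n) k x\<bar> powr p)) \<longlonglongrightarrow> ennreal (\<bar>G k x\<bar> powr p)"
      using p by (intro AE_I2 tendsto_ennrealI tendsto_powr2 tendsto_rabs G[OF k] tendsto_const) auto
    show "(\<integral>\<^sup>+ x. ennreal (\<bar>D (s n) k x\<bar> powr p) \<partial>lborel) \<le> ennreal (M powr p)" for n using B k by simp
  qed
  have dm: "(deriv ^^ m) (G 0) = w"
    using dG[OF m1(1)] m1(2) unfolding w_def by (metis comp_apply funpow.simps(2))
  have all: "(deriv ^^ k) (G 0) \<in> Lp_space p \<and> Lp_norm p ((deriv ^^ k) (G 0)) \<le> M" if k: "k \<le> m" for k
  proof (cases "k = m")
    case True
    then show ?thesis using Lp_of_nn_integral(1,3)[OF p M wm wn] dm by simp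
  next
    case False
    then have km: "k < m" using k by simp
    have "G k \<in> borel_measurable lebesgue"
      using borel_measurable_continuous_onI[OF Gcont[OF km]] by (simp add: measurable_completion)
    moreover have "(\<integral>\<^sup>+ x. ennreal (\<bar>G k x\<bar> powr p) \<partial>lebesgue) \<le> ennreal (M powr p)"
      using Gn[OF km] by (simp add: nn_integral_completion)
    ultimately show ?thesis using Lp_of_nn_integral(1,3)[OF p M] dG[OF km] by simp
  qed
  have sob: "G 0 \<in> sobolev m p"
    unfolding sobolev_def hom_sobolev_def locally_abs_continuous_def
  proof (intro CollectI conjI allI impI)
    show "(deriv ^^ k) (G 0) differentiable at x" if "k < m - 1" for k x
    proof -
      have "Suc k < m" "k < m" using that by simp_all
      then show ?thesis using Gder[of k x] dG[of k] real_differentiable_def by metis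
    qed
    show "abs_continuous_on {a..b} ((deriv ^^ (m - 1)) (G 0))" for a b using dG[OF m1(1)] ac by simp
  qed (use all in auto)
  have "sobolev_norm m p (G 0) \<le> real (card {..m}) * M"
    unfolding sobolev_norm_def using all by (intro sum_bounded_above) auto
  then have "sobolev_norm m p (G 0) \<le> (real m + 1) * M" by (simp add: add.commute)
  with that[OF s sob] G m show ?thesis by (metis One_nat_def less_eq_Suc_le)
qed

section \<open>The extension theorem\<close>

lemma divided_difference_cong:
  assumes "\<And>t. t \<in> S \<Longrightarrow> f t = g t" shows "divided_difference f S = divided_difference g S"
  using assms by (simp add: divided_difference_def lagrange_poly_def)

lemma W_sum_cong:
  assumes "\<And>t. t \<in> x ` {..n} \<Longrightarrow> f t = g t" "m \<le> n"
  shows "W_sum m p n x f = W_sum m p n x g"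
  unfolding W_sum_def
proof (intro sum.cong refl)
  fix k i assume "k \<in> {..m}" "i \<in> {..n - k}"
  then have "i + k \<le> n" using assms(2) by auto
  then have "divided_difference f (x ` {i..i + k}) = divided_difference g (x ` {i..i + k})"
    by (intro divided_difference_cong assms(1)) auto
  then show "W_weight m n x i * \<bar>divided_difference f (x ` {i..i + k})\<bar> powr p =
      W_weight m n x i * \<bar>divided_difference g (x ` {i..i + k})\<bar> powr p" by simp
qed

lemma W_sum_nonneg:
  assumes "strict_mono_on {..n} x" shows "0 \<le> W_sum m p n x f"
  unfolding W_sum_def using W_weight_nonneg[OF assms] by (intro sum_nonneg mult_nonneg_nonneg) auto

lemma W_functional_upper:
  assumes "m \<le> n" "strict_mono_on {..n} x" "x ` {..n} \<subseteq> E"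
  shows "ereal (W_sum m p n x f powr (1 / p)) \<le> W_functional m p E f"
  unfolding W_functional_def W_sum_def
  by (rule SUP_upper2[of "(n, x)"]) (use assms in auto)

lemma W_functional_least:
  assumes "\<And>n x. m \<le> n \<Longrightarrow> strict_mono_on {..n} x \<Longrightarrow> x ` {..n} \<subseteq> E \<Longrightarrow> ereal (W_sum m p n x f powr (1 / p)) \<le> B"
  shows "W_functional m p E f \<le> B"
  unfolding W_functional_def
proof (rule SUP_least, clarify)
  fix n and x :: "nat \<Rightarrow> real"
  assume "m \<le> n" "strict_mono_on {..n} x" "x ` {..n} \<subseteq> E"
  from assms[OF this] show "ereal ((\<Sum>k\<le>m. \<Sum>i\<le>n - k. W_weight m n x i * \<bar>divided_difference f (x ` {i..i + k})\<bar> powr p) powr (1 / p)) \<le> B"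
    by (simp add: W_sum_def)
qed

text \<open>Gives the continuity of an extension and, with a uniform bound for the norms, a modulus
  of continuity for the data on \<open>E\<close>.\<close>

lemma sobolev_hoelder:
  assumes m: "m \<ge> 1" and p: "p > 1" and F: "F \<in> sobolev m p"
  shows "\<bar>F y - F x\<bar> \<le> sobolev_norm m p F * \<bar>y - x\<bar> powr ((p - 1) / p)"
proof -
  let ?v = "(deriv ^^ Suc 0) F" and ?N = "sobolev_norm m p F"
  have N0: "0 \<le> Lp_norm p g" for g unfolding Lp_norm_def by simp
  have v: "?v \<in> Lp_space p" using F m by (simp add: sobolev_def del: funpow.simps)
  have vN: "Lp_norm p ?v \<le> ?N"
    unfolding sobolev_norm_def by (rule member_le_sum[of "Suc 0" "{..m}" "\<lambda>k. Lp_norm p ((deriv ^^ k) F)"]) (use m N0 in auto)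
  have le: "\<bar>F t - F s\<bar> \<le> ?N * \<bar>t - s\<bar> powr ((p - 1) / p)" if st: "s \<le> t" for s t
  proof -
    let ?I = "integral {s..t} (\<lambda>y. \<bar>?v y\<bar>)"
    have "\<bar>F t - F s\<bar> \<le> ?I"
      using sobolev_increment_bound[OF p F, of 0 s t] m st by simp
    moreover have "?I \<le> Lp_norm p ?v * \<bar>t - s\<bar> powr ((p - 1) / p)"
    proof (rule powr_le_imp_le[of _ p])
      have "?I powr p \<le> measure lebesgue {s..t} powr (p - 1) * Lint p {s..t} ?v"
        by (rule Lp_power_mean(2)[OF p v]) simp
      also have "\<dots> \<le> measure lebesgue {s..t} powr (p - 1) * Lint p UNIV ?v"
        by (intro mult_left_mono Lint_mono[OF v]) simp_all
      also have "\<dots> = (Lp_norm p ?v * \<bar>t - s\<bar> powr ((p - 1) / p)) powr p"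
        unfolding Lint_UNIV[OF p] powr_mult using st p by (simp add: powr_powr)
      finally show "?I powr p \<le> (Lp_norm p ?v * \<bar>t - s\<bar> powr ((p - 1) / p)) powr p" .
    qed (use p N0[of ?v] in auto)
    moreover have "Lp_norm p ?v * \<bar>t - s\<bar> powr ((p - 1) / p) \<le> ?N * \<bar>t - s\<bar> powr ((p - 1) / p)"
      by (rule mult_right_mono[OF vN]) simp
    ultimately show ?thesis by linarith
  qed
  show ?thesis using le[of x y] le[of y x] by (cases "x \<le> y") (simp_all add: abs_minus_commute)
qed

lemma trace_necessity:
  assumes m: "m \<ge> 1" and p: "p > 1" and F: "F \<in> sobolev m p" "\<And>t. t \<in> E \<Longrightarrow> F t = f t"
  shows "W_functional m p E f \<le> ereal ((real m + 1) * (2 * real m + 1) * (real m + 1) * (2 * 4 ^ m) * sobolev_norm m p F)"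
proof (rule W_functional_least)
  fix n and x :: "nat \<Rightarrow> real"
  assume n: "m \<le> n" and x: "strict_mono_on {..n} x" and xE: "x ` {..n} \<subseteq> E"
  let ?C = "(real m + 1) * (2 * real m + 1) * (real m + 1) * (2 * 4 ^ m) * sobolev_norm m p F"
  have "0 \<le> sobolev_norm m p F" unfolding sobolev_norm_def Lp_norm_def by (intro sum_nonneg) simp
  then have C: "0 \<le> ?C" by simp
  have "W_sum m p n x f = W_sum m p n x F" by (rule W_sum_cong[OF _ n]) (use xE F(2) in auto)
  also have "\<dots> \<le> ?C powr p" by (rule W_sum_le_sobolev_norm[OF m p F(1) n x])
  finally have "W_sum m p n x f powr (1 / p) \<le> (?C powr p) powr (1 / p)"
    using W_sum_nonneg[OF x] p by (intro powr_mono2) auto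
  also have "\<dots> = ?C" using C p by (simp add: powr_powr)
  finally show "ereal (W_sum m p n x f powr (1 / p)) \<le> ereal ?C" by simp
qed

lemma trace_sufficiency:
  assumes m: "m \<ge> 1"
  shows "\<exists>K\<ge>1. \<forall>p E f A. 1 < p \<longrightarrow> (\<exists>S\<subseteq>E. finite S \<and> card S = m + 1) \<longrightarrow> W_functional m p E f = ereal A \<longrightarrow>
    (\<exists>F\<in>sobolev m p. (\<forall>x\<in>E. F x = f x) \<and> sobolev_norm m p F \<le> K * A)"
proof -
  obtain K where K: "K \<ge> 1" and ext: "\<And>p n x f A. 1 < p \<Longrightarrow> m \<le> n \<Longrightarrow> strict_mono_on {..n} x \<Longrightarrow> 0 \<le> A \<Longrightarrow>
    (\<forall>n' y. m \<le> n' \<longrightarrow> strict_mono_on {..n'} y \<longrightarrow> y ` {..n'} \<subseteq> x ` {..n} \<longrightarrow> W_sum m p n' y f \<le> A powr p) \<Longrightarrow>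
    \<exists>F. deriv_chain (Suc m) F \<and> (\<forall>i\<le>n. F 0 (x i) = f (x i)) \<and>
      (\<forall>k\<le>m. (\<integral>\<^sup>+ t. ennreal (\<bar>F k t\<bar> powr p) \<partial>lborel) \<le> ennreal ((K * A) powr p))"
    using finite_extension[OF m] by blast
  have K1: "1 * 1 \<le> (real m + 1) * K" using K by (intro mult_mono) auto
  show ?thesis
  proof (intro exI[of _ "(real m + 1) * K"] conjI allI impI)
    show "1 \<le> (real m + 1) * K" using K1 by simp
    fix p E f A
    assume p: "1 < p" and SE: "\<exists>S\<subseteq>E. finite S \<and> card S = m + 1" and WA: "W_functional m p E f = ereal A"
    obtain S where S: "S \<subseteq> E" "finite S" "card S = m + 1" using SE by blast
    \<comment> \<open>\<open>T\<close> contains the m + 1 points of \<open>S\<close>, so its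
      increasing enumeration is admissible for the functional; this also shows that \<open>A\<close>
      is nonnegative.\<close>
    have ext_set: "\<exists>F. deriv_chain (Suc m) F \<and> (\<forall>t\<in>T. F 0 t = f t) \<and>
        (\<forall>k\<le>m. (\<integral>\<^sup>+ t. ennreal (\<bar>F k t\<bar> powr p) \<partial>lborel) \<le> ennreal ((K * A) powr p))" and A0: "0 \<le> A"
      if T: "finite T" "S \<subseteq> T" "T \<subseteq> E" for T
    proof -
      have cT: "m + 1 \<le> card T" using card_mono[OF T(1,2)] S(3) by simp
      obtain y where y: "strict_mono_on {..<card T} y" "y ` {..<card T} = T"
        by (rule finite_set_enumeration[OF T(1)]) (rule that)
      define n where "n = card T - 1"
      have n: "{..<card T} = {..n}" "m \<le> n" using cT by (auto simp: n_def)
      have yn: "strict_mono_on {..n} y" "y ` {..n} = T" using y n by simp_all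
      have "ereal (W_sum m p n y f powr (1 / p)) \<le> ereal A"
        using W_functional_upper[OF n(2) yn(1)] yn(2) T(3) WA by metis
      then have "W_sum m p n y f powr (1 / p) \<le> A" by simp
      then show A: "0 \<le> A" using powr_ge_zero order_trans by blast
      have W: "W_sum m p n' z f \<le> A powr p" if z: "m \<le> n'" "strict_mono_on {..n'} z" "z ` {..n'} \<subseteq> y ` {..n}" for n' z
      proof -
        have "ereal (W_sum m p n' z f powr (1 / p)) \<le> ereal A"
          unfolding WA[symmetric] by (rule W_functional_upper[OF z(1,2)]) (use z(3) yn(2) T(3) in auto)
        then have "(W_sum m p n' z f powr (1 / p)) powr p \<le> A powr p" using p by (intro powr_mono2) auto
        then show ?thesis using p W_sum_nonneg[OF z(2), of m p f] by (simp add: powr_powr)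
      qed
      then obtain F where F: "deriv_chain (Suc m) F" "\<forall>i\<le>n. F 0 (y i) = f (y i)"
        "\<forall>k\<le>m. (\<integral>\<^sup>+ t. ennreal (\<bar>F k t\<bar> powr p) \<partial>lborel) \<le> ennreal ((K * A) powr p)"
        using ext[OF p n(2) yn(1) A, of f] by blast
      have "\<forall>t\<in>T. F 0 t = f t"
      proof
        fix t assume "t \<in> T"
        then obtain i where "i \<le> n" "t = y i" using yn(2) by auto
        then show "F 0 t = f t" using F(2) by simp
      qed
      then show "\<exists>F. deriv_chain (Suc m) F \<and> (\<forall>t\<in>T. F 0 t = f t) \<and>
        (\<forall>k\<le>m. (\<integral>\<^sup>+ t. ennreal (\<bar>F k t\<bar> powr p) \<partial>lborel) \<le> ennreal ((K * A) powr p))" using F(1,3) by blast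
    qed
    have A: "0 \<le> A" using A0[OF S(2) order_refl S(1)] .
    have M: "0 \<le> K * A" using K A by simp
    \<comment> \<open>Stated for an arbitrary increasing sequence because it serves twice: with a
      constant sequence to estimate f, and with finite sets that exhaust \<open>S\<close> together
      with a countable dense subset of \<open>E\<close>.\<close>
    have lim_ext: "\<exists>F\<in>sobolev m p. (\<forall>t\<in>\<Union>(range T). F t = f t) \<and> sobolev_norm m p F \<le> (real m + 1) * (K * A)"
      if T: "\<And>n. finite (T n)" "\<And>n. S \<subseteq> T n" "\<And>n. T n \<subseteq> E" "incseq T" for T :: "nat \<Rightarrow> real set"
    proof -
      have "\<exists>F. deriv_chain (Suc m) F \<and> (\<forall>t\<in>T n. F 0 t = f t) \<and>
        (\<forall>k\<le>m. (\<integral>\<^sup>+ t. ennreal (\<bar>F k t\<bar> powr p) \<partial>lborel) \<le> ennreal ((K * A) powr p))" for n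
        by (rule ext_set[OF T(1-3)])
      then obtain D where D: "\<And>n. deriv_chain (Suc m) (D n)" "\<And>n. \<forall>t\<in>T n. D n 0 t = f t"
        "\<And>n. \<forall>k\<le>m. (\<integral>\<^sup>+ t. ennreal (\<bar>D n k t\<bar> powr p) \<partial>lborel) \<le> ennreal ((K * A) powr p)" by metis
      obtain s F where s: "strict_mono (s :: nat \<Rightarrow> nat)" and F: "F \<in> sobolev m p" "sobolev_norm m p F \<le> (real m + 1) * (K * A)"
        "\<And>x. (\<lambda>n. D (s n) 0 x) \<longlonglongrightarrow> F x"
      proof (rule sobolev_limit[where D = D, OF m p M D(1)])
        fix n k assume "k \<le> m"
        then show "(\<integral>\<^sup>+ t. ennreal (\<bar>D n k t\<bar> powr p) \<partial>lborel) \<le> ennreal ((K * A) powr p)"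
          using D(3) by blast
      qed (rule that)
      have "F t = f t" if t: "t \<in> T N" for t N
      proof -
        have "\<forall>\<^sub>F n in sequentially. D (s n) 0 t = f t"
        proof (rule eventually_sequentiallyI[of N])
          fix n assume "N \<le> n"
          then have "N \<le> s n" using seq_suble[OF s, of n] by simp
          then have "t \<in> T (s n)" using T(4) t by (auto simp: incseq_def)
          then show "D (s n) 0 t = f t" using D(2) by blast
        qed
        then have "(\<lambda>n. D (s n) 0 t) \<longlonglongrightarrow> f t" by (rule tendsto_eventually)
        then show ?thesis using F(3) LIMSEQ_unique by blast
      qed
      then show ?thesis using F(1,2) by blast
    qed
    \<comment> \<open>No continuity of f is given beforehand. It follows from extensions off
      \<open>S\<close> with two arbitrary points of \<open>E\<close> added, since their norms have a
      common bound; then agreement of F and f on the dense set \<open>Q\<close> spreads to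
      \<open>E\<close>.\<close>
    have fh: "\<bar>f b - f a\<bar> \<le> (real m + 1) * (K * A) * \<bar>b - a\<bar> powr ((p - 1) / p)" if ab: "a \<in> E" "b \<in> E" for a b
    proof -
      have "\<exists>F\<in>sobolev m p. (\<forall>t\<in>\<Union>(range (\<lambda>n::nat. S \<union> {a, b})). F t = f t) \<and> sobolev_norm m p F \<le> (real m + 1) * (K * A)"
        by (rule lim_ext) (use S ab in auto)
      then obtain F where F: "F \<in> sobolev m p" "F a = f a" "F b = f b" "sobolev_norm m p F \<le> (real m + 1) * (K * A)"
        by auto
      have "\<bar>F b - F a\<bar> \<le> sobolev_norm m p F * \<bar>b - a\<bar> powr ((p - 1) / p)" by (rule sobolev_hoelder[OF m p F(1)])
      also have "\<dots> \<le> (real m + 1) * (K * A) * \<bar>b - a\<bar> powr ((p - 1) / p)" using F(4) by (rule mult_right_mono) simp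
      finally show ?thesis using F(2,3) by simp
    qed
    obtain Q where Q: "countable Q" "Q \<subseteq> E" "E \<subseteq> closure Q" by (rule separable)
    have "S \<noteq> {}" using S(3) by auto
    then have Q0: "Q \<noteq> {}" using S(1) Q(3) by auto
    define T where "T n = S \<union> from_nat_into Q ` {..n}" for n :: nat
    have "\<exists>F\<in>sobolev m p. (\<forall>t\<in>\<Union>(range T). F t = f t) \<and> sobolev_norm m p F \<le> (real m + 1) * (K * A)"
    proof (rule lim_ext)
      show "finite (T n)" "S \<subseteq> T n" for n using S(2) by (auto simp: T_def)
      show "T n \<subseteq> E" for n using S(1) Q(2) from_nat_into[OF Q0] by (auto simp: T_def)
      show "incseq T" by (auto simp: incseq_def T_def)
    qed
    then obtain F where F: "F \<in> sobolev m p" "\<forall>t\<in>\<Union>(range T). F t = f t" "sobolev_norm m p F \<le> (real m + 1) * (K * A)"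
      by blast
    have FQ: "F q = f q" if "q \<in> Q" for q
    proof -
      obtain n where "from_nat_into Q n = q" using from_nat_into_surj[OF Q(1) \<open>q \<in> Q\<close>] by blast
      then have "q \<in> T n" by (auto simp: T_def)
      then show ?thesis using F(2) by blast
    qed
    have "F x = f x" if x: "x \<in> E" for x
    proof -
      obtain q where q: "\<And>n. q n \<in> Q" "q \<longlonglongrightarrow> x" using x Q(3) closure_sequential by blast
      define \<alpha> where "\<alpha> = (p - 1) / p"
      have \<alpha>: "\<alpha> > 0" using p by (simp add: \<alpha>_def)
      have "continuous_on UNIV F"
        by (rule continuous_of_hoelder[OF \<alpha>]) (unfold \<alpha>_def, rule sobolev_hoelder[OF m p F(1)])
      then have "isCont F x" by (simp add: continuous_on_eq_continuous_at)
      then have 1: "(\<lambda>n. F (q n)) \<longlonglongrightarrow> F x" using q(2) by (rule isCont_tendsto_compose)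
      have "(\<lambda>n. \<bar>q n - x\<bar>) \<longlonglongrightarrow> 0" using q(2) by (simp add: tendsto_rabs_zero_iff LIM_zero_iff)
      then have "(\<lambda>n. \<bar>q n - x\<bar> powr \<alpha>) \<longlonglongrightarrow> 0"
        by (rule tendsto_zero_powrI[OF _ tendsto_const _ \<alpha>]) simp
      then have lim: "(\<lambda>n. (real m + 1) * (K * A) * \<bar>q n - x\<bar> powr \<alpha>) \<longlonglongrightarrow> 0" by (rule tendsto_mult_right_zero)
      have "(\<lambda>n. f (q n) - f x) \<longlonglongrightarrow> 0"
      proof (rule Lim_null_comparison[OF always_eventually lim], rule allI)
        fix n
        have "q n \<in> E" using q(1) Q(2) by blast
        then show "norm (f (q n) - f x) \<le> (real m + 1) * (K * A) * \<bar>q n - x\<bar> powr \<alpha>"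
          using fh[OF x] by (simp add: \<alpha>_def)
      qed
      then have "(\<lambda>n. f (q n)) \<longlonglongrightarrow> f x" by (simp add: LIM_zero_iff)
      then have "(\<lambda>n. F (q n)) \<longlonglongrightarrow> f x" using FQ q(1) by simp
      then show ?thesis using 1 LIMSEQ_unique by blast
    qed
    then show "\<exists>F\<in>sobolev m p. (\<forall>x\<in>E. F x = f x) \<and> sobolev_norm m p F \<le> (real m + 1) * K * A"
      using F(1,3) by (auto simp: mult.assoc)
  qed
qed

theorem theorem1p2:
  fixes m :: nat
  assumes "m \<ge> 1"
  shows "\<exists>C::real. C \<ge> 1 \<and>
    (\<forall>(p::real) (E::real set) (f::real \<Rightarrow> real).
       1 < p \<longrightarrow> closed E \<longrightarrow> (\<exists>S\<subseteq>E. finite S \<and> card S = m + 1) \<longrightarrow>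
         ((\<exists>F\<in>sobolev m p. \<forall>x\<in>E. F x = f x) \<longleftrightarrow> W_functional m p E f < \<infinity>) \<and>
         ereal (inverse C) * W_functional m p E f \<le> sobolev_trace_norm m p E f \<and>
         sobolev_trace_norm m p E f \<le> ereal C * W_functional m p E f)"
proof -
  obtain K where K: "K \<ge> 1" and suff: "\<And>p E f A. 1 < p \<Longrightarrow> \<exists>S\<subseteq>E. finite S \<and> card S = m + 1 \<Longrightarrow>
    W_functional m p E f = ereal A \<Longrightarrow> \<exists>F\<in>sobolev m p. (\<forall>x\<in>E. F x = f x) \<and> sobolev_norm m p F \<le> K * A"
    using trace_sufficiency[OF assms] by blast
  define N where "N = (real m + 1) * (2 * real m + 1) * (real m + 1) * (2 * 4 ^ m)"
  have N: "N > 0" by (simp add: N_def add_pos_pos)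
  \<comment> \<open>One constant for both directions: \<open>K\<close> from the extension and
    \<open>N\<close> from the necessity, both fixed before p, E and f.\<close>
  define C where "C = max K N"
  have C: "C \<ge> 1" "K \<le> C" "N \<le> C" using K by (auto simp: C_def)
  show ?thesis
  proof (intro exI[of _ C] conjI allI impI)
    show "C \<ge> 1" by (rule C)
    fix p :: real and E :: "real set" and f :: "real \<Rightarrow> real"
    assume p: "1 < p" and S: "\<exists>S\<subseteq>E. finite S \<and> card S = m + 1"
    let ?W = "W_functional m p E f"
    have nec: "?W \<le> ereal (N * sobolev_norm m p F)" if "F \<in> sobolev m p" "\<forall>x\<in>E. F x = f x" for F
      unfolding N_def by (rule trace_necessity[OF assms p that(1)]) (use that(2) in blast)
    \<comment> \<open>The supremum runs over a nonempty family because \<open>E\<close> has m + 1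
      points; a finite value is therefore a real number A >= 0.\<close>
    have W0: "0 \<le> ?W"
    proof -
      obtain T where T: "T \<subseteq> E" "finite T" "card T = m + 1" using S by blast
      obtain y where y: "strict_mono_on {..<card T} y" "y ` {..<card T} = T"
        by (rule finite_set_enumeration[OF T(2)]) (rule that)
      have eq: "{..<card T} = {..m}" using T(3) by auto
      have "ereal (W_sum m p m y f powr (1 / p)) \<le> ?W"
        by (rule W_functional_upper) (use y eq T(1) in auto)
      moreover have "0 \<le> ereal (W_sum m p m y f powr (1 / p))" by simp
      ultimately show ?thesis by (rule order_trans[rotated])
    qed
    have suff': "\<exists>A\<ge>0. ?W = ereal A \<and> (\<exists>F\<in>sobolev m p. (\<forall>x\<in>E. F x = f x) \<and> sobolev_norm m p F \<le> K * A)" if fin: "?W < \<infinity>"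
    proof -
      obtain A where A: "?W = ereal A" "0 \<le> A" using W0 fin by (cases ?W) auto
      then show ?thesis using suff[OF p S A(1)] by blast
    qed
    show "(\<exists>F\<in>sobolev m p. \<forall>x\<in>E. F x = f x) \<longleftrightarrow> ?W < \<infinity>"
    proof
      assume "\<exists>F\<in>sobolev m p. \<forall>x\<in>E. F x = f x"
      then obtain F where F: "F \<in> sobolev m p" "\<forall>x\<in>E. F x = f x" by blast
      have "?W \<le> ereal (N * sobolev_norm m p F)" by (rule nec[OF F])
      also have "\<dots> < \<infinity>" by simp
      finally show "?W < \<infinity>" .
    next
      assume "?W < \<infinity>"
      then show "\<exists>F\<in>sobolev m p. \<forall>x\<in>E. F x = f x" using suff' by blast
    qed
    show "ereal (inverse C) * ?W \<le> sobolev_trace_norm m p E f"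
      unfolding sobolev_trace_norm_def
    proof (rule INF_greatest)
      fix F assume "F \<in> {F \<in> sobolev m p. \<forall>x\<in>E. F x = f x}"
      then have F: "F \<in> sobolev m p" "\<forall>x\<in>E. F x = f x" by simp_all
      have n0: "0 \<le> sobolev_norm m p F" unfolding sobolev_norm_def Lp_norm_def by (intro sum_nonneg) simp
      have "ereal (inverse C) * ?W \<le> ereal (inverse C) * ereal (N * sobolev_norm m p F)"
        using C(1) by (intro ereal_mult_left_mono nec[OF F]) simp
      also have "\<dots> = ereal (inverse C * N * sobolev_norm m p F)" by simp
      also have "\<dots> \<le> ereal (1 * sobolev_norm m p F)"
      proof -
        have "inverse C * N \<le> 1" using C by (simp add: field_simps)
        then have "inverse C * N * sobolev_norm m p F \<le> 1 * sobolev_norm m p F" using n0 by (rule mult_right_mono)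
        then show ?thesis by simp
      qed
      finally show "ereal (inverse C) * ?W \<le> ereal (sobolev_norm m p F)" by simp
    qed
    show "sobolev_trace_norm m p E f \<le> ereal C * ?W"
    proof (cases "?W < \<infinity>")
      case True
      then obtain A F where A: "A \<ge> 0" "?W = ereal A" and F: "F \<in> sobolev m p" "\<forall>x\<in>E. F x = f x" "sobolev_norm m p F \<le> K * A"
        using suff' by blast
      have "sobolev_trace_norm m p E f \<le> ereal (sobolev_norm m p F)"
        unfolding sobolev_trace_norm_def by (rule INF_lower) (use F in simp)
      also have "\<dots> \<le> ereal (C * A)"
        using F(3) mult_right_mono[OF C(2) A(1)] by simp
      finally show ?thesis using A(2) by simp
    next
      case False
      then have "?W = \<infinity>" by simp
      then show ?thesis using C(1) by simp
    qed
  qed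
qed

end
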